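(* Let $p$ be a prime, let $P$ be a $p$-equipped poset, and let $(F,G)$ be a pair of fields where $G$ is a normal extension of $F$ of degree $p$ with $G=F(\xi)$, $\xi^p=q\in F$. Let $A=(\mathrm{End}_F G)^{op}$ and let $\mathcal T=\{\mathcal T_{x,y}=A_\ell\mid x\le^\ell y\}_{x,y\in P}$, where $A_\ell=\{\sum_{i=0}^{\ell-1}\mu_{g_i}\vartheta^i\mid g_i\in G\}$. If $\mathrm{Rep}\,P$ is the category of representations of $P$ over $(F,G)$, then there is an equivalence of categories $$\mathrm{Rep}\,P\cong \mathrm{Rep}(P,A,\mathcal T).$$
   Context: A finite poset $(P,\le)$ is $p$-equipped if to each pair $x\le y$ is assigned exactly one value $\ell\in\{1,\dots,p\}$, written $x\le^\ell y$, such that $x\le^\ell y\le^m z$ and $x\le^n z$ imply $n\ge\min\{\ell+m-1,p\}$. If $\mathrm{char}\,F=p$, then $G/F$ is purely inseparable and $\delta:G\to G$ denotes the $F$-linear derivation with $\delta(a)=0$ for $a\in F$ and $\delta(\xi^i)=i\xi^{i-1}$ for $i<p$. If $\mathrm{char}\,F\ne p$, $\sigma$ denotes a fixed generator of the (cyclic) Galois group of $G/F$. Put $\vartheta=\delta$ if $\mathrm{char}\,F=p$ and $\vartheta=\sigma$ if $\mathrm{char}\,F\neq p$. For $g\in G$, $\mu_g\in\mathrm{End}_FG$ is multiplication by $g$. The product in $A$ is $h*h'=h'h$. For a $G$-vector space $V$: if $\mathrm{char}\,F=p$, a $\delta$-derivation is an $F$-linear $d:V\to V$ with $d^p=0$ and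 $d(vg)=d(v)g+v\delta(g)$; if $\mathrm{char}\,F\ne p$, a $\sigma$-action is an $F$-linear $s:V\to V$ with $s^p=\mathrm{id}_V$ and $s(va)=s(v)\sigma(a)$. $\mathrm{Rep}\,P$: objects are collections $(V,r;V_x:x\in P)$, where $V$ is a $G$-vector space, $r$ is a $\sigma$-action if $\mathrm{char}\,F\ne p$ (a $\delta$-derivation if $\mathrm{char}\,F=p$), each $V_x$ is a $G$-subspace, and $x\le^\ell y$ implies $\sum_{i=0}^{\ell-1}r^i(V_x)\subseteq V_y$. Morphisms are $G$-linear maps $\psi:V\to V'$ with $\psi r=r'\psi$ and $\psi(V_x)\subseteq V_x'$ for all $x$. $\mathrm{Rep}(P,A,\mathcal T)$: objects are collections $(V,V_x:x\in P)$, where $V$ is a right $A$-module and each $V_x$ is an $F$-subspace with $V_x\mathcal T_{x,y}\subseteq V_y$ for all $x\le y$ (and $v1_x=v$ for $v\in V_x$, where $1_x$ is the unit of the algebra $\mathcal T_{x,x}$, which is the unit of $A$). Morphisms are right $A$-module morphisms $h:V\to V'$ with $h(V_x)\subseteq V'_x$ for all $x$. *)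

theory Defs
  imports "HOL-Algebra.Algebra"
begin

section \<open>Categories and equivalence\<close>

text \<open>
  Hom-sets are indexed by source and target, so they need not be disjoint; for the same reason
  composition and the arrow part of a functor carry the objects involved. \<open>arr_comp C a b c g f\<close> is
  the composite of \<open>f : a \<rightarrow> b\<close> followed by \<open>g : b \<rightarrow> c\<close>.
\<close>

record ('o, 'm) category =
  objs :: "'o set"
  arrs :: "'o \<Rightarrow> 'o \<Rightarrow> 'm set"
  arr_comp :: "'o \<Rightarrow> 'o \<Rightarrow> 'o \<Rightarrow> 'm \<Rightarrow> 'm \<Rightarrow> 'm"
  ident :: "'o \<Rightarrow> 'm"

locale is_category =
  fixes C :: "('o, 'm) category"
  assumes ident_arr: "a \<in> objs C \<Longrightarrow> ident C a \<in> arrs C a a"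
    and comp_arr: "\<lbrakk>a \<in> objs C; b \<in> objs C; c \<in> objs C; f \<in> arrs C a b; g \<in> arrs C b c\<rbrakk>
      \<Longrightarrow> arr_comp C a b c g f \<in> arrs C a c"
    and ident_left: "\<lbrakk>a \<in> objs C; b \<in> objs C; f \<in> arrs C a b\<rbrakk>
      \<Longrightarrow> arr_comp C a b b (ident C b) f = f"
    and ident_right: "\<lbrakk>a \<in> objs C; b \<in> objs C; f \<in> arrs C a b\<rbrakk>
      \<Longrightarrow> arr_comp C a a b f (ident C a) = f"
    and comp_assoc: "\<lbrakk>a \<in> objs C; b \<in> objs C; c \<in> objs C; d \<in> objs C;
        f \<in> arrs C a b; g \<in> arrs C b c; h \<in> arrs C c d\<rbrakk>
      \<Longrightarrow> arr_comp C a c d h (arr_comp C a b c g f) = arr_comp C a b d (arr_comp C b c d h g) f"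

locale is_functor =
  fixes C :: "('o, 'm) category" and D :: "('q, 'n) category"
    and F0 :: "'o \<Rightarrow> 'q" and F1 :: "'o \<Rightarrow> 'o \<Rightarrow> 'm \<Rightarrow> 'n"
  assumes map_obj: "a \<in> objs C \<Longrightarrow> F0 a \<in> objs D"
    and map_arr: "\<lbrakk>a \<in> objs C; b \<in> objs C; f \<in> arrs C a b\<rbrakk>
      \<Longrightarrow> F1 a b f \<in> arrs D (F0 a) (F0 b)"
    and map_ident: "a \<in> objs C \<Longrightarrow> F1 a a (ident C a) = ident D (F0 a)"
    and map_comp: "\<lbrakk>a \<in> objs C; b \<in> objs C; c \<in> objs C; f \<in> arrs C a b; g \<in> arrs C b c\<rbrakk>
      \<Longrightarrow> F1 a c (arr_comp C a b c g f) = arr_comp D (F0 a) (F0 b) (F0 c) (F1 b c g) (F1 a b f)"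

definition is_iso :: "('o, 'm) category \<Rightarrow> 'o \<Rightarrow> 'o \<Rightarrow> 'm \<Rightarrow> bool" where
  "is_iso C a b f \<longleftrightarrow> f \<in> arrs C a b \<and>
     (\<exists>g \<in> arrs C b a. arr_comp C a b a g f = ident C a \<and> arr_comp C b a b f g = ident C b)"

locale is_natural_iso =
  fixes C :: "('o, 'm) category" and D :: "('q, 'n) category"
    and F0 :: "'o \<Rightarrow> 'q" and F1 :: "'o \<Rightarrow> 'o \<Rightarrow> 'm \<Rightarrow> 'n"
    and G0 :: "'o \<Rightarrow> 'q" and G1 :: "'o \<Rightarrow> 'o \<Rightarrow> 'm \<Rightarrow> 'n"
    and \<eta> :: "'o \<Rightarrow> 'n"
  assumes component_iso: "a \<in> objs C \<Longrightarrow> is_iso D (F0 a) (G0 a) (\<eta> a)"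
    and naturality: "\<lbrakk>a \<in> objs C; b \<in> objs C; f \<in> arrs C a b\<rbrakk>
      \<Longrightarrow> arr_comp D (F0 a) (F0 b) (G0 b) (\<eta> b) (F1 a b f)
        = arr_comp D (F0 a) (G0 a) (G0 b) (G1 a b f) (\<eta> a)"

definition equivalent_categories :: "('o, 'm) category \<Rightarrow> ('q, 'n) category \<Rightarrow> bool" where
  "equivalent_categories C D \<longleftrightarrow> is_category C \<and> is_category D \<and>
     (\<exists>F0 F1 G0 G1 \<eta> \<epsilon>.
        is_functor C D F0 F1 \<and> is_functor D C G0 G1 \<and>
        is_natural_iso C C (\<lambda>a. a) (\<lambda>a b f. f) (\<lambda>a. G0 (F0 a)) (\<lambda>a b f. G1 (F0 a) (F0 b) (F1 a b f)) \<eta> \<and>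
        is_natural_iso D D (\<lambda>a. F0 (G0 a)) (\<lambda>a b f. F1 (G0 a) (G0 b) (G1 a b f)) (\<lambda>a. a) (\<lambda>a b f. f) \<epsilon>)"


section \<open>Equipped posets\<close>

text \<open>
  The order is \<open>leq\<close>; \<open>x \<le>\<^sup>l y\<close> is \<open>(x, y) \<in> leq \<and> lvl x y = l\<close>. Values of \<open>lvl\<close> off \<open>leq\<close> are
  irrelevant.
\<close>

locale equipped_poset =
  fixes p :: nat and P :: "'x set" and leq :: "'x rel" and lvl :: "'x \<Rightarrow> 'x \<Rightarrow> nat"
  assumes finite_poset: "finite P"
    and order: "partial_order_on P leq"
    and lvl_range: "(x, y) \<in> leq \<Longrightarrow> lvl x y \<in> {1..p}"
    and lvl_trans: "\<lbrakk>(x, y) \<in> leq; (y, z) \<in> leq\<rbrakk> \<Longrightarrow> lvl x z \<ge> min (lvl x y + lvl y z - 1) p"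


section \<open>Fields\<close>

text \<open>The additive order of the unit, which \<^const>\<open>group.ord\<close> sets to 0 when it is infinite.\<close>

definition ring_char :: "('a, 'b) ring_scheme \<Rightarrow> nat" where
  "ring_char R = group.ord (add_monoid R) \<one>\<^bsub>R\<^esub>"

definition normal_extension :: "'g ring \<Rightarrow> 'g set \<Rightarrow> bool" where
  "normal_extension G F \<longleftrightarrow>
     (\<forall>a \<in> carrier G. ring.algebraic G F a) \<and>
     (\<forall>f \<in> carrier (univ_poly G F). pirreducible\<^bsub>G\<^esub> F f \<longrightarrow>
        (\<exists>a \<in> carrier G. ring.eval G f a = \<zero>\<^bsub>G\<^esub>) \<longrightarrow> ring.splitted G f)"

text \<open>Maps are extensional, so that equality of maps is equality on the carrier.\<close>

definition galois_group :: "'g ring \<Rightarrow> 'g set \<Rightarrow> ('g \<Rightarrow> 'g) monoid" where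
  "galois_group G F =
     \<lparr> carrier = {f \<in> ring_iso G G \<inter> extensional (carrier G). \<forall>a \<in> F. f a = a},
       monoid.mult = compose (carrier G),
       one = (\<lambda>x \<in> carrier G. x) \<rparr>"

definition galois_generator :: "'g ring \<Rightarrow> 'g set \<Rightarrow> ('g \<Rightarrow> 'g) \<Rightarrow> bool" where
  "galois_generator G F \<sigma> \<longleftrightarrow> \<sigma> \<in> carrier (galois_group G F) \<and>
     generate (galois_group G F) {\<sigma>} = carrier (galois_group G F)"


section \<open>Linear maps and endomorphism algebras\<close>

text \<open>
  For a right module the entry \<open>smult M a v\<close> of the record stands for \<open>v a\<close>; the definition of
  linear maps is the same for left and right modules.
\<close>

definition lin_maps ::
  "('a, 'r) ring_scheme \<Rightarrow> ('a, 'v) module \<Rightarrow> ('a, 'w) module \<Rightarrow> ('v \<Rightarrow> 'w) set" where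
  "lin_maps R M N = {f \<in> carrier M \<rightarrow>\<^sub>E carrier N.
     (\<forall>v \<in> carrier M. \<forall>w \<in> carrier M. f (v \<oplus>\<^bsub>M\<^esub> w) = f v \<oplus>\<^bsub>N\<^esub> f w) \<and>
     (\<forall>a \<in> carrier R. \<forall>v \<in> carrier M. f (a \<odot>\<^bsub>M\<^esub> v) = a \<odot>\<^bsub>N\<^esub> f v)}"

locale right_module = A?: ring A + M?: abelian_group M
  for A :: "('a, 'r) ring_scheme" and M :: "('a, 'v) module" +
  assumes act_closed: "\<lbrakk>a \<in> carrier A; v \<in> carrier M\<rbrakk> \<Longrightarrow> a \<odot>\<^bsub>M\<^esub> v \<in> carrier M"
    and act_add_ring: "\<lbrakk>a \<in> carrier A; b \<in> carrier A; v \<in> carrier M\<rbrakk>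
      \<Longrightarrow> (a \<oplus>\<^bsub>A\<^esub> b) \<odot>\<^bsub>M\<^esub> v = a \<odot>\<^bsub>M\<^esub> v \<oplus>\<^bsub>M\<^esub> b \<odot>\<^bsub>M\<^esub> v"
    and act_add_module: "\<lbrakk>a \<in> carrier A; v \<in> carrier M; w \<in> carrier M\<rbrakk>
      \<Longrightarrow> a \<odot>\<^bsub>M\<^esub> (v \<oplus>\<^bsub>M\<^esub> w) = a \<odot>\<^bsub>M\<^esub> v \<oplus>\<^bsub>M\<^esub> a \<odot>\<^bsub>M\<^esub> w"
    and act_mult: "\<lbrakk>a \<in> carrier A; b \<in> carrier A; v \<in> carrier M\<rbrakk>
      \<Longrightarrow> (a \<otimes>\<^bsub>A\<^esub> b) \<odot>\<^bsub>M\<^esub> v = b \<odot>\<^bsub>M\<^esub> (a \<odot>\<^bsub>M\<^esub> v)"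
    and act_one: "v \<in> carrier M \<Longrightarrow> \<one>\<^bsub>A\<^esub> \<odot>\<^bsub>M\<^esub> v = v"

definition self_module :: "'g ring \<Rightarrow> ('g, 'g) module" where
  "self_module G = \<lparr> carrier = carrier G, monoid.mult = monoid.mult G, one = \<one>\<^bsub>G\<^esub>,
     ring.zero = \<zero>\<^bsub>G\<^esub>, add = add G, smult = monoid.mult G \<rparr>"

definition end_algebra :: "'g ring \<Rightarrow> 'g set \<Rightarrow> ('g, 'g \<Rightarrow> 'g) module" where
  "end_algebra G F =
     \<lparr> carrier = lin_maps (G\<lparr>carrier := F\<rparr>) (self_module G) (self_module G),
       monoid.mult = compose (carrier G),
       one = (\<lambda>x \<in> carrier G. x),
       ring.zero = (\<lambda>x \<in> carrier G. \<zero>\<^bsub>G\<^esub>),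
       add = (\<lambda>f g. \<lambda>x \<in> carrier G. f x \<oplus>\<^bsub>G\<^esub> g x),
       smult = (\<lambda>a f. \<lambda>x \<in> carrier G. a \<otimes>\<^bsub>G\<^esub> f x) \<rparr>"

definition opposite_algebra :: "('f, 'a) module \<Rightarrow> ('f, 'a) module" where
  "opposite_algebra A = A\<lparr>monoid.mult := (\<lambda>h h'. h' \<otimes>\<^bsub>A\<^esub> h)\<rparr>"

definition mult_by :: "'g ring \<Rightarrow> 'g \<Rightarrow> 'g \<Rightarrow> 'g" where
  "mult_by G g = (\<lambda>x \<in> carrier G. g \<otimes>\<^bsub>G\<^esub> x)"


section \<open>The maps \<open>\<delta>\<close>, \<open>\<sigma>\<close>, \<open>\<theta>\<close> and the subspaces \<open>A\<^sub>l\<close>\<close>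

definition standard_derivation :: "'g ring \<Rightarrow> 'g set \<Rightarrow> nat \<Rightarrow> 'g \<Rightarrow> ('g \<Rightarrow> 'g) \<Rightarrow> bool" where
  "standard_derivation G F p \<xi> \<delta> \<longleftrightarrow>
     \<delta> \<in> lin_maps (G\<lparr>carrier := F\<rparr>) (self_module G) (self_module G) \<and>
     (\<forall>a \<in> carrier G. \<forall>b \<in> carrier G. \<delta> (a \<otimes>\<^bsub>G\<^esub> b) = \<delta> a \<otimes>\<^bsub>G\<^esub> b \<oplus>\<^bsub>G\<^esub> a \<otimes>\<^bsub>G\<^esub> \<delta> b) \<and>
     (\<forall>a \<in> F. \<delta> a = \<zero>\<^bsub>G\<^esub>) \<and>
     (\<forall>i<p. \<delta> (\<xi> [^]\<^bsub>G\<^esub> i) = [i] \<cdot>\<^bsub>G\<^esub> (\<xi> [^]\<^bsub>G\<^esub> (i - 1)))"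

definition theta ::
  "'g ring \<Rightarrow> 'g set \<Rightarrow> nat \<Rightarrow> ('g \<Rightarrow> 'g) \<Rightarrow> ('g \<Rightarrow> 'g) \<Rightarrow> 'g \<Rightarrow> 'g" where
  "theta G F p \<delta> \<sigma> = (if ring_char (G\<lparr>carrier := F\<rparr>) = p then \<delta> else \<sigma>)"

text \<open>The products and powers here are those of \<open>End\<^sub>F G\<close>, not of its opposite.\<close>

definition A_layer :: "'g ring \<Rightarrow> 'g set \<Rightarrow> ('g \<Rightarrow> 'g) \<Rightarrow> nat \<Rightarrow> ('g \<Rightarrow> 'g) set" where
  "A_layer G F \<theta> l =
     (let E = end_algebra G F in
      {(\<Oplus>\<^bsub>E\<^esub> i \<in> {..<l}. mult_by G (g i) \<otimes>\<^bsub>E\<^esub> (\<theta> [^]\<^bsub>E\<^esub> i)) | g. g \<in> {..<l} \<rightarrow> carrier G})"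


section \<open>Representations over \<open>(F, G)\<close>\<close>

definition delta_derivation ::
  "'g ring \<Rightarrow> 'g set \<Rightarrow> nat \<Rightarrow> ('g \<Rightarrow> 'g) \<Rightarrow> ('g, 'v) module \<Rightarrow> ('v \<Rightarrow> 'v) \<Rightarrow> bool" where
  "delta_derivation G F p \<delta> V d \<longleftrightarrow>
     d \<in> lin_maps (G\<lparr>carrier := F\<rparr>) V V \<and>
     (\<forall>v \<in> carrier V. (d ^^ p) v = \<zero>\<^bsub>V\<^esub>) \<and>
     (\<forall>g \<in> carrier G. \<forall>v \<in> carrier V. d (g \<odot>\<^bsub>V\<^esub> v) = g \<odot>\<^bsub>V\<^esub> d v \<oplus>\<^bsub>V\<^esub> \<delta> g \<odot>\<^bsub>V\<^esub> v)"

definition sigma_action ::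
  "'g ring \<Rightarrow> 'g set \<Rightarrow> nat \<Rightarrow> ('g \<Rightarrow> 'g) \<Rightarrow> ('g, 'v) module \<Rightarrow> ('v \<Rightarrow> 'v) \<Rightarrow> bool" where
  "sigma_action G F p \<sigma> V s \<longleftrightarrow>
     s \<in> lin_maps (G\<lparr>carrier := F\<rparr>) V V \<and>
     (\<forall>v \<in> carrier V. (s ^^ p) v = v) \<and>
     (\<forall>g \<in> carrier G. \<forall>v \<in> carrier V. s (g \<odot>\<^bsub>V\<^esub> v) = \<sigma> g \<odot>\<^bsub>V\<^esub> s v)"

text \<open>
  The underlying sets of the representations are subsets of the type \<open>'v\<close>, which plays the role of
  the universe. The last condition on objects says that the sum of the subspaces
  \<open>r\<^sup>i (V\<^sub>x)\<close> for \<open>i < l\<close> lies in \<open>V\<^sub>y\<close>.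
\<close>

definition Rep ::
  "'g ring \<Rightarrow> 'g set \<Rightarrow> nat \<Rightarrow> ('g \<Rightarrow> 'g) \<Rightarrow> ('g \<Rightarrow> 'g) \<Rightarrow> 'x set \<Rightarrow> 'x rel \<Rightarrow> ('x \<Rightarrow> 'x \<Rightarrow> nat)
   \<Rightarrow> (('g, 'v) module \<times> ('v \<Rightarrow> 'v) \<times> ('x \<Rightarrow> 'v set), 'v \<Rightarrow> 'v) category" where
  "Rep G F p \<delta> \<sigma> P leq lvl =
     \<lparr> objs = {(V, r, U).
         module G V \<and>
         (if ring_char (G\<lparr>carrier := F\<rparr>) = p then delta_derivation G F p \<delta> V r
          else sigma_action G F p \<sigma> V r) \<and>
         U \<in> P \<rightarrow>\<^sub>E {W. submodule W G V} \<and>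
         (\<forall>(x, y) \<in> leq.
            {(\<Oplus>\<^bsub>V\<^esub> i \<in> {..<lvl x y}. (r ^^ i) (w i)) | w. w \<in> {..<lvl x y} \<rightarrow> U x} \<subseteq> U y)},
       arrs = (\<lambda>(V, r, U) (V', r', U').
         {\<psi> \<in> lin_maps G V V'.
            (\<forall>v \<in> carrier V. \<psi> (r v) = r' (\<psi> v)) \<and> (\<forall>x \<in> P. \<psi> ` U x \<subseteq> U' x)}),
       arr_comp = (\<lambda>(V, _, _) _ _ g f. compose (carrier V) g f),
       ident = (\<lambda>(V, _, _). \<lambda>v \<in> carrier V. v) \<rparr>"


section \<open>Representations over a system of subspaces of an algebra\<close>

text \<open>
  For an algebra \<open>A\<close> over a field \<open>K\<close>, the \<open>K\<close>-vector space underlying a right \<open>A\<close>-module, where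
  \<open>a \<in> K\<close> acts through \<open>a \<cdot> 1\<^sub>A\<close>.
\<close>

definition restrict_scalars :: "('f, 'a) module \<Rightarrow> ('a, 'v) module \<Rightarrow> ('f, 'v) module" where
  "restrict_scalars A V = \<lparr> carrier = carrier V, monoid.mult = monoid.mult V,
     one = \<one>\<^bsub>V\<^esub>, ring.zero = \<zero>\<^bsub>V\<^esub>, add = add V, smult = (\<lambda>a v. (a \<odot>\<^bsub>A\<^esub> \<one>\<^bsub>A\<^esub>) \<odot>\<^bsub>V\<^esub> v) \<rparr>"

definition Rep_alg ::
  "('f, 'k) ring_scheme \<Rightarrow> ('f, 'a) module \<Rightarrow> ('x \<Rightarrow> 'x \<Rightarrow> 'a set) \<Rightarrow> 'x set \<Rightarrow> 'x rel
   \<Rightarrow> (('a, 'v) module \<times> ('x \<Rightarrow> 'v set), 'v \<Rightarrow> 'v) category" where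
  "Rep_alg K A T P leq =
     \<lparr> objs = {(V, U).
         right_module A V \<and>
         U \<in> P \<rightarrow>\<^sub>E {W. submodule W K (restrict_scalars A V)} \<and>
         (\<forall>(x, y) \<in> leq. \<forall>v \<in> U x. \<forall>t \<in> T x y. t \<odot>\<^bsub>V\<^esub> v \<in> U y) \<and>
         (\<forall>x \<in> P. \<forall>v \<in> U x. \<one>\<^bsub>A\<^esub> \<odot>\<^bsub>V\<^esub> v = v)},
       arrs = (\<lambda>(V, U) (V', U'). {h \<in> lin_maps A V V'. \<forall>x \<in> P. h ` U x \<subseteq> U' x}),
       arr_comp = (\<lambda>(V, _) _ _ g f. compose (carrier V) g f),
       ident = (\<lambda>(V, _). \<lambda>v \<in> carrier V. v) \<rparr>"

end

theory Submission
  imports Defs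
begin

text \<open>
  Every \<open>f \<in> End\<^sub>F G\<close> is uniquely a left skew polynomial \<open>\<Sum> g\<^sub>i \<theta>\<^sup>i\<close> with \<open>i < p\<close>: for
  \<open>\<theta> = \<delta>\<close> the matrix of the \<open>\<delta>\<^sup>j\<close> on the powers of \<open>\<xi>\<close> is triangular with diagonal \<open>i!\<close>, and for
  \<open>\<theta> = \<sigma>\<close> it is the discrete Fourier matrix of \<open>\<zeta> = \<sigma> \<xi> / \<xi>\<close>, a primitive \<open>p\<close>-th root of unity lying
  in \<open>F\<close>. Hence a \<open>G\<close>-space with a twisted operator \<open>r\<close> is the same as a right \<open>A\<close>-module, where
  \<open>\<Sum> g\<^sub>i \<theta>\<^sup>i\<close> acts as \<open>\<Sum> g\<^sub>i r\<^sup>i\<close>, and in this dictionary \<open>A\<^sub>l\<close> maps \<open>V\<^sub>x\<close> into \<open>V\<^sub>y\<close> iff all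
  \<open>r\<^sup>i\<close> with \<open>i < l\<close> do. Both functors keep the underlying sets and maps.
\<close>

section \<open>Categories of structured sets\<close>

text \<open>The action of \<open>A\<close> on \<open>V\<close> has to be read off coefficients of
  expansions, and its multiplicativity is the obstacle. No product formula for skew polynomials is
  used. Instead \<open>G\<close> with \<open>\<theta>\<close> is itself one of the modules under
  study: an identity between series proved for all of them holds in \<open>G\<close>, where
  uniqueness identifies the coefficients, and in \<open>V\<close>, where it then describes the
  action. Only left factors \<open>mult_by G g\<close> and \<open>\<theta>\<close> need this, as
  they generate.

  The Fourier matrix is invertible because p is nonzero in \<open>G\<close> and \<zeta> \<noteq> 1.
  The latter says that \<sigma> moves \<xi>, although the generator of a trivial group would be the
  identity. So a nontrivial automorphism is built: by normality the minimal polynomial of \<xi>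
  splits, p \<noteq> 0 makes \<xi> a simple root, and \<xi> can be sent to another root. Primality
  of p makes \<zeta> primitive. It lies in \<open>F\<close> because its degree over \<open>F\<close>
  divides p and is less than p.

  A representation over \<open>A\<close> has only \<open>F\<close>-subspaces; they are
  \<open>G\<close>-subspaces because x \<le> x carries a level of at least 1.\<close>

locale structured_sets =
  fixes C :: "('o, 'v \<Rightarrow> 'v) category" and U :: "'o \<Rightarrow> 'v set"
  assumes arr_funcset: "\<lbrakk>a \<in> objs C; b \<in> objs C; f \<in> arrs C a b\<rbrakk> \<Longrightarrow> f \<in> U a \<rightarrow>\<^sub>E U b"
    and comp_eq: "arr_comp C a b c g f = compose (U a) g f"
    and ident_eq: "ident C a = (\<lambda>v \<in> U a. v)"
    and ident_in: "a \<in> objs C \<Longrightarrow> (\<lambda>v \<in> U a. v) \<in> arrs C a a"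
    and comp_in: "\<lbrakk>a \<in> objs C; b \<in> objs C; c \<in> objs C; f \<in> arrs C a b; g \<in> arrs C b c\<rbrakk>
      \<Longrightarrow> compose (U a) g f \<in> arrs C a c"

lemma compose_restrict_id_left: "f \<in> A \<rightarrow>\<^sub>E B \<Longrightarrow> compose A (\<lambda>v \<in> B. v) f = f"
  by (auto simp: compose_def fun_eq_iff PiE_iff extensional_def)

lemma compose_restrict_id_right: "f \<in> A \<rightarrow>\<^sub>E B \<Longrightarrow> compose A f (\<lambda>v \<in> A. v) = f"
  by (auto simp: compose_def fun_eq_iff PiE_iff extensional_def)

lemma (in structured_sets) is_category: "is_category C"
proof
  show "arr_comp C a b b (ident C b) f = f" if "a \<in> objs C" "b \<in> objs C" "f \<in> arrs C a b" for a b f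
    using arr_funcset[OF that] by (simp add: comp_eq ident_eq compose_restrict_id_left)
  show "arr_comp C a a b f (ident C a) = f" if "a \<in> objs C" "b \<in> objs C" "f \<in> arrs C a b" for a b f
    using arr_funcset[OF that] by (simp add: comp_eq ident_eq compose_restrict_id_right)
  show "arr_comp C a c d h (arr_comp C a b c g f) = arr_comp C a b d (arr_comp C b c d h g) f"
    if "a \<in> objs C" "b \<in> objs C" "c \<in> objs C" "d \<in> objs C"
      "f \<in> arrs C a b" "g \<in> arrs C b c" "h \<in> arrs C c d" for a b c d f g h
    using arr_funcset[OF that(1,2,5)] by (auto simp: comp_eq compose_def fun_eq_iff)
qed (simp_all add: comp_eq ident_eq ident_in comp_in)

text \<open>Serves functors that change the structure on a set and leave every map alone, so
  functoriality and naturality reduce to facts on \<open>compose\<close>. The round trip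
  \<open>H (F a)\<close> need not equal \<open>a\<close>, as records may disagree outside the
  carriers; hence the identity map is only asked to be an arrow in both directions.\<close>

lemma equivalent_structured_sets:
  assumes C: "structured_sets C U" and D: "structured_sets D W"
    and F_obj: "\<And>a. a \<in> objs C \<Longrightarrow> F a \<in> objs D" and F_set: "\<And>a. W (F a) = U a"
    and F_arr: "\<And>a b f. \<lbrakk>a \<in> objs C; b \<in> objs C; f \<in> arrs C a b\<rbrakk> \<Longrightarrow> f \<in> arrs D (F a) (F b)"
    and H_obj: "\<And>a. a \<in> objs D \<Longrightarrow> H a \<in> objs C" and H_set: "\<And>a. U (H a) = W a"
    and H_arr: "\<And>a b f. \<lbrakk>a \<in> objs D; b \<in> objs D; f \<in> arrs D a b\<rbrakk> \<Longrightarrow> f \<in> arrs C (H a) (H b)"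
    and unit: "\<And>a. a \<in> objs C \<Longrightarrow> (\<lambda>v \<in> U a. v) \<in> arrs C a (H (F a))"
      "\<And>a. a \<in> objs C \<Longrightarrow> (\<lambda>v \<in> U a. v) \<in> arrs C (H (F a)) a"
    and counit: "\<And>a. a \<in> objs D \<Longrightarrow> (\<lambda>v \<in> W a. v) \<in> arrs D (F (H a)) a"
      "\<And>a. a \<in> objs D \<Longrightarrow> (\<lambda>v \<in> W a. v) \<in> arrs D a (F (H a))"
  shows "equivalent_categories C D"
proof -
  interpret C: structured_sets C U by fact
  interpret D: structured_sets D W by fact
  have id_id: "compose A (\<lambda>v \<in> A. v) (\<lambda>v \<in> A. v) = (\<lambda>v \<in> A. v)" for A :: "'b set"
    by (auto simp: compose_def)
  have "is_functor C D F (\<lambda>a b f. f)"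
    by unfold_locales (simp_all add: F_obj F_arr C.comp_eq D.comp_eq C.ident_eq D.ident_eq F_set)
  moreover have "is_functor D C H (\<lambda>a b f. f)"
    by unfold_locales (simp_all add: H_obj H_arr C.comp_eq D.comp_eq C.ident_eq D.ident_eq H_set)
  moreover have "is_natural_iso C C (\<lambda>a. a) (\<lambda>a b f. f) (\<lambda>a. H (F a)) (\<lambda>a b f. f)
      (\<lambda>a. \<lambda>v \<in> U a. v)"
  proof
    show "is_iso C a (H (F a)) (\<lambda>v \<in> U a. v)" if "a \<in> objs C" for a
      unfolding is_iso_def using unit[OF that]
      by (auto simp: C.comp_eq C.ident_eq H_set F_set id_id intro!: bexI[of _ "\<lambda>v \<in> U a. v"])
    show "arr_comp C a b (H (F b)) (\<lambda>v \<in> U b. v) f = arr_comp C a (H (F a)) (H (F b)) f (\<lambda>v \<in> U a. v)"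
      if "a \<in> objs C" "b \<in> objs C" "f \<in> arrs C a b" for a b f
      using C.arr_funcset[OF that]
      by (simp add: C.comp_eq compose_restrict_id_left compose_restrict_id_right)
  qed
  moreover have "is_natural_iso D D (\<lambda>a. F (H a)) (\<lambda>a b f. f) (\<lambda>a. a) (\<lambda>a b f. f)
      (\<lambda>a. \<lambda>v \<in> W a. v)"
  proof
    show "is_iso D (F (H a)) a (\<lambda>v \<in> W a. v)" if "a \<in> objs D" for a
      unfolding is_iso_def using counit[OF that]
      by (auto simp: D.comp_eq D.ident_eq H_set F_set id_id intro!: bexI[of _ "\<lambda>v \<in> W a. v"])
    show "arr_comp D (F (H a)) (F (H b)) b (\<lambda>v \<in> W b. v) f = arr_comp D (F (H a)) a b f (\<lambda>v \<in> W a. v)"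
      if "a \<in> objs D" "b \<in> objs D" "f \<in> arrs D a b" for a b f
      using D.arr_funcset[OF that] H_set F_set
      by (simp add: D.comp_eq compose_restrict_id_left compose_restrict_id_right)
  qed
  ultimately show ?thesis
    unfolding equivalent_categories_def using C.is_category D.is_category by blast
qed

section \<open>Sums and linear maps\<close>

context abelian_monoid begin

lemma finsum_lessThan_Suc:
  "f \<in> {..<Suc n} \<rightarrow> carrier G \<Longrightarrow> (\<Oplus>i\<in>{..<Suc n}. f i) = (\<Oplus>i\<in>{..<n}. f i) \<oplus> f n"
  by (subst lessThan_Suc, subst finsum_insert) (auto simp: Pi_iff a_comm)

text \<open>Isolates index 0 instead of the last index; together with
  \<open>finsum_lessThan_Suc\<close> it carries out cyclic shifts of coefficients.\<close>

lemma finsum_lessThan_Suc_shift: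
  assumes "f \<in> {..<Suc n} \<rightarrow> carrier G"
  shows "(\<Oplus>i\<in>{..<Suc n}. f i) = f 0 \<oplus> (\<Oplus>i\<in>{..<n}. f (Suc i))"
  using assms
proof (induction n)
  case (Suc n)
  have "(\<Oplus>i\<in>{..<Suc (Suc n)}. f i) = (f 0 \<oplus> (\<Oplus>i\<in>{..<n}. f (Suc i))) \<oplus> f (Suc n)"
    using Suc.prems by (subst finsum_lessThan_Suc) (auto simp: Pi_iff Suc.IH)
  also have "\<dots> = f 0 \<oplus> (\<Oplus>i\<in>{..<Suc n}. f (Suc i))"
    using Suc.prems by (subst finsum_lessThan_Suc) (auto simp: Pi_iff intro!: a_assoc finsum_closed)
  finally show ?case .
qed (auto simp: finsum_lessThan_Suc Pi_iff)

lemma finsum_delta: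
  assumes "finite I" "j \<in> I" "a \<in> carrier G"
  shows "(\<Oplus>i\<in>I. if i = j then a else \<zero>) = a"
  using add.finprod_singleton_swap[OF assms(2,1), of "\<lambda>_. a"] assms(3) by (simp add: Pi_def)

lemma finsum_swap:
  assumes "finite A" "finite B" "\<And>i j. \<lbrakk>i \<in> A; j \<in> B\<rbrakk> \<Longrightarrow> f i j \<in> carrier G"
  shows "(\<Oplus>i\<in>A. \<Oplus>j\<in>B. f i j) = (\<Oplus>j\<in>B. \<Oplus>i\<in>A. f i j)"
  using assms(1,3)
proof (induction A rule: finite_induct)
  case empty
  then show ?case using finsum_zero by simp
next
  case (insert a A)
  have "(\<Oplus>i\<in>insert a A. \<Oplus>j\<in>B. f i j) = (\<Oplus>j\<in>B. f a j) \<oplus> (\<Oplus>j\<in>B. \<Oplus>i\<in>A. f i j)"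
    using insert by (subst finsum_insert) (auto intro!: finsum_closed)
  also have "\<dots> = (\<Oplus>j\<in>B. f a j \<oplus> (\<Oplus>i\<in>A. f i j))"
    using insert by (intro finsum_addf[symmetric]) (auto intro!: finsum_closed)
  also have "\<dots> = (\<Oplus>j\<in>B. \<Oplus>i\<in>insert a A. f i j)"
    using insert by (intro finsum_cong') (auto intro!: finsum_closed simp: finsum_insert Pi_iff)
  finally show ?case .
qed

end

lemma abelian_group_cong:
  assumes "abelian_group M" "carrier N = carrier M" "add N = add M" "\<zero>\<^bsub>N\<^esub> = \<zero>\<^bsub>M\<^esub>"
  shows "abelian_group N"
proof -
  interpret abelian_group M by fact
  show ?thesis
  proof (rule abelian_groupI)
    show "\<exists>y\<in>carrier N. y \<oplus>\<^bsub>N\<^esub> x = \<zero>\<^bsub>N\<^esub>" if "x \<in> carrier N" for x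
      using that assms(2-4) by (intro bexI[of _ "\<ominus>\<^bsub>M\<^esub> x"]) (auto simp: l_neg)
  qed (auto simp: assms(2-4) a_ac)
qed

lemma finsum_module_cong:
  assumes "abelian_group M" "carrier N = carrier M" "add N = add M" "\<zero>\<^bsub>N\<^esub> = \<zero>\<^bsub>M\<^esub>"
    and "h \<in> I \<rightarrow> carrier M"
  shows "finsum N h I = finsum M h I"
proof -
  interpret M: abelian_group M by fact
  interpret N: abelian_group N by (rule abelian_group_cong[OF assms(1-4)])
  show ?thesis using assms(5)
  proof (induction I rule: infinite_finite_induct)
    case (insert i I)
    then show ?case
      using M.finsum_insert[of I i h] N.finsum_insert[of I i h] assms(2-4) by (auto simp: Pi_iff)
  qed (simp_all add: assms(4) M.finsum_infinite N.finsum_infinite)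
qed

text \<open>The scalar rings \<open>R\<close> and \<open>S\<close> may differ: the additive part is
  shared, so only closure under the new scalars is in question. The passage goes from
  \<open>G\<close> down to \<open>F\<close> for one functor and from \<open>F\<close> up to
  \<open>G\<close> for the other.\<close>

lemma submodule_cong:
  assumes "carrier N = carrier M" "add N = add M" "\<zero>\<^bsub>N\<^esub> = \<zero>\<^bsub>M\<^esub>" "submodule W R M"
    and "\<And>a v. \<lbrakk>a \<in> carrier S; v \<in> W\<rbrakk> \<Longrightarrow> a \<odot>\<^bsub>N\<^esub> v \<in> W"
  shows "submodule W S N"
  using assms
  by (auto simp: submodule_def submodule_axioms_def subgroup_def m_inv_def)

lemma submodule_finsum:
  assumes "submodule W R M" "abelian_group M" "\<And>i. i \<in> I \<Longrightarrow> h i \<in> W"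
  shows "(\<Oplus>\<^bsub>M\<^esub>i\<in>I. h i) \<in> W"
proof -
  interpret W: submodule W R M by fact
  interpret M: abelian_group M by fact
  have W: "W \<subseteq> carrier M" using W.subset by simp
  show ?thesis using assms(3)
  proof (induction I rule: infinite_finite_induct)
    case (insert i I)
    have "(\<Oplus>\<^bsub>M\<^esub>j\<in>insert i I. h j) = h i \<oplus>\<^bsub>M\<^esub> (\<Oplus>\<^bsub>M\<^esub>j\<in>I. h j)"
      using insert W by (intro M.finsum_insert) auto
    then show ?case using insert W.m_closed by simp
  qed (use W.one_closed in \<open>simp_all add: M.finsum_infinite\<close>)
qed

lemma lin_mapsD:
  assumes "f \<in> lin_maps R M N"
  shows "\<And>v. v \<in> carrier M \<Longrightarrow> f v \<in> carrier N"
    and "f \<in> extensional (carrier M)"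
    and "\<And>v w. \<lbrakk>v \<in> carrier M; w \<in> carrier M\<rbrakk> \<Longrightarrow> f (v \<oplus>\<^bsub>M\<^esub> w) = f v \<oplus>\<^bsub>N\<^esub> f w"
    and "\<And>a v. \<lbrakk>a \<in> carrier R; v \<in> carrier M\<rbrakk> \<Longrightarrow> f (a \<odot>\<^bsub>M\<^esub> v) = a \<odot>\<^bsub>N\<^esub> f v"
  using assms by (auto simp: lin_maps_def PiE_iff)

lemma lin_maps_zero:
  assumes "f \<in> lin_maps R M N" "abelian_group M" "abelian_group N"
  shows "f \<zero>\<^bsub>M\<^esub> = \<zero>\<^bsub>N\<^esub>"
proof -
  interpret M: abelian_group M by fact
  interpret N: abelian_group N by fact
  have "f \<zero>\<^bsub>M\<^esub> \<oplus>\<^bsub>N\<^esub> f \<zero>\<^bsub>M\<^esub> = f \<zero>\<^bsub>M\<^esub>"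
    using lin_mapsD(3)[OF assms(1), of "\<zero>\<^bsub>M\<^esub>" "\<zero>\<^bsub>M\<^esub>"] by simp
  then show ?thesis
    using lin_mapsD(1)[OF assms(1), of "\<zero>\<^bsub>M\<^esub>"] by (metis M.zero_closed N.add.l_cancel_one')
qed

lemma lin_maps_finsum:
  assumes "f \<in> lin_maps R M N" "abelian_group M" "abelian_group N" "finite I" "g \<in> I \<rightarrow> carrier M"
  shows "f (\<Oplus>\<^bsub>M\<^esub>i\<in>I. g i) = (\<Oplus>\<^bsub>N\<^esub>i\<in>I. f (g i))"
proof -
  interpret M: abelian_group M by fact
  interpret N: abelian_group N by fact
  show ?thesis using assms(4,5)
  proof (induction I)
    case empty
    then show ?case by (simp add: lin_maps_zero[OF assms(1-3)])
  next
    case (insert i I)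
    have "f (\<Oplus>\<^bsub>M\<^esub>j\<in>insert i I. g j) = f (g i) \<oplus>\<^bsub>N\<^esub> f (\<Oplus>\<^bsub>M\<^esub>j\<in>I. g j)"
      using insert by (subst M.finsum_insert) (auto simp: lin_mapsD(3)[OF assms(1)])
    also have "\<dots> = (\<Oplus>\<^bsub>N\<^esub>j\<in>insert i I. f (g j))"
      using insert lin_mapsD(1)[OF assms(1)] by (subst N.finsum_insert) auto
    finally show ?case .
  qed
qed

lemma compose_lin_maps:
  assumes "f \<in> lin_maps R L M" "g \<in> lin_maps R M N" "abelian_group L"
    and smult: "\<And>a v. \<lbrakk>a \<in> carrier R; v \<in> carrier L\<rbrakk> \<Longrightarrow> a \<odot>\<^bsub>L\<^esub> v \<in> carrier L"
  shows "compose (carrier L) g f \<in> lin_maps R L N"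
proof -
  interpret abelian_group L by fact
  show ?thesis
    unfolding lin_maps_def
  proof (intro CollectI conjI ballI)
    show "compose (carrier L) g f \<in> carrier L \<rightarrow>\<^sub>E carrier N"
      using lin_mapsD(1)[OF assms(1)] lin_mapsD(1)[OF assms(2)] by (auto simp: compose_def)
  next
    fix v w assume "v \<in> carrier L" "w \<in> carrier L"
    then show "compose (carrier L) g f (v \<oplus>\<^bsub>L\<^esub> w)
        = compose (carrier L) g f v \<oplus>\<^bsub>N\<^esub> compose (carrier L) g f w"
      using add.m_closed[of v w]
      by (simp add: compose_def lin_mapsD[OF assms(1)] lin_mapsD[OF assms(2)])
  next
    fix a v assume "a \<in> carrier R" "v \<in> carrier L"
    then show "compose (carrier L) g f (a \<odot>\<^bsub>L\<^esub> v) = a \<odot>\<^bsub>N\<^esub> compose (carrier L) g f v"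
      using smult[of a v] by (simp add: compose_def lin_mapsD[OF assms(1)] lin_mapsD[OF assms(2)])
  qed
qed

text \<open>Covers records whose scalar actions agree on the carriers only, which is the situation
  of the unit and the counit.\<close>

lemma restrict_id_lin_maps:
  assumes "carrier N = carrier M" "add N = add M"
    and "\<And>a v. \<lbrakk>a \<in> carrier R; v \<in> carrier M\<rbrakk> \<Longrightarrow> a \<odot>\<^bsub>M\<^esub> v \<in> carrier M"
    and "\<And>a v. \<lbrakk>a \<in> carrier R; v \<in> carrier M\<rbrakk> \<Longrightarrow> a \<odot>\<^bsub>N\<^esub> v = a \<odot>\<^bsub>M\<^esub> v"
    and "abelian_group M"
  shows "(\<lambda>v \<in> carrier M. v) \<in> lin_maps R M N"
proof -
  interpret abelian_group M by fact
  show ?thesis using assms(1-4) by (auto simp: lin_maps_def)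
qed

section \<open>Endomorphism algebras\<close>

lemma ring_opposite_algebra:
  assumes "ring A" shows "ring (opposite_algebra A)"
proof -
  interpret ring A by fact
  have "abelian_group (opposite_algebra A)"
    using abelian_group_axioms
    unfolding abelian_group_def abelian_group_axioms_def abelian_monoid_def opposite_algebra_def
    by simp
  moreover have "monoid (opposite_algebra A)"
    by unfold_locales (auto simp: opposite_algebra_def m_assoc)
  ultimately show ?thesis
    by (intro ringI) (auto simp: opposite_algebra_def l_distr r_distr abelian_group.axioms)
qed

locale endomorphisms = cring G for G :: "'g ring" (structure) +
  fixes F :: "'g set"
  assumes sub: "F \<subseteq> carrier G"
begin

abbreviation K :: "'g ring" where "K \<equiv> G\<lparr>carrier := F\<rparr>"

abbreviation E :: "('g, 'g \<Rightarrow> 'g) module" where "E \<equiv> end_algebra G F"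

lemma self_module_simps [simp]:
  "carrier (self_module G) = carrier G" "\<zero>\<^bsub>self_module G\<^esub> = \<zero>"
  "x \<oplus>\<^bsub>self_module G\<^esub> y = x \<oplus> y" "x \<odot>\<^bsub>self_module G\<^esub> y = x \<otimes> y"
  by (simp_all add: self_module_def)

lemma E_simps [simp]:
  "\<one>\<^bsub>E\<^esub> = (\<lambda>x \<in> carrier G. x)" "\<zero>\<^bsub>E\<^esub> = (\<lambda>x \<in> carrier G. \<zero>)"
  "f \<oplus>\<^bsub>E\<^esub> g = (\<lambda>x \<in> carrier G. f x \<oplus> g x)" "f \<otimes>\<^bsub>E\<^esub> g = compose (carrier G) f g"
  "a \<odot>\<^bsub>E\<^esub> f = (\<lambda>x \<in> carrier G. a \<otimes> f x)"
  by (simp_all add: end_algebra_def)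

lemma abelian_group_self: "abelian_group (self_module G)"
  by (rule abelian_group_cong[OF abelian_group_axioms]) (simp_all add: self_module_def)

lemma module_self: "module G (self_module G)"
  by (intro module.intro is_cring abelian_group_self module_axioms.intro)
     (simp_all add: l_distr r_distr m_assoc)

lemma finsum_self [simp]: "h \<in> I \<rightarrow> carrier G \<Longrightarrow> finsum (self_module G) h I = finsum G h I"
  by (rule finsum_module_cong[OF abelian_group_axioms]) (simp_all add: self_module_def)

lemma carrier_E: "carrier E = lin_maps K (self_module G) (self_module G)"
  by (simp add: end_algebra_def)

lemma mem_E_iff: "f \<in> carrier E \<longleftrightarrow> f \<in> carrier G \<rightarrow>\<^sub>E carrier G
    \<and> (\<forall>x \<in> carrier G. \<forall>y \<in> carrier G. f (x \<oplus> y) = f x \<oplus> f y)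
    \<and> (\<forall>a \<in> F. \<forall>x \<in> carrier G. f (a \<otimes> x) = a \<otimes> f x)"
  by (simp add: carrier_E lin_maps_def)

lemma E_funcset: "f \<in> carrier E \<Longrightarrow> f \<in> carrier G \<rightarrow>\<^sub>E carrier G"
  by (simp add: mem_E_iff)

lemma E_D:
  assumes "f \<in> carrier E"
  shows E_closed: "\<And>x. x \<in> carrier G \<Longrightarrow> f x \<in> carrier G"
    and E_ext: "f \<in> extensional (carrier G)"
    and E_add: "\<And>x y. \<lbrakk>x \<in> carrier G; y \<in> carrier G\<rbrakk> \<Longrightarrow> f (x \<oplus> y) = f x \<oplus> f y"
    and E_smult: "\<And>a x. \<lbrakk>a \<in> F; x \<in> carrier G\<rbrakk> \<Longrightarrow> f (a \<otimes> x) = a \<otimes> f x"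
  using assms by (auto simp: mem_E_iff PiE_iff)

lemma E_eqI: "\<lbrakk>f \<in> carrier E; g \<in> carrier E; \<And>x. x \<in> carrier G \<Longrightarrow> f x = g x\<rbrakk> \<Longrightarrow> f = g"
  by (rule extensionalityI[of _ "carrier G"]) (auto dest: E_ext)

lemma E_zero: "f \<in> carrier E \<Longrightarrow> f \<zero> = \<zero>"
  using lin_maps_zero[OF _ abelian_group_self abelian_group_self] by (auto simp: carrier_E)

lemma E_finsum:
  "\<lbrakk>f \<in> carrier E; finite I; h \<in> I \<rightarrow> carrier G\<rbrakk> \<Longrightarrow> f (\<Oplus>i\<in>I. h i) = (\<Oplus>i\<in>I. f (h i))"
  using lin_maps_finsum[OF _ abelian_group_self abelian_group_self, of f K I h]
  E_closed[of f]
  by (simp add: carrier_E Pi_iff)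

lemma in_E [simp]:
  "(\<lambda>x \<in> carrier G. x) \<in> carrier E" "(\<lambda>x \<in> carrier G. \<zero>) \<in> carrier E"
  "\<lbrakk>f \<in> carrier E; g \<in> carrier E\<rbrakk> \<Longrightarrow> (\<lambda>x \<in> carrier G. f x \<oplus> g x) \<in> carrier E"
  "\<lbrakk>f \<in> carrier E; g \<in> carrier E\<rbrakk> \<Longrightarrow> compose (carrier G) f g \<in> carrier E"
  "f \<in> carrier E \<Longrightarrow> (\<lambda>x \<in> carrier G. \<ominus> f x) \<in> carrier E"
  "a \<in> carrier G \<Longrightarrow> mult_by G a \<in> carrier E"
  using sub
  by (auto simp: mem_E_iff PiE_iff subset_iff r_distr a_ac m_ac compose_def mult_by_def minus_add r_minus
      simp flip: r_minus)

lemma ring_E: "ring E"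
proof (rule ringI)
  show "abelian_group E"
  proof (rule abelian_groupI)
    show "\<exists>g\<in>carrier E. g \<oplus>\<^bsub>E\<^esub> f = \<zero>\<^bsub>E\<^esub>" if "f \<in> carrier E" for f
      using that by (intro bexI[of _ "\<lambda>x \<in> carrier G. \<ominus> f x"]) (auto simp: l_neg E_closed fun_eq_iff)
  qed (auto simp: E_closed a_ac fun_eq_iff extensional_arb[OF E_ext])
  show "monoid E"
  proof
    show "x \<otimes>\<^bsub>E\<^esub> y \<otimes>\<^bsub>E\<^esub> z = x \<otimes>\<^bsub>E\<^esub> (y \<otimes>\<^bsub>E\<^esub> z)" if "z \<in> carrier E" for x y z
      using E_closed[OF that] by (auto simp: compose_def fun_eq_iff)
  qed (simp_all add: compose_restrict_id_left[OF E_funcset] compose_restrict_id_right[OF E_funcset])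
qed (auto simp: compose_def E_closed E_add fun_eq_iff)

sublocale E: ring E by (rule ring_E)

lemma E_pow: "\<lbrakk>f \<in> carrier E; x \<in> carrier G\<rbrakk> \<Longrightarrow> (f [^]\<^bsub>E\<^esub> (n::nat)) x = (f ^^ n) x"
proof (induction n arbitrary: x)
  case (Suc n)
  then show ?case by (simp add: compose_def E_closed funpow_swap1)
qed simp

lemma E_finsum_apply:
  "\<lbrakk>finite I; h \<in> I \<rightarrow> carrier E; x \<in> carrier G\<rbrakk> \<Longrightarrow> (\<Oplus>\<^bsub>E\<^esub>i\<in>I. h i) x = (\<Oplus>i\<in>I. h i x)"
proof (induction I rule: finite_induct)
  case (insert i I)
  then have "\<And>j. j \<in> insert i I \<Longrightarrow> h j \<in> carrier E" by auto
  then have h: "\<And>j. j \<in> insert i I \<Longrightarrow> h j x \<in> carrier G"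
    using insert.prems(2) by (simp add: E_closed)
  have "(\<Oplus>\<^bsub>E\<^esub>j\<in>insert i I. h j) = h i \<oplus>\<^bsub>E\<^esub> (\<Oplus>\<^bsub>E\<^esub>j\<in>I. h j)"
    using insert by (intro E.finsum_insert) auto
  then have "(\<Oplus>\<^bsub>E\<^esub>j\<in>insert i I. h j) x = h i x \<oplus> (\<Oplus>j\<in>I. h j x)"
    using insert by simp
  also have "\<dots> = (\<Oplus>j\<in>insert i I. h j x)"
    using insert.hyps h by (intro finsum_insert[symmetric]) auto
  finally show ?case .
qed simp

lemma funpow_closed: "\<lbrakk>f \<in> carrier E; x \<in> carrier G\<rbrakk> \<Longrightarrow> (f ^^ n) x \<in> carrier G"
  by (induction n) (auto simp: E_closed)

lemma mult_by_hom:
  shows mult_by_zero: "mult_by G \<zero> = \<zero>\<^bsub>E\<^esub>" and mult_by_one: "mult_by G \<one> = \<one>\<^bsub>E\<^esub>"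
    and mult_by_add: "\<lbrakk>g \<in> carrier G; h \<in> carrier G\<rbrakk>
      \<Longrightarrow> mult_by G (g \<oplus> h) = mult_by G g \<oplus>\<^bsub>E\<^esub> mult_by G h"
    and mult_by_mult: "\<lbrakk>g \<in> carrier G; h \<in> carrier G\<rbrakk>
      \<Longrightarrow> mult_by G (g \<otimes> h) = mult_by G g \<otimes>\<^bsub>E\<^esub> mult_by G h"
  by (auto simp: mult_by_def l_distr m_assoc compose_def)

abbreviation A :: "('g, 'g \<Rightarrow> 'g) module" where "A \<equiv> opposite_algebra E"

lemma A_simps [simp]:
  "carrier A = carrier E" "\<one>\<^bsub>A\<^esub> = \<one>\<^bsub>E\<^esub>" "\<zero>\<^bsub>A\<^esub> = \<zero>\<^bsub>E\<^esub>" "f \<oplus>\<^bsub>A\<^esub> g = f \<oplus>\<^bsub>E\<^esub> g"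
  "f \<otimes>\<^bsub>A\<^esub> g = g \<otimes>\<^bsub>E\<^esub> f" "a \<odot>\<^bsub>A\<^esub> f = a \<odot>\<^bsub>E\<^esub> f"
  by (simp_all add: opposite_algebra_def)

lemma ring_A: "ring A"
  using ring_opposite_algebra ring_E .

end

section \<open>Skew polynomial expansions of endomorphisms\<close>

text \<open>The value at \<open>v\<close> of the left skew polynomial with coefficients
  \<open>g\<close>, its variable replaced by \<open>r\<close>. For \<open>self_module G\<close> and
  \<open>\<theta>\<close> these are the expansions of endomorphisms of \<open>G\<close>.\<close>

definition series :: "('g, 'v) module \<Rightarrow> ('v \<Rightarrow> 'v) \<Rightarrow> (nat \<Rightarrow> 'g) \<Rightarrow> nat \<Rightarrow> 'v \<Rightarrow> 'v" where
  "series V r g l v = (\<Oplus>\<^bsub>V\<^esub> i \<in> {..<l}. g i \<odot>\<^bsub>V\<^esub> (r ^^ i) v)"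

text \<open>
  A common frame for both characteristics: \<open>(\<alpha>, \<beta>, c) = (id, \<delta>, 0)\<close> for a derivation \<open>\<theta> = \<delta>\<close>, and
  \<open>(\<alpha>, \<beta>, c) = (\<sigma>, 0, 1)\<close> for an automorphism \<open>\<theta> = \<sigma>\<close>.
\<close>

locale skew_field_extension = endomorphisms G F for G :: "'g ring" (structure) and F +
  fixes \<theta> \<alpha> \<beta> :: "'g \<Rightarrow> 'g" and c :: 'g and p :: nat
  assumes p_pos: "0 < p"
    and theta_E [simp]: "\<theta> \<in> carrier E"
    and alpha_closed [simp]: "g \<in> carrier G \<Longrightarrow> \<alpha> g \<in> carrier G"
    and beta_closed [simp]: "g \<in> carrier G \<Longrightarrow> \<beta> g \<in> carrier G"
    and c_closed [simp]: "c \<in> carrier G"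
    and theta_mult: "\<lbrakk>g \<in> carrier G; x \<in> carrier G\<rbrakk> \<Longrightarrow> \<theta> (g \<otimes> x) = \<alpha> g \<otimes> \<theta> x \<oplus> \<beta> g \<otimes> x"
    and theta_pow: "x \<in> carrier G \<Longrightarrow> (\<theta> ^^ p) x = c \<otimes> x"
    and expansion: "f \<in> carrier E \<Longrightarrow> \<exists>a \<in> {..<p} \<rightarrow> carrier G. \<forall>x \<in> carrier G.
      f x = (\<Oplus>i\<in>{..<p}. a i \<otimes> (\<theta> ^^ i) x)"
    and expansion_unique: "\<lbrakk>a \<in> {..<p} \<rightarrow> carrier G;
      \<And>x. x \<in> carrier G \<Longrightarrow> (\<Oplus>i\<in>{..<p}. a i \<otimes> (\<theta> ^^ i) x) = \<zero>; j < p\<rbrakk> \<Longrightarrow> a j = \<zero>"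
begin

lemmas add_commute = a_comm

lemma series_self: "\<lbrakk>g \<in> {..<l} \<rightarrow> carrier G; x \<in> carrier G\<rbrakk>
  \<Longrightarrow> series (self_module G) \<theta> g l x = (\<Oplus>i\<in>{..<l}. g i \<otimes> (\<theta> ^^ i) x)"
  unfolding series_def by (subst finsum_self) (auto simp: Pi_iff funpow_closed)

text \<open>Only the values at indices below \<open>p\<close> are determined, by
  \<open>expansion_unique\<close>; the arbitrary values beyond are not seen by a sum over
  \<open>{..<p}\<close>.\<close>

definition coef :: "('g \<Rightarrow> 'g) \<Rightarrow> nat \<Rightarrow> 'g" where
  "coef f = (SOME g. g \<in> {..<p} \<rightarrow> carrier G \<and> (\<forall>x \<in> carrier G. f x = series (self_module G) \<theta> g p x))"

lemma coef:
  assumes "f \<in> carrier E"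
  shows coef_closed: "coef f \<in> {..<p} \<rightarrow> carrier G"
    and coef_series: "\<And>x. x \<in> carrier G \<Longrightarrow> f x = series (self_module G) \<theta> (coef f) p x"
proof -
  have "\<exists>g. g \<in> {..<p} \<rightarrow> carrier G \<and> (\<forall>x \<in> carrier G. f x = series (self_module G) \<theta> g p x)"
    using expansion[OF assms] by (auto simp: series_self)
  from someI_ex[OF this] show "coef f \<in> {..<p} \<rightarrow> carrier G"
    "\<And>x. x \<in> carrier G \<Longrightarrow> f x = series (self_module G) \<theta> (coef f) p x"
    unfolding coef_def by blast+
qed

text \<open>The difference of two expansions of \<open>f\<close> is an expansion of zero.\<close>

lemma coef_eq:
  assumes "f \<in> carrier E" "g \<in> {..<p} \<rightarrow> carrier G" "i < p"
    and f: "\<And>x. x \<in> carrier G \<Longrightarrow> f x = series (self_module G) \<theta> g p x"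
  shows "coef f i = g i"
proof -
  have cl: "coef f i \<in> carrier G" "g i \<in> carrier G" if "i < p" for i
    using coef_closed[OF assms(1)] assms(2) that by auto
  have "coef f i \<oplus> \<ominus> g i = \<zero>"
  proof (rule expansion_unique[OF _ _ \<open>i < p\<close>])
    fix x assume x: "x \<in> carrier G"
    have "(\<Oplus>i\<in>{..<p}. (coef f i \<oplus> \<ominus> g i) \<otimes> (\<theta> ^^ i) x)
        = (\<Oplus>i\<in>{..<p}. coef f i \<otimes> (\<theta> ^^ i) x \<oplus> \<ominus> \<one> \<otimes> (g i \<otimes> (\<theta> ^^ i) x))"
      using x cl by (intro finsum_cong') (auto simp: l_distr funpow_closed l_minus)
    also have "\<dots> = (\<Oplus>i\<in>{..<p}. coef f i \<otimes> (\<theta> ^^ i) x)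
        \<oplus> (\<Oplus>i\<in>{..<p}. \<ominus> \<one> \<otimes> (g i \<otimes> (\<theta> ^^ i) x))"
      using x cl by (intro finsum_addf) (auto simp: funpow_closed)
    also have "(\<Oplus>i\<in>{..<p}. \<ominus> \<one> \<otimes> (g i \<otimes> (\<theta> ^^ i) x)) = \<ominus> \<one> \<otimes> (\<Oplus>i\<in>{..<p}. g i \<otimes> (\<theta> ^^ i) x)"
      using x cl by (intro finsum_rdistr[symmetric]) (auto simp: funpow_closed)
    also have "(\<Oplus>i\<in>{..<p}. coef f i \<otimes> (\<theta> ^^ i) x) = f x"
      using coef_series[OF assms(1) x] coef_closed[OF assms(1)] x by (simp add: series_self)
    also have "(\<Oplus>i\<in>{..<p}. g i \<otimes> (\<theta> ^^ i) x) = f x"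
      using f[OF x] assms(2) x by (simp add: series_self)
    finally show "(\<Oplus>i\<in>{..<p}. (coef f i \<oplus> \<ominus> g i) \<otimes> (\<theta> ^^ i) x) = \<zero>"
      using x assms(1) by (simp add: l_minus r_neg E_closed)
  qed (use cl in auto)
  then show ?thesis using cl[OF assms(3)] by (metis a_inv_closed minus_equality minus_minus)
qed

definition layer_sum :: "(nat \<Rightarrow> 'g) \<Rightarrow> nat \<Rightarrow> 'g \<Rightarrow> 'g" where
  "layer_sum g l = (\<Oplus>\<^bsub>E\<^esub> i \<in> {..<l}. mult_by G (g i) \<otimes>\<^bsub>E\<^esub> (\<theta> [^]\<^bsub>E\<^esub> i))"

lemma A_layer_eq: "A_layer G F \<theta> l = {layer_sum g l | g. g \<in> {..<l} \<rightarrow> carrier G}"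
  by (simp add: A_layer_def layer_sum_def Let_def)

lemma layer_sum_closed [simp]: "g \<in> {..<l} \<rightarrow> carrier G \<Longrightarrow> layer_sum g l \<in> carrier E"
  unfolding layer_sum_def by (intro E.finsum_closed) (auto simp: Pi_iff simp del: E_simps intro!: E.m_closed)

lemma layer_sum_Suc: "g \<in> {..<Suc l} \<rightarrow> carrier G
  \<Longrightarrow> layer_sum g (Suc l) = layer_sum g l \<oplus>\<^bsub>E\<^esub> mult_by G (g l) \<otimes>\<^bsub>E\<^esub> (\<theta> [^]\<^bsub>E\<^esub> l)"
  unfolding layer_sum_def
  by (intro E.finsum_lessThan_Suc) (auto simp: Pi_iff simp del: E_simps intro!: E.m_closed)

lemma layer_sum_apply:
  assumes "g \<in> {..<l} \<rightarrow> carrier G" "x \<in> carrier G"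
  shows "layer_sum g l x = series (self_module G) \<theta> g l x"
proof -
  have "layer_sum g l x = (\<Oplus>i\<in>{..<l}. (mult_by G (g i) \<otimes>\<^bsub>E\<^esub> (\<theta> [^]\<^bsub>E\<^esub> i)) x)"
    unfolding layer_sum_def using assms
    by (intro E_finsum_apply) (auto simp: Pi_iff simp del: E_simps intro!: E.m_closed)
  also have "\<dots> = (\<Oplus>i\<in>{..<l}. g i \<otimes> (\<theta> ^^ i) x)"
    using assms by (intro finsum_cong') (auto simp: compose_def E_pow mult_by_def funpow_closed)
  finally show ?thesis using assms by (simp add: series_self)
qed

lemma E_eq_layer_sum: "f \<in> carrier E \<Longrightarrow> f = layer_sum (coef f) p"
  using coef_closed coef_series by (intro E_eqI) (auto simp: layer_sum_apply)

text \<open>By the expansion, the multiplications and \<open>\<theta>\<close> generate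
  \<open>E\<close> as a ring. The rule reduces multiplicativity of an action to left factors of
  these two kinds.\<close>

lemma E_induct [consumes 1, case_names zero mult_by theta add comp]:
  assumes "f \<in> carrier E" and "Q \<zero>\<^bsub>E\<^esub>" and "\<And>g. g \<in> carrier G \<Longrightarrow> Q (mult_by G g)" and "Q \<theta>"
    and "\<And>f h. \<lbrakk>f \<in> carrier E; h \<in> carrier E; Q f; Q h\<rbrakk> \<Longrightarrow> Q (f \<oplus>\<^bsub>E\<^esub> h)"
    and "\<And>f h. \<lbrakk>f \<in> carrier E; h \<in> carrier E; Q f; Q h\<rbrakk> \<Longrightarrow> Q (f \<otimes>\<^bsub>E\<^esub> h)"
  shows "Q f"
proof -
  have one: "\<one>\<^bsub>E\<^esub> = mult_by G \<one>"
    by (auto simp: mult_by_def)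
  have pow: "Q (\<theta> [^]\<^bsub>E\<^esub> i)" for i :: nat
  proof (induction i)
    case 0
    then show ?case using assms(3)[of \<one>] one by (simp del: E_simps)
  next
    case (Suc i)
    then show ?case using assms(4) assms(6)[of "\<theta> [^]\<^bsub>E\<^esub> i" \<theta>] by (simp del: E_simps)
  qed
  have "Q (layer_sum g l)" if "g \<in> {..<l} \<rightarrow> carrier G" for g l
    using that
  proof (induction l)
    case 0
    then show ?case using assms(2) by (simp add: layer_sum_def del: E_simps)
  next
    case (Suc l)
    then show ?case
      by (auto simp: layer_sum_Suc pow Pi_iff simp del: E_simps intro!: assms(3,5,6) E.m_closed)
  qed
  then show ?thesis using E_eq_layer_sum[OF assms(1)] coef_closed[OF assms(1)] by metis
qed

text \<open>The coefficients of \<open>\<theta>\<close> composed with the endomorphism that has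
  coefficients \<open>g\<close>. Moving \<open>\<theta>\<close> past \<open>g i\<close> leaves
  \<open>\<beta> (g i)\<close> in place and sends \<open>\<alpha> (g i)\<close> one index up; what
  would land at index \<open>p\<close> returns to index 0 with the factor \<open>c\<close>, the
  value of the \<open>p\<close>-th power of \<open>\<theta>\<close>.\<close>

definition shift :: "(nat \<Rightarrow> 'g) \<Rightarrow> nat \<Rightarrow> 'g" where
  "shift g i = \<beta> (g i) \<oplus> (if i = 0 then \<alpha> (g (p - 1)) \<otimes> c else \<alpha> (g (i - 1)))"

lemma shift_closed: "g \<in> {..<p} \<rightarrow> carrier G \<Longrightarrow> shift g \<in> {..<p} \<rightarrow> carrier G"
  using p_pos by (auto simp: shift_def Pi_iff)

end

text \<open>On \<open>V\<close> the operator \<open>r\<close> obeys the relations that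
  \<open>\<theta>\<close> obeys on \<open>G\<close>. For the two choices of
  \<open>(\<alpha>, \<beta>, c)\<close> these are the axioms of a \<open>\<delta>\<close>-derivation
  and of a \<open>\<sigma>\<close>-action.\<close>

locale twisted_module = skew_field_extension G F \<theta> \<alpha> \<beta> c p + module G V
  for G :: "'g ring" (structure) and F \<theta> \<alpha> \<beta> c p and V :: "('g, 'v) module" +
  fixes r :: "'v \<Rightarrow> 'v"
  assumes r_lin: "r \<in> lin_maps K V V"
    and r_smult: "\<lbrakk>g \<in> carrier G; v \<in> carrier V\<rbrakk>
      \<Longrightarrow> r (g \<odot>\<^bsub>V\<^esub> v) = \<alpha> g \<odot>\<^bsub>V\<^esub> r v \<oplus>\<^bsub>V\<^esub> \<beta> g \<odot>\<^bsub>V\<^esub> v"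
    and r_pow: "v \<in> carrier V \<Longrightarrow> (r ^^ p) v = c \<odot>\<^bsub>V\<^esub> v"

text \<open>The device for comparing coefficients: each fact on \<open>series\<close> for a general
  \<open>V\<close> also holds in \<open>G\<close>, where uniqueness makes it a fact on
  \<open>coef\<close>.\<close>

lemma (in skew_field_extension) twisted_module_self:
  "twisted_module G F \<theta> \<alpha> \<beta> c p (self_module G) \<theta>"
  by (intro twisted_module.intro skew_field_extension_axioms module_self twisted_module_axioms.intro)
     (simp_all add: theta_mult theta_pow flip: carrier_E)

section \<open>The action of endomorphisms on a twisted module\<close>

context twisted_module begin

lemma r_pow_closed [simp]: "v \<in> carrier V \<Longrightarrow> (r ^^ i) v \<in> carrier V"
  by (induction i) (auto simp: lin_mapsD(1)[OF r_lin])

lemma r_pow_add: "\<lbrakk>v \<in> carrier V; w \<in> carrier V\<rbrakk>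
  \<Longrightarrow> (r ^^ i) (v \<oplus>\<^bsub>V\<^esub> w) = (r ^^ i) v \<oplus>\<^bsub>V\<^esub> (r ^^ i) w"
  by (induction i) (auto simp: lin_mapsD(3)[OF r_lin])

lemma r_pow_zero: "(r ^^ i) \<zero>\<^bsub>V\<^esub> = \<zero>\<^bsub>V\<^esub>"
  by (induction i) (auto simp: lin_maps_zero[OF r_lin M.abelian_group_axioms M.abelian_group_axioms])

lemma series_closed [simp]:
  "\<lbrakk>g \<in> {..<l} \<rightarrow> carrier G; v \<in> carrier V\<rbrakk> \<Longrightarrow> series V r g l v \<in> carrier V"
  unfolding series_def by (intro M.finsum_closed) auto

lemma series_add_coef:
  assumes "g \<in> {..<l} \<rightarrow> carrier G" "h \<in> {..<l} \<rightarrow> carrier G" "v \<in> carrier V"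
  shows "series V r (\<lambda>i. g i \<oplus> h i) l v = series V r g l v \<oplus>\<^bsub>V\<^esub> series V r h l v"
proof -
  have "series V r (\<lambda>i. g i \<oplus> h i) l v
      = (\<Oplus>\<^bsub>V\<^esub>i\<in>{..<l}. g i \<odot>\<^bsub>V\<^esub> (r ^^ i) v \<oplus>\<^bsub>V\<^esub> h i \<odot>\<^bsub>V\<^esub> (r ^^ i) v)"
    unfolding series_def using assms by (intro M.finsum_cong') (auto simp: smult_l_distr Pi_iff)
  also have "\<dots> = series V r g l v \<oplus>\<^bsub>V\<^esub> series V r h l v"
    unfolding series_def using assms by (intro M.finsum_addf) auto
  finally show ?thesis .
qed

lemma series_add_vec:
  assumes "g \<in> {..<l} \<rightarrow> carrier G" "v \<in> carrier V" "w \<in> carrier V"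
  shows "series V r g l (v \<oplus>\<^bsub>V\<^esub> w) = series V r g l v \<oplus>\<^bsub>V\<^esub> series V r g l w"
proof -
  have "series V r g l (v \<oplus>\<^bsub>V\<^esub> w)
      = (\<Oplus>\<^bsub>V\<^esub>i\<in>{..<l}. g i \<odot>\<^bsub>V\<^esub> (r ^^ i) v \<oplus>\<^bsub>V\<^esub> g i \<odot>\<^bsub>V\<^esub> (r ^^ i) w)"
    unfolding series_def using assms
    by (intro M.finsum_cong') (auto simp: smult_r_distr r_pow_add Pi_iff)
  also have "\<dots> = series V r g l v \<oplus>\<^bsub>V\<^esub> series V r g l w"
    unfolding series_def using assms by (intro M.finsum_addf) auto
  finally show ?thesis .
qed

lemma series_smult:
  assumes "g \<in> {..<l} \<rightarrow> carrier G" "a \<in> carrier G" "v \<in> carrier V"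
  shows "series V r (\<lambda>i. a \<otimes> g i) l v = a \<odot>\<^bsub>V\<^esub> series V r g l v"
proof -
  have "series V r (\<lambda>i. a \<otimes> g i) l v = (\<Oplus>\<^bsub>V\<^esub>i\<in>{..<l}. a \<odot>\<^bsub>V\<^esub> (g i \<odot>\<^bsub>V\<^esub> (r ^^ i) v))"
    unfolding series_def using assms by (intro M.finsum_cong') (auto simp: smult_assoc1 Pi_iff)
  also have "\<dots> = a \<odot>\<^bsub>V\<^esub> series V r g l v"
    unfolding series_def using assms by (intro finsum_smult_ldistr[symmetric]) auto
  finally show ?thesis .
qed

lemma series_const:
  assumes "a \<in> carrier G" "v \<in> carrier V"
  shows "series V r (\<lambda>i. if i = 0 then a else \<zero>) p v = a \<odot>\<^bsub>V\<^esub> v"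
proof -
  have "series V r (\<lambda>i. if i = 0 then a else \<zero>) p v = (\<Oplus>\<^bsub>V\<^esub>i\<in>{..<p}. if i = 0 then a \<odot>\<^bsub>V\<^esub> v else \<zero>\<^bsub>V\<^esub>)"
    unfolding series_def using assms by (intro M.finsum_cong') auto
  then show ?thesis using M.finsum_delta[of "{..<p}" 0] assms p_pos by simp
qed

lemma r_series:
  assumes g: "g \<in> {..<p} \<rightarrow> carrier G" and v: "v \<in> carrier V"
  shows "r (series V r g p v) = series V r (shift g) p v"
proof -
  obtain m where m: "p = Suc m" using p_pos gr0_implies_Suc by blast
  have cl: "g i \<in> carrier G" if "i < p" for i using g that by auto
  let ?s = "\<lambda>i. if i = 0 then \<alpha> (g (p - 1)) \<otimes> c else \<alpha> (g (i - 1))"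
  have s: "?s \<in> {..<p} \<rightarrow> carrier G" using cl m by auto
  have "r (series V r g p v) = (\<Oplus>\<^bsub>V\<^esub>i\<in>{..<p}. r (g i \<odot>\<^bsub>V\<^esub> (r ^^ i) v))"
    unfolding series_def using cl v
    by (intro lin_maps_finsum[OF r_lin M.abelian_group_axioms M.abelian_group_axioms]) auto
  also have "\<dots> = (\<Oplus>\<^bsub>V\<^esub>i\<in>{..<p}. \<alpha> (g i) \<odot>\<^bsub>V\<^esub> (r ^^ Suc i) v \<oplus>\<^bsub>V\<^esub> \<beta> (g i) \<odot>\<^bsub>V\<^esub> (r ^^ i) v)"
    using cl v r_pow_closed[of v "Suc _"] by (intro M.finsum_cong') (auto simp: r_smult)
  also have "\<dots> = (\<Oplus>\<^bsub>V\<^esub>i\<in>{..<p}. \<alpha> (g i) \<odot>\<^bsub>V\<^esub> (r ^^ Suc i) v) \<oplus>\<^bsub>V\<^esub> series V r (\<lambda>i. \<beta> (g i)) p v"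
    unfolding series_def using cl v
    by (intro M.finsum_addf) (auto simp del: funpow.simps)
  \<comment> \<open>The last term is split off: it contains \<open>r ^^ p\<close>, which acts as
    \<open>c\<close>, and so becomes the constant coefficient in \<open>?s\<close>.\<close>
  also have "(\<Oplus>\<^bsub>V\<^esub>i\<in>{..<p}. \<alpha> (g i) \<odot>\<^bsub>V\<^esub> (r ^^ Suc i) v)
      = (\<Oplus>\<^bsub>V\<^esub>i\<in>{..<m}. \<alpha> (g i) \<odot>\<^bsub>V\<^esub> (r ^^ Suc i) v) \<oplus>\<^bsub>V\<^esub> \<alpha> (g m) \<odot>\<^bsub>V\<^esub> (c \<odot>\<^bsub>V\<^esub> v)"
    using cl v r_pow[OF v] unfolding m
    by (subst M.finsum_lessThan_Suc) (auto simp del: funpow.simps)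
  also have "\<dots> = series V r ?s p v"
    unfolding series_def m using cl v m
    by (subst M.finsum_lessThan_Suc_shift)
       (auto simp del: funpow.simps(2) simp: smult_assoc1 Pi_iff intro!: M.a_comm M.finsum_closed)
  also have "series V r ?s p v \<oplus>\<^bsub>V\<^esub> series V r (\<lambda>i. \<beta> (g i)) p v = series V r (\<lambda>i. ?s i \<oplus> \<beta> (g i)) p v"
    using s cl v by (intro series_add_coef[symmetric]) auto
  also have "\<dots> = series V r (shift g) p v"
    unfolding series_def shift_def using cl v m by (intro M.finsum_cong') (auto simp: add_commute[of "\<beta> (g _)"])
  finally show ?thesis .
qed

definition act :: "('g \<Rightarrow> 'g) \<Rightarrow> 'v \<Rightarrow> 'v" where
  "act f v = series V r (coef f) p v"

lemma act_closed [simp]: "\<lbrakk>f \<in> carrier E; v \<in> carrier V\<rbrakk> \<Longrightarrow> act f v \<in> carrier V"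
  using coef_closed by (simp add: act_def)

text \<open>Frees the action from the choice made in \<open>coef\<close>: it suffices to exhibit
  some expansion of a sum or product on \<open>G\<close>, and its coefficients compute the action on
  \<open>V\<close>.\<close>

lemma act_eq:
  assumes "f \<in> carrier E" "g \<in> {..<p} \<rightarrow> carrier G" "v \<in> carrier V"
    and "\<And>x. x \<in> carrier G \<Longrightarrow> f x = series (self_module G) \<theta> g p x"
  shows "act f v = series V r g p v"
  unfolding act_def series_def using assms coef_eq[OF assms(1,2)]
  by (intro M.finsum_cong') auto

lemma act_add:
  assumes "f \<in> carrier E" "h \<in> carrier E" "v \<in> carrier V"
  shows "act (f \<oplus>\<^bsub>E\<^esub> h) v = act f v \<oplus>\<^bsub>V\<^esub> act h v"
proof -
  interpret S: twisted_module G F \<theta> \<alpha> \<beta> c p "self_module G" \<theta> by (rule twisted_module_self)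
  have "act (f \<oplus>\<^bsub>E\<^esub> h) v = series V r (\<lambda>i. coef f i \<oplus> coef h i) p v"
    using assms coef_closed[OF assms(1)] coef_closed[OF assms(2)]
    by (intro act_eq) (auto simp: S.series_add_coef coef_series)
  then show ?thesis
    using assms by (simp add: act_def series_add_coef coef_closed)
qed

lemma act_add_vec:
  "\<lbrakk>f \<in> carrier E; v \<in> carrier V; w \<in> carrier V\<rbrakk> \<Longrightarrow> act f (v \<oplus>\<^bsub>V\<^esub> w) = act f v \<oplus>\<^bsub>V\<^esub> act f w"
  by (simp add: act_def series_add_vec coef_closed)

lemma act_mult_by_comp:
  assumes "g \<in> carrier G" "h \<in> carrier E" "v \<in> carrier V"
  shows "act (mult_by G g \<otimes>\<^bsub>E\<^esub> h) v = g \<odot>\<^bsub>V\<^esub> act h v"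
proof -
  interpret S: twisted_module G F \<theta> \<alpha> \<beta> c p "self_module G" \<theta> by (rule twisted_module_self)
  have "act (mult_by G g \<otimes>\<^bsub>E\<^esub> h) v = series V r (\<lambda>i. g \<otimes> coef h i) p v"
    using assms coef_closed[OF assms(2)]
    by (intro act_eq E.m_closed)
       (auto simp: S.series_smult E_closed simp flip: coef_series[OF assms(2)],
        auto simp: mult_by_def compose_def E_closed)
  then show ?thesis
    using assms by (simp add: act_def series_smult coef_closed)
qed

text \<open>\<open>r_series\<close> is used twice: in \<open>G\<close> it shows that
  \<open>shift (coef h)\<close> expands the composite, and in \<open>V\<close> that the same
  coefficients produce \<open>r (act h v)\<close>.\<close>

lemma act_theta_comp:
  assumes "h \<in> carrier E" "v \<in> carrier V"
  shows "act (\<theta> \<otimes>\<^bsub>E\<^esub> h) v = r (act h v)"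
proof -
  interpret S: twisted_module G F \<theta> \<alpha> \<beta> c p "self_module G" \<theta> by (rule twisted_module_self)
  have "act (\<theta> \<otimes>\<^bsub>E\<^esub> h) v = series V r (shift (coef h)) p v"
    using assms shift_closed[OF coef_closed[OF assms(1)]]
    by (intro act_eq E.m_closed) (auto simp: compose_eq simp flip: S.r_series[OF coef_closed[OF assms(1)]] coef_series[OF assms(1)])
  then show ?thesis
    using assms by (simp add: act_def r_series coef_closed)
qed

lemma act_mult_by:
  assumes "g \<in> carrier G" "v \<in> carrier V" shows "act (mult_by G g) v = g \<odot>\<^bsub>V\<^esub> v"
proof -
  interpret S: twisted_module G F \<theta> \<alpha> \<beta> c p "self_module G" \<theta> by (rule twisted_module_self)
  have "act (mult_by G g) v = series V r (\<lambda>i. if i = 0 then g else \<zero>) p v"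
    using assms by (intro act_eq) (auto simp: S.series_const, simp add: mult_by_def)
  then show ?thesis using assms by (simp add: series_const)
qed

lemma act_one: "v \<in> carrier V \<Longrightarrow> act \<one>\<^bsub>E\<^esub> v = v"
proof -
  have "\<one>\<^bsub>E\<^esub> = mult_by G \<one>" by (auto simp: mult_by_def)
  then show "v \<in> carrier V \<Longrightarrow> act \<one>\<^bsub>E\<^esub> v = v" using act_mult_by[of \<one> v] by simp
qed

lemma act_theta: "v \<in> carrier V \<Longrightarrow> act \<theta> v = r v"
  using act_theta_comp[of "\<one>\<^bsub>E\<^esub>" v] act_one[of v] by (simp del: E_simps)

lemma act_comp:
  assumes "f \<in> carrier E" "h \<in> carrier E" "v \<in> carrier V"
  shows "act (f \<otimes>\<^bsub>E\<^esub> h) v = act f (act h v)"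
  using assms
\<comment> \<open>Both \<open>h\<close> and \<open>v\<close> stay free: when the left factor is
  itself a composite, its second factor is moved into \<open>h\<close> by associativity.\<close>
proof (induction f arbitrary: h v rule: E_induct)
  case zero
  have 0: "act \<zero>\<^bsub>E\<^esub> v = \<zero>\<^bsub>V\<^esub>" if "v \<in> carrier V" for v
    using act_add[of "\<zero>\<^bsub>E\<^esub>" "\<zero>\<^bsub>E\<^esub>" v] act_closed[of "\<zero>\<^bsub>E\<^esub>" v] that
    by (simp del: E_simps)
  show ?case using zero by (simp add: 0 del: E_simps)
next
  case (mult_by g)
  then show ?case by (simp add: act_mult_by_comp act_mult_by del: E_simps)
next
  case theta
  then show ?case by (simp add: act_theta_comp act_theta del: E_simps)
next
  case (add f f')
  then show ?case by (simp add: E.l_distr act_add del: E_simps)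
next
  case (comp f f')
  then show ?case by (simp add: E.m_assoc del: E_simps)
qed

end

section \<open>Twisted modules and modules over the endomorphism algebra\<close>

context skew_field_extension begin

definition to_alg :: "('g, 'v) module \<Rightarrow> ('v \<Rightarrow> 'v) \<Rightarrow> ('g \<Rightarrow> 'g, 'v) module" where
  "to_alg V r = \<lparr> carrier = carrier V, monoid.mult = monoid.mult V, one = \<one>\<^bsub>V\<^esub>,
     ring.zero = \<zero>\<^bsub>V\<^esub>, add = add V, smult = (\<lambda>f. series V r (coef f) p) \<rparr>"

definition of_alg :: "('g \<Rightarrow> 'g, 'v) module \<Rightarrow> ('g, 'v) module" where
  "of_alg M = \<lparr> carrier = carrier M, monoid.mult = monoid.mult M, one = \<one>\<^bsub>M\<^esub>,
     ring.zero = \<zero>\<^bsub>M\<^esub>, add = add M, smult = (\<lambda>g. smult M (mult_by G g)) \<rparr>"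

text \<open>Cut down to the carrier because operators in \<open>lin_maps\<close> are
  extensional.\<close>

definition theta_act :: "('g \<Rightarrow> 'g, 'v) module \<Rightarrow> 'v \<Rightarrow> 'v" where
  "theta_act M = (\<lambda>v \<in> carrier M. \<theta> \<odot>\<^bsub>M\<^esub> v)"

lemma to_alg_simps [simp]:
  "carrier (to_alg V r) = carrier V" "\<zero>\<^bsub>to_alg V r\<^esub> = \<zero>\<^bsub>V\<^esub>" "add (to_alg V r) = add V"
  by (simp_all add: to_alg_def)

lemma of_alg_simps [simp]:
  "carrier (of_alg M) = carrier M" "\<zero>\<^bsub>of_alg M\<^esub> = \<zero>\<^bsub>M\<^esub>" "add (of_alg M) = add M"
  "g \<odot>\<^bsub>of_alg M\<^esub> v = mult_by G g \<odot>\<^bsub>M\<^esub> v"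
  by (simp_all add: of_alg_def)

text \<open>Layers are exploited through their monomials: \<open>j = 0\<close> yields the
  multiplications by elements of \<open>G\<close>, and \<open>g = \<one>\<close> the powers of
  \<open>\<theta>\<close>.\<close>

lemma mult_by_comp_theta_pow_mem_A_layer:
  assumes "g \<in> carrier G" "j < l"
  shows "mult_by G g \<otimes>\<^bsub>E\<^esub> (\<theta> [^]\<^bsub>E\<^esub> j) \<in> A_layer G F \<theta> l"
proof -
  let ?g = "\<lambda>i. if i = j then g else \<zero>"
  have "layer_sum ?g l = (\<Oplus>\<^bsub>E\<^esub>i\<in>{..<l}. if i = j then mult_by G g \<otimes>\<^bsub>E\<^esub> (\<theta> [^]\<^bsub>E\<^esub> j) else \<zero>\<^bsub>E\<^esub>)"
    unfolding layer_sum_def using assms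
    by (intro E.finsum_cong') (auto simp: mult_by_zero simp del: E_simps intro!: E.m_closed)
  also have "\<dots> = mult_by G g \<otimes>\<^bsub>E\<^esub> (\<theta> [^]\<^bsub>E\<^esub> j)"
    using assms by (intro E.finsum_delta) (auto simp del: E_simps intro!: E.m_closed)
  finally show ?thesis using assms by (auto simp: A_layer_eq simp del: E_simps intro!: exI[of _ ?g])
qed

end

context twisted_module begin

lemma to_alg_smult [simp]: "f \<odot>\<^bsub>to_alg V r\<^esub> v = act f v"
  by (simp add: to_alg_def act_def)

lemma right_module_to_alg: "right_module A (to_alg V r)"
  by (intro right_module.intro ring_A right_module_axioms.intro
      abelian_group_cong[OF M.abelian_group_axioms])
     (simp_all add: act_add act_add_vec act_comp act_one del: E_simps)

lemma act_theta_pow: "v \<in> carrier V \<Longrightarrow> act (\<theta> [^]\<^bsub>E\<^esub> (i::nat)) v = (r ^^ i) v"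
proof (induction i arbitrary: v)
  case (Suc i)
  then show ?case
    by (simp add: act_comp act_theta lin_mapsD(1)[OF r_lin] funpow_swap1 del: E_simps)
qed (simp add: act_one del: E_simps)

text \<open>The action is already known to be additive and multiplicative, so no coefficients are
  compared and \<open>l\<close> may exceed \<open>p\<close>.\<close>

lemma act_layer_sum:
  "\<lbrakk>g \<in> {..<l} \<rightarrow> carrier G; v \<in> carrier V\<rbrakk> \<Longrightarrow> act (layer_sum g l) v = series V r g l v"
proof (induction l)
  case 0
  have "act \<zero>\<^bsub>E\<^esub> v = \<zero>\<^bsub>V\<^esub>"
    using act_add[of "\<zero>\<^bsub>E\<^esub>" "\<zero>\<^bsub>E\<^esub>" v] act_closed[of "\<zero>\<^bsub>E\<^esub>" v] 0 by (simp del: E_simps)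
  then show ?case by (simp add: layer_sum_def series_def del: E_simps)
next
  case (Suc l)
  then have g: "g \<in> {..<l} \<rightarrow> carrier G" "g l \<in> carrier G" by auto
  have "series V r g (Suc l) v = series V r g l v \<oplus>\<^bsub>V\<^esub> g l \<odot>\<^bsub>V\<^esub> (r ^^ l) v"
    unfolding series_def using Suc.prems by (intro M.finsum_lessThan_Suc) auto
  moreover have "act (layer_sum g (Suc l)) v
      = act (layer_sum g l) v \<oplus>\<^bsub>V\<^esub> act (mult_by G (g l) \<otimes>\<^bsub>E\<^esub> (\<theta> [^]\<^bsub>E\<^esub> l)) v"
    using Suc.prems g by (subst layer_sum_Suc) (auto intro!: act_add E.m_closed simp del: E_simps)
  ultimately show ?case
    using Suc g by (simp add: act_mult_by_comp act_theta_pow del: E_simps)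
qed

lemma act_mem_submodule:
  assumes W: "submodule W G V" and v: "v \<in> carrier V" and r: "\<And>i. i < l \<Longrightarrow> (r ^^ i) v \<in> W"
    and t: "t \<in> A_layer G F \<theta> l"
  shows "act t v \<in> W"
proof -
  obtain g where g: "g \<in> {..<l} \<rightarrow> carrier G" and t_eq: "t = layer_sum g l"
    using t by (auto simp: A_layer_eq)
  have "series V r g l v \<in> W"
    unfolding series_def using g r
    by (intro submodule_finsum[OF W M.abelian_group_axioms]) (auto intro!: submodule.smult_closed[OF W])
  then show ?thesis using act_layer_sum[OF g v] t_eq by simp
qed

end

text \<open>A map that commutes with \<open>r\<close> commutes with its powers, and by
  \<open>G\<close>-linearity with every series in them; each endomorphism acts by such a
  series.\<close>

lemma (in twisted_module) lin_maps_to_alg: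
  assumes V': "twisted_module G F \<theta> \<alpha> \<beta> c p V' r'"
    and \<psi>: "\<psi> \<in> lin_maps G V V'" and comm: "\<And>v. v \<in> carrier V \<Longrightarrow> \<psi> (r v) = r' (\<psi> v)"
  shows "\<psi> \<in> lin_maps A (to_alg V r) (to_alg V' r')"
proof -
  interpret V': twisted_module G F \<theta> \<alpha> \<beta> c p V' r' by fact
  have pow: "\<psi> ((r ^^ i) v) = (r' ^^ i) (\<psi> v)" if "v \<in> carrier V" for i v
    using that by (induction i) (auto simp: comm)
  have "\<psi> (act f v) = V'.act f (\<psi> v)" if f: "f \<in> carrier E" and v: "v \<in> carrier V" for f v
  proof -
    have "\<psi> (act f v) = (\<Oplus>\<^bsub>V'\<^esub>i\<in>{..<p}. \<psi> (coef f i \<odot>\<^bsub>V\<^esub> (r ^^ i) v))"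
      unfolding act_def series_def using coef_closed[OF f] v
      by (intro lin_maps_finsum[OF \<psi> M.abelian_group_axioms V'.M.abelian_group_axioms]) auto
    also have "\<dots> = V'.act f (\<psi> v)"
      unfolding V'.act_def series_def using coef_closed[OF f] v lin_mapsD(1,4)[OF \<psi>]
      by (intro V'.M.finsum_cong') (auto simp: pow Pi_iff)
    finally show ?thesis .
  qed
  then show ?thesis
    using \<psi> by (simp add: lin_maps_def)
qed

section \<open>From modules over the endomorphism algebra back to twisted modules\<close>

locale endo_module = skew_field_extension G F \<theta> \<alpha> \<beta> c p + right_module "opposite_algebra (end_algebra G F)" M
  for G :: "'g ring" (structure) and F \<theta> \<alpha> \<beta> c p and M :: "('g \<Rightarrow> 'g, 'v) module"
begin

text \<open>Two reversals cancel: the product of \<open>A\<close> is reversed composition, and in a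
  right module the left factor acts first. A right \<open>A\<close>-module is thus a left module
  over \<open>E\<close>.\<close>

lemma smult_comp: "\<lbrakk>f \<in> carrier E; h \<in> carrier E; v \<in> carrier M\<rbrakk>
  \<Longrightarrow> (f \<otimes>\<^bsub>E\<^esub> h) \<odot>\<^bsub>M\<^esub> v = f \<odot>\<^bsub>M\<^esub> (h \<odot>\<^bsub>M\<^esub> v)"
  using act_mult[of h f v] by simp

lemma smult_add: "\<lbrakk>f \<in> carrier E; h \<in> carrier E; v \<in> carrier M\<rbrakk>
  \<Longrightarrow> (f \<oplus>\<^bsub>E\<^esub> h) \<odot>\<^bsub>M\<^esub> v = f \<odot>\<^bsub>M\<^esub> v \<oplus>\<^bsub>M\<^esub> h \<odot>\<^bsub>M\<^esub> v"
  using act_add_ring[of f h v] by simp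

lemma smult_unit: "v \<in> carrier M \<Longrightarrow> \<one>\<^bsub>E\<^esub> \<odot>\<^bsub>M\<^esub> v = v"
  using act_one by simp

lemma smult_closed [simp]: "\<lbrakk>f \<in> carrier E; v \<in> carrier M\<rbrakk> \<Longrightarrow> f \<odot>\<^bsub>M\<^esub> v \<in> carrier M"
  using act_closed[of f v] by simp

lemma smult_add_vec: "\<lbrakk>f \<in> carrier E; v \<in> carrier M; w \<in> carrier M\<rbrakk>
  \<Longrightarrow> f \<odot>\<^bsub>M\<^esub> (v \<oplus>\<^bsub>M\<^esub> w) = f \<odot>\<^bsub>M\<^esub> v \<oplus>\<^bsub>M\<^esub> f \<odot>\<^bsub>M\<^esub> w"
  using act_add_module[of f v w] by simp

lemma theta_act_pow: "v \<in> carrier M \<Longrightarrow> (theta_act M ^^ i) v = (\<theta> [^]\<^bsub>E\<^esub> i) \<odot>\<^bsub>M\<^esub> v"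
proof (induction i arbitrary: v)
  case (Suc i)
  then show ?case
    by (simp add: theta_act_def smult_comp funpow_Suc_right del: E_simps funpow.simps(2))
qed (simp add: smult_unit del: E_simps)

lemma theta_act_closed [simp]: "v \<in> carrier M \<Longrightarrow> theta_act M v \<in> carrier M"
  by (simp add: theta_act_def)

lemma theta_comp_mult_by:
  assumes "g \<in> carrier G"
  shows "\<theta> \<otimes>\<^bsub>E\<^esub> mult_by G g = mult_by G (\<alpha> g) \<otimes>\<^bsub>E\<^esub> \<theta> \<oplus>\<^bsub>E\<^esub> mult_by G (\<beta> g)"
  using assms by (auto simp: compose_def mult_by_def theta_mult E_closed)

lemma theta_E_pow: "\<theta> [^]\<^bsub>E\<^esub> p = mult_by G c"
proof (rule E_eqI)
  show "\<theta> [^]\<^bsub>E\<^esub> p \<in> carrier E" by (simp del: E_simps)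
  show "(\<theta> [^]\<^bsub>E\<^esub> p) x = mult_by G c x" if "x \<in> carrier G" for x
    using that by (simp add: E_pow theta_pow mult_by_def)
qed simp

lemma module_of_alg: "module G (of_alg M)"
proof (intro module.intro is_cring module_axioms.intro)
  show "abelian_group (of_alg M)"
    using M.abelian_group_axioms by (rule abelian_group_cong) auto
  fix g h v assume gh: "g \<in> carrier G" "h \<in> carrier G" and v: "v \<in> carrier (of_alg M)"
  show "(g \<oplus> h) \<odot>\<^bsub>of_alg M\<^esub> v = g \<odot>\<^bsub>of_alg M\<^esub> v \<oplus>\<^bsub>of_alg M\<^esub> h \<odot>\<^bsub>of_alg M\<^esub> v"
    using gh v by (simp add: mult_by_add smult_add del: E_simps)
  show "(g \<otimes> h) \<odot>\<^bsub>of_alg M\<^esub> v = g \<odot>\<^bsub>of_alg M\<^esub> (h \<odot>\<^bsub>of_alg M\<^esub> v)"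
    using gh v by (simp add: mult_by_mult smult_comp del: E_simps)
qed (simp_all add: smult_add_vec mult_by_one smult_unit del: E_simps)

lemma twisted_module_of_alg: "twisted_module G F \<theta> \<alpha> \<beta> c p (of_alg M) (theta_act M)"
proof (intro twisted_module.intro skew_field_extension_axioms module_of_alg twisted_module_axioms.intro)
  \<comment> \<open>Multiplication by an element of \<open>F\<close> commutes with
    \<open>\<theta>\<close> because \<open>\<theta>\<close> is \<open>F\<close>-linear; on
    \<open>M\<close> this becomes linearity of \<open>theta_act M\<close> over
    \<open>K\<close>.\<close>
  have comm: "\<theta> \<otimes>\<^bsub>E\<^esub> mult_by G a = mult_by G a \<otimes>\<^bsub>E\<^esub> \<theta>" if "a \<in> F" for a
    using that sub by (auto simp: compose_def mult_by_def E_closed E_smult)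
  have "theta_act M (mult_by G a \<odot>\<^bsub>M\<^esub> v) = mult_by G a \<odot>\<^bsub>M\<^esub> theta_act M v"
    if "a \<in> F" "v \<in> carrier M" for a v
  proof -
    have "a \<in> carrier G" using that sub by auto
    with comm[OF that(1)] that(2) show ?thesis
      using smult_comp[of \<theta> "mult_by G a" v] smult_comp[of "mult_by G a" \<theta> v]
      by (simp add: theta_act_def del: E_simps)
  qed
  then show "theta_act M \<in> lin_maps K (of_alg M) (of_alg M)"
    by (simp add: lin_maps_def theta_act_def smult_add_vec)
  show "theta_act M (g \<odot>\<^bsub>of_alg M\<^esub> v)
      = \<alpha> g \<odot>\<^bsub>of_alg M\<^esub> theta_act M v \<oplus>\<^bsub>of_alg M\<^esub> \<beta> g \<odot>\<^bsub>of_alg M\<^esub> v"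
    if "g \<in> carrier G" "v \<in> carrier (of_alg M)" for g v
    using that smult_comp[of \<theta> "mult_by G g" v]
      smult_add[of "mult_by G (\<alpha> g) \<otimes>\<^bsub>E\<^esub> \<theta>" "mult_by G (\<beta> g)" v]
    by (simp add: theta_act_def theta_comp_mult_by smult_comp del: E_simps)
  show "(theta_act M ^^ p) v = c \<odot>\<^bsub>of_alg M\<^esub> v" if "v \<in> carrier (of_alg M)" for v
    using that by (simp add: theta_act_pow theta_E_pow del: E_simps)
qed

lemma series_of_alg:
  "\<lbrakk>g \<in> {..<l} \<rightarrow> carrier G; v \<in> carrier M\<rbrakk>
    \<Longrightarrow> series (of_alg M) (theta_act M) g l v = layer_sum g l \<odot>\<^bsub>M\<^esub> v"
proof (induction l)
  case 0
  have "\<zero>\<^bsub>E\<^esub> \<odot>\<^bsub>M\<^esub> v = \<zero>\<^bsub>M\<^esub>"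
    using smult_add[of "\<zero>\<^bsub>E\<^esub>" "\<zero>\<^bsub>E\<^esub>" v] smult_closed[of "\<zero>\<^bsub>E\<^esub>" v] 0 by (simp del: E_simps)
  interpret O: abelian_group "of_alg M" using module_of_alg module.axioms(2) by blast
  show ?case by (simp add: layer_sum_def series_def \<open>\<zero>\<^bsub>E\<^esub> \<odot>\<^bsub>M\<^esub> v = _\<close> del: E_simps)
next
  case (Suc l)
  interpret O: twisted_module G F \<theta> \<alpha> \<beta> c p "of_alg M" "theta_act M" by (rule twisted_module_of_alg)
  have g: "g \<in> {..<l} \<rightarrow> carrier G" "g l \<in> carrier G" using Suc.prems by auto
  have "series (of_alg M) (theta_act M) g (Suc l) v
      = series (of_alg M) (theta_act M) g l v \<oplus>\<^bsub>M\<^esub> mult_by G (g l) \<odot>\<^bsub>M\<^esub> (theta_act M ^^ l) v"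
    unfolding series_def using Suc.prems O.r_pow_closed[of v]
    by (subst O.M.finsum_lessThan_Suc) (auto simp: Pi_iff)
  moreover have "layer_sum g (Suc l) \<odot>\<^bsub>M\<^esub> v
      = layer_sum g l \<odot>\<^bsub>M\<^esub> v \<oplus>\<^bsub>M\<^esub> (mult_by G (g l) \<otimes>\<^bsub>E\<^esub> (\<theta> [^]\<^bsub>E\<^esub> l)) \<odot>\<^bsub>M\<^esub> v"
    using Suc.prems g by (subst layer_sum_Suc) (auto intro!: smult_add E.m_closed simp del: E_simps)
  ultimately show ?case
    using Suc g by (simp add: smult_comp theta_act_pow del: E_simps)
qed

text \<open>By \<open>E_eq_layer_sum\<close>, \<open>f\<close> is the layer sum of its own
  coefficients, and \<open>series_of_alg\<close> says that layer sums act on \<open>M\<close> by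
  series in \<open>theta_act M\<close>.\<close>

lemma smult_to_alg_of_alg:
  assumes "f \<in> carrier E" "v \<in> carrier M"
  shows "f \<odot>\<^bsub>to_alg (of_alg M) (theta_act M)\<^esub> v = f \<odot>\<^bsub>M\<^esub> v"
  using assms series_of_alg[OF coef_closed[OF assms(1)] assms(2)] E_eq_layer_sum[OF assms(1)]
  by (simp add: to_alg_def)

end

lemma (in skew_field_extension) endo_moduleI:
  "right_module A M \<Longrightarrow> endo_module G F \<theta> \<alpha> \<beta> c p M"
  by (intro endo_module.intro skew_field_extension_axioms)

section \<open>The two functors and the equivalence\<close>

context skew_field_extension begin

text \<open>\<open>frame\<close> absorbs the case distinction in \<open>Rep\<close>: each
  characteristic supplies it for its own \<open>\<theta>\<close>, and the equivalence is proved once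
  for both.\<close>

context
  fixes P :: "'x set" and leq :: "'x rel" and lvl :: "'x \<Rightarrow> 'x \<Rightarrow> nat" and \<delta> \<sigma> :: "'g \<Rightarrow> 'g"
  assumes eq: "equipped_poset p P leq lvl"
    and frame: "\<And>(V :: ('g, 'v) module) r. module G V \<and>
      (if ring_char K = p then delta_derivation G F p \<delta> V r else sigma_action G F p \<sigma> V r)
      \<longleftrightarrow> twisted_module G F \<theta> \<alpha> \<beta> c p V r"
begin

abbreviation C :: "(('g, 'v) module \<times> ('v \<Rightarrow> 'v) \<times> ('x \<Rightarrow> 'v set), 'v \<Rightarrow> 'v) category" where
  "C \<equiv> Rep G F p \<delta> \<sigma> P leq lvl"

abbreviation T :: "'x \<Rightarrow> 'x \<Rightarrow> ('g \<Rightarrow> 'g) set" where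
  "T \<equiv> (\<lambda>x y. A_layer G F \<theta> (lvl x y))"

abbreviation D :: "(('g \<Rightarrow> 'g, 'v) module \<times> ('x \<Rightarrow> 'v set), 'v \<Rightarrow> 'v) category" where
  "D \<equiv> Rep_alg K A T P leq"

lemma leqD: "(x, y) \<in> leq \<Longrightarrow> x \<in> P \<and> y \<in> P"
  using equipped_poset.order[OF eq] by (auto simp: partial_order_on_def preorder_on_def)

lemma leq_refl: "x \<in> P \<Longrightarrow> (x, x) \<in> leq"
  using equipped_poset.order[OF eq] by (auto simp: partial_order_on_def preorder_on_def refl_on_def)

lemma lvl_pos: "(x, y) \<in> leq \<Longrightarrow> 0 < lvl x y"
  using equipped_poset.lvl_range[OF eq] by fastforce

lemma objs_C: "(V, r, U) \<in> objs C \<longleftrightarrow> twisted_module G F \<theta> \<alpha> \<beta> c p V r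
    \<and> U \<in> P \<rightarrow>\<^sub>E {W. submodule W G V}
    \<and> (\<forall>(x, y) \<in> leq.
        {(\<Oplus>\<^bsub>V\<^esub> i \<in> {..<lvl x y}. (r ^^ i) (w i)) | w. w \<in> {..<lvl x y} \<rightarrow> U x} \<subseteq> U y)"
  unfolding frame[symmetric] Rep_def by simp

lemma arrs_C: "f \<in> arrs C (V, r, U) (V', r', U') \<longleftrightarrow> f \<in> lin_maps G V V'
    \<and> (\<forall>v \<in> carrier V. f (r v) = r' (f v)) \<and> (\<forall>x \<in> P. f ` U x \<subseteq> U' x)"
  by (simp add: Rep_def)

lemma objs_D: "(M, U) \<in> objs D \<longleftrightarrow> right_module A M
    \<and> U \<in> P \<rightarrow>\<^sub>E {W. submodule W K (restrict_scalars A M)}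
    \<and> (\<forall>(x, y) \<in> leq. \<forall>v \<in> U x. \<forall>t \<in> T x y. t \<odot>\<^bsub>M\<^esub> v \<in> U y)
    \<and> (\<forall>x \<in> P. \<forall>v \<in> U x. \<one>\<^bsub>E\<^esub> \<odot>\<^bsub>M\<^esub> v = v)"
  by (simp add: Rep_alg_def del: E_simps)

lemma arrs_D: "f \<in> arrs D (M, U) (M', U') \<longleftrightarrow> f \<in> lin_maps A M M' \<and> (\<forall>x \<in> P. f ` U x \<subseteq> U' x)"
  by (simp add: Rep_alg_def)

lemma objs_C_subset:
  assumes "(V, r, U) \<in> objs C" "x \<in> P" shows "submodule (U x) G V" "U x \<subseteq> carrier V"
proof -
  show "submodule (U x) G V" using assms by (auto simp: objs_C)
  then show "U x \<subseteq> carrier V" by (simp add: submodule_def subgroup_def)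
qed

lemma objs_D_subset:
  assumes "(M, U) \<in> objs D" "x \<in> P"
  shows "submodule (U x) K (restrict_scalars A M)" "U x \<subseteq> carrier M"
proof -
  show "submodule (U x) K (restrict_scalars A M)" using assms by (auto simp: objs_D)
  then show "U x \<subseteq> carrier M" by (simp add: submodule_def subgroup_def restrict_scalars_def)
qed

lemma structured_sets_C: "structured_sets C (\<lambda>(V, r, U). carrier V)"
proof (intro structured_sets.intro; clarify)
  fix V r U V' r' U' f
  assume "f \<in> arrs C (V, r, U) (V', r', U')"
  then show "f \<in> carrier V \<rightarrow>\<^sub>E carrier V'" by (auto simp: arrs_C lin_maps_def)
next
  fix V r U assume obj: "(V, r, U) \<in> objs C"
  then interpret twisted_module G F \<theta> \<alpha> \<beta> c p V r by (simp add: objs_C)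
  show "(\<lambda>v \<in> carrier V. v) \<in> arrs C (V, r, U) (V, r, U)"
    using objs_C_subset(2)[OF obj] lin_mapsD(1)[OF r_lin]
    by (auto simp: arrs_C intro!: restrict_id_lin_maps M.abelian_group_axioms)
next
  fix V r U V' r' U' V'' r'' U'' f g
  assume obj: "(V, r, U) \<in> objs C" "(V', r', U') \<in> objs C"
    and f: "f \<in> arrs C (V, r, U) (V', r', U')" and g: "g \<in> arrs C (V', r', U') (V'', r'', U'')"
  interpret twisted_module G F \<theta> \<alpha> \<beta> c p V r using obj by (simp add: objs_C)
  have fl: "f \<in> lin_maps G V V'" and gl: "g \<in> lin_maps G V' V''" using f g by (simp_all add: arrs_C)
  have "compose (carrier V) g f \<in> lin_maps G V V''"
    by (rule compose_lin_maps[OF fl gl M.abelian_group_axioms]) auto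
  then show "compose (carrier V) g f \<in> arrs C (V, r, U) (V'', r'', U'')"
    using f g objs_C_subset(2)[OF obj(1)] lin_mapsD(1)[OF r_lin] lin_mapsD(1)[OF fl]
    by (auto simp: arrs_C compose_def image_subset_iff subset_iff)
qed (simp_all add: Rep_def split: prod.splits)

lemma structured_sets_D: "structured_sets D (\<lambda>(M, U). carrier M)"
proof (intro structured_sets.intro; clarify)
  fix M U M' U' f
  assume "f \<in> arrs D (M, U) (M', U')"
  then show "f \<in> carrier M \<rightarrow>\<^sub>E carrier M'" by (auto simp: arrs_D lin_maps_def)
next
  fix M U assume obj: "(M, U) \<in> objs D"
  then interpret endo_module G F \<theta> \<alpha> \<beta> c p M by (intro endo_moduleI) (simp add: objs_D)
  show "(\<lambda>v \<in> carrier M. v) \<in> arrs D (M, U) (M, U)"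
    using objs_D_subset(2)[OF obj]
    by (auto simp: arrs_D intro!: restrict_id_lin_maps M.abelian_group_axioms)
next
  fix M U M' U' M'' U'' f g
  assume obj: "(M, U) \<in> objs D"
    and f: "f \<in> arrs D (M, U) (M', U')" and g: "g \<in> arrs D (M', U') (M'', U'')"
  interpret endo_module G F \<theta> \<alpha> \<beta> c p M
    using obj by (intro endo_moduleI) (simp add: objs_D)
  have "compose (carrier M) g f \<in> lin_maps A M M''"
    using f g by (intro compose_lin_maps[OF _ _ M.abelian_group_axioms]) (auto simp: arrs_D)
  then show "compose (carrier M) g f \<in> arrs D (M, U) (M'', U'')"
    using f g objs_D_subset(2)[OF obj] by (auto simp: arrs_D compose_def image_subset_iff subset_iff)
qed (simp_all add: Rep_alg_def split: prod.splits)

lemma to_alg_obj: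
  assumes obj: "(V, r, U) \<in> objs C" shows "(to_alg V r, U) \<in> objs D"
proof -
  interpret twisted_module G F \<theta> \<alpha> \<beta> c p V r using obj by (simp add: objs_C)
  note sub_V = objs_C_subset[OF obj]
  have "submodule (U x) K (restrict_scalars A (to_alg V r))" if "x \<in> P" for x
  proof (rule submodule_cong[OF _ _ _ sub_V(1)[OF that]])
    fix a v assume a: "a \<in> carrier K" and v: "v \<in> U x"
    have "v \<in> carrier V" "a \<in> carrier G" using a v sub sub_V(2)[OF that] by auto
    moreover have "a \<odot>\<^bsub>A\<^esub> \<one>\<^bsub>A\<^esub> = mult_by G a" by (auto simp: mult_by_def)
    ultimately have "a \<odot>\<^bsub>restrict_scalars A (to_alg V r)\<^esub> v = a \<odot>\<^bsub>V\<^esub> v"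
      by (simp add: restrict_scalars_def act_mult_by del: A_simps)
    then show "a \<odot>\<^bsub>restrict_scalars A (to_alg V r)\<^esub> v \<in> U x"
      using submodule.smult_closed[OF sub_V(1)[OF that]] \<open>a \<in> carrier G\<close> v by simp
  qed (simp_all add: restrict_scalars_def)
  moreover have "act t v \<in> U y" if xy: "(x, y) \<in> leq" and v: "v \<in> U x" and t: "t \<in> T x y" for x y v t
  proof -
    have P: "x \<in> P" "y \<in> P" using leqD[OF xy] by auto
    then have vV: "v \<in> carrier V" using v sub_V(2) by auto
    have "(r ^^ j) v \<in> U y" if j: "j < lvl x y" for j
    proof -
      \<comment> \<open>The condition on objects concerns whole sums over the exponents; a family
        supported at \<open>j\<close> isolates the single term \<open>(r ^^ j) v\<close>.\<close>
      let ?w = "\<lambda>i. if i = j then v else \<zero>\<^bsub>V\<^esub>"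
      have "\<zero>\<^bsub>V\<^esub> \<in> U x"
        using sub_V(1)[OF P(1)] by (simp add: submodule_def subgroup_def)
      then have "?w \<in> {..<lvl x y} \<rightarrow> U x" using v by auto
      then have "(\<Oplus>\<^bsub>V\<^esub> i \<in> {..<lvl x y}. (r ^^ i) (?w i)) \<in> U y"
        using obj xy unfolding objs_C by blast
      also have "(\<Oplus>\<^bsub>V\<^esub> i \<in> {..<lvl x y}. (r ^^ i) (?w i))
          = (\<Oplus>\<^bsub>V\<^esub> i \<in> {..<lvl x y}. if i = j then (r ^^ j) v else \<zero>\<^bsub>V\<^esub>)"
        using vV by (intro M.finsum_cong') (auto simp: r_pow_zero)
      also have "\<dots> = (r ^^ j) v" using j vV by (intro M.finsum_delta) auto
      finally show ?thesis .
    qed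
    then show ?thesis by (intro act_mem_submodule[OF sub_V(1)[OF P(2)] vV _ t])
  qed
  moreover have "act \<one>\<^bsub>E\<^esub> v = v" if "x \<in> P" "v \<in> U x" for x v
    using sub_V(2)[OF that(1)] that(2) by (intro act_one) auto
  ultimately show ?thesis
    using obj right_module_to_alg by (auto simp: objs_D objs_C PiE_iff simp del: E_simps)
qed

lemma of_alg_obj:
  assumes obj: "(M, U) \<in> objs D" shows "(of_alg M, theta_act M, U) \<in> objs C"
proof -
  interpret endo_module G F \<theta> \<alpha> \<beta> c p M using obj by (intro endo_moduleI) (simp add: objs_D)
  interpret O: twisted_module G F \<theta> \<alpha> \<beta> c p "of_alg M" "theta_act M" by (rule twisted_module_of_alg)
  note sub_M = objs_D_subset[OF obj]
  have act: "t \<odot>\<^bsub>M\<^esub> v \<in> U y" if "(x, y) \<in> leq" "v \<in> U x" "t \<in> T x y" for x y v t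
    using obj that unfolding objs_D by blast
  have subm: "submodule (U x) G (of_alg M)" if x: "x \<in> P" for x
  proof (rule submodule_cong[OF _ _ _ sub_M(1)[OF x]])
    fix a v assume a: "a \<in> carrier G" and v: "v \<in> U x"
    \<comment> \<open>So far \<open>U x\<close> is only an \<open>F\<close>-subspace. The level of
      (x, x) is at least 1, so the layer \<open>T x x\<close> contains all multiplications by
      elements of \<open>G\<close>, which makes \<open>U x\<close> stable under
      \<open>G\<close>.\<close>
    have "mult_by G a \<otimes>\<^bsub>E\<^esub> (\<theta> [^]\<^bsub>E\<^esub> (0::nat)) \<in> T x x"
      using a lvl_pos[OF leq_refl[OF x]] by (rule mult_by_comp_theta_pow_mem_A_layer)
    then have "mult_by G a \<in> T x x"
      using a by (simp del: E_simps)
    then show "a \<odot>\<^bsub>of_alg M\<^esub> v \<in> U x" using act[OF leq_refl[OF x] v] by simp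
  qed (simp_all add: restrict_scalars_def)
  moreover have "(\<Oplus>\<^bsub>of_alg M\<^esub> i \<in> {..<lvl x y}. (theta_act M ^^ i) (w i)) \<in> U y"
    if xy: "(x, y) \<in> leq" and w: "w \<in> {..<lvl x y} \<rightarrow> U x" for x y w
  proof (rule submodule_finsum[OF subm O.M.abelian_group_axioms])
    show "y \<in> P" using leqD[OF xy] by simp
    fix i assume i: "i \<in> {..<lvl x y}"
    then have wi: "w i \<in> U x" "w i \<in> carrier M" using w sub_M(2) leqD[OF xy] by auto
    \<comment> \<open>With coefficient \<open>\<one>\<close> the monomial is a bare power of
      \<open>\<theta>\<close>, which acts on \<open>M\<close> as the corresponding power of
      \<open>theta_act M\<close>.\<close>
    have "mult_by G \<one> \<otimes>\<^bsub>E\<^esub> (\<theta> [^]\<^bsub>E\<^esub> i) \<in> T x y"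
      using i by (intro mult_by_comp_theta_pow_mem_A_layer) auto
    then have "\<theta> [^]\<^bsub>E\<^esub> i \<in> T x y" by (simp add: mult_by_one del: E_simps)
    then show "(theta_act M ^^ i) (w i) \<in> U y"
      using act[OF xy wi(1)] theta_act_pow[OF wi(2)] by simp
  qed
  ultimately show ?thesis
    using obj O.twisted_module_axioms by (auto simp: objs_D objs_C PiE_iff)
qed

lemma Rep_equivalent: "equivalent_categories C D"
proof (rule equivalent_structured_sets[OF structured_sets_C structured_sets_D,
      where F = "\<lambda>(V, r, U). (to_alg V r, U)" and H = "\<lambda>(M, U). (of_alg M, theta_act M, U)"];
    clarsimp)
  show "(to_alg V r, U) \<in> objs D" if "(V, r, U) \<in> objs C" for V r U
    by (rule to_alg_obj[OF that])
  show "(of_alg M, theta_act M, U) \<in> objs C" if "(M, U) \<in> objs D" for M U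
    by (rule of_alg_obj[OF that])
next
  fix V r U V' r' U' f
  assume obj: "(V, r, U) \<in> objs C" "(V', r', U') \<in> objs C" and f: "f \<in> arrs C (V, r, U) (V', r', U')"
  interpret twisted_module G F \<theta> \<alpha> \<beta> c p V r using obj by (simp add: objs_C)
  show "f \<in> arrs D (to_alg V r, U) (to_alg V' r', U')"
    using f obj(2) by (auto simp: arrs_C arrs_D objs_C intro!: lin_maps_to_alg)
next
  fix M U M' U' f
  assume obj: "(M, U) \<in> objs D" and f: "f \<in> arrs D (M, U) (M', U')"
  interpret endo_module G F \<theta> \<alpha> \<beta> c p M using obj by (intro endo_moduleI) (simp add: objs_D)
  have fl: "f \<in> lin_maps A M M'" using f by (simp add: arrs_D)
  then have "f \<in> lin_maps G (of_alg M) (of_alg M')"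
    by (simp add: lin_maps_def)
  then show "f \<in> arrs C (of_alg M, theta_act M, U) (of_alg M', theta_act M', U')"
    using f lin_mapsD(1)[OF fl] lin_mapsD(4)[OF fl, of \<theta>] by (simp add: arrs_C arrs_D theta_act_def)
next
  fix V r U assume obj: "(V, r, U) \<in> objs C"
  interpret twisted_module G F \<theta> \<alpha> \<beta> c p V r using obj by (simp add: objs_C)
  interpret N: endo_module G F \<theta> \<alpha> \<beta> c p "to_alg V r" by (rule endo_moduleI[OF right_module_to_alg])
  interpret O: twisted_module G F \<theta> \<alpha> \<beta> c p "of_alg (to_alg V r)" "theta_act (to_alg V r)"
    by (rule N.twisted_module_of_alg)
  have r: "theta_act (to_alg V r) v = r v" "r v \<in> carrier V" if "v \<in> carrier V" for v
    using that lin_mapsD(1)[OF r_lin] by (simp_all add: theta_act_def act_theta)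
  show "(\<lambda>v \<in> carrier V. v) \<in> arrs C (V, r, U) (of_alg (to_alg V r), theta_act (to_alg V r), U)"
    using objs_C_subset(2)[OF obj] r
    by (auto simp: arrs_C act_mult_by intro!: restrict_id_lin_maps M.abelian_group_axioms)
  have "(\<lambda>v \<in> carrier (of_alg (to_alg V r)). v) \<in> lin_maps G (of_alg (to_alg V r)) V"
    by (rule restrict_id_lin_maps[OF _ _ _ _ O.M.abelian_group_axioms]) (auto simp: act_mult_by)
  then show "(\<lambda>v \<in> carrier V. v) \<in> arrs C (of_alg (to_alg V r), theta_act (to_alg V r), U) (V, r, U)"
    using objs_C_subset(2)[OF obj] r by (auto simp: arrs_C)
next
  fix M U assume obj: "(M, U) \<in> objs D"
  interpret endo_module G F \<theta> \<alpha> \<beta> c p M using obj by (intro endo_moduleI) (simp add: objs_D)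
  interpret O: twisted_module G F \<theta> \<alpha> \<beta> c p "of_alg M" "theta_act M" by (rule twisted_module_of_alg)
  let ?N = "to_alg (of_alg M) (theta_act M)"
  have eq: "f \<odot>\<^bsub>?N\<^esub> v = f \<odot>\<^bsub>M\<^esub> v" if "f \<in> carrier E" "v \<in> carrier M" for f v
    using smult_to_alg_of_alg that .
  have "(\<lambda>v \<in> carrier ?N. v) \<in> lin_maps A ?N M"
    using eq smult_closed O.right_module_to_alg
    by (intro restrict_id_lin_maps) (auto simp: right_module_def simp del: O.to_alg_smult)
  then show "(\<lambda>v \<in> carrier M. v) \<in> arrs D (?N, U) (M, U)"
    using objs_D_subset(2)[OF obj] by (auto simp: arrs_D)
  have "(\<lambda>v \<in> carrier M. v) \<in> lin_maps A M ?N"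
    using eq smult_closed
    by (intro restrict_id_lin_maps M.abelian_group_axioms) (auto simp del: O.to_alg_smult)
  then show "(\<lambda>v \<in> carrier M. v) \<in> arrs D (M, U) (?N, U)"
    using objs_D_subset(2)[OF obj] by (auto simp: arrs_D)
qed

end

end

section \<open>Discrete Fourier inversion\<close>

lemma (in cring) geometric_sum:
  "z \<in> carrier R \<Longrightarrow> (z \<ominus> \<one>) \<otimes> (\<Oplus>i\<in>{..<n::nat}. z [^] i) = z [^] n \<ominus> \<one>"
proof (induction n)
  case 0
  then show ?case by (simp add: r_neg minus_eq)
next
  case (Suc n)
  let ?s = "\<Oplus>i\<in>{..<n}. z [^] i"
  have "?s \<in> carrier R" using Suc.prems by (intro finsum_closed) auto
  have "(z \<ominus> \<one>) \<otimes> (?s \<oplus> z [^] n) = (z \<ominus> \<one>) \<otimes> ?s \<oplus> (z \<ominus> \<one>) \<otimes> z [^] n"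
    using Suc.prems \<open>?s \<in> carrier R\<close> by (intro r_distr) auto
  also have "\<dots> = (z [^] n \<ominus> \<one>) \<oplus> (z \<ominus> \<one>) \<otimes> z [^] n" using Suc by simp
  also have "\<dots> = z [^] Suc n \<ominus> \<one>" using Suc.prems nat_pow_closed[of z n] unfolding nat_pow_Suc by algebra
  finally show ?case
    using Suc.prems by (subst finsum_lessThan_Suc) auto
qed

text \<open>\<open>v\<close> is the inverse of \<open>u\<close>, so the terms are the powers of z =
  u^(k-i), written without negative exponents. For \<open>i \<noteq> k\<close> primitivity gives z
  \<noteq> 1, whereas z^p = 1 makes z - 1 annihilate the geometric sum.\<close>

lemma (in field) orthogonality:
  assumes u: "u \<in> carrier R" "v \<in> carrier R" "u \<otimes> v = \<one>" and up: "u [^] p = \<one>"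
    and prim: "\<And>k. \<lbrakk>0 < k; k < p\<rbrakk> \<Longrightarrow> u [^] k \<noteq> \<one>" and ki: "k < p" "i < (p::nat)"
  shows "(\<Oplus>j\<in>{..<p}. u [^] (k * j) \<otimes> v [^] (i * j)) = (if i = k then [p] \<cdot> \<one> else \<zero>)"
proof -
  let ?z = "u [^] k \<otimes> v [^] i"
  have z: "?z \<in> carrier R" using u by simp
  have uv: "u [^] n \<otimes> v [^] n = \<one>" for n :: nat
    using u by (simp flip: nat_pow_distrib)
  have vp: "v [^] p = \<one>" using uv[of p] up u by simp
  have "(\<Oplus>j\<in>{..<p}. u [^] (k * j) \<otimes> v [^] (i * j)) = (\<Oplus>j\<in>{..<p}. ?z [^] j)"
    using u by (intro finsum_cong') (auto simp: nat_pow_distrib nat_pow_pow)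
  also have "\<dots> = (if i = k then [p] \<cdot> \<one> else \<zero>)"
  proof (cases "i = k")
    case True
    then show ?thesis using uv add.finprod_const[of \<one> "{..<p}"] by simp
  next
    case False
    have zp: "?z [^] p = \<one>"
    proof -
      have "(u [^] k) [^] p = \<one>" "(v [^] i) [^] p = \<one>"
        using u up vp by (metis nat_pow_pow mult.commute nat_pow_one)+
      then show ?thesis using u by (simp add: nat_pow_distrib)
    qed
    have "?z \<noteq> \<one>"
    proof
      assume z1: "?z = \<one>"
      have "u [^] k = u [^] k \<otimes> (v [^] i \<otimes> u [^] i)" using uv[of i] u by (simp add: m_comm)
      also have "\<dots> = u [^] i" using z1 u by (simp flip: m_assoc)
      finally have eq: "u [^] k = u [^] i" .
      \<comment> \<open>Equal powers with exponents \<open>a < b\<close> cancel to a power with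
        exponent \<open>b - a\<close>, strictly between 0 and \<open>p\<close>. Natural subtraction
        needs the smaller exponent to be known, hence the two applications below.\<close>
      have *: False if "a < b" "b < p" "u [^] a = u [^] b" for a b :: nat
      proof -
        have "u [^] (b - a) = u [^] (b - a) \<otimes> (u [^] a \<otimes> v [^] a)" using uv u by simp
        also have "\<dots> = u [^] (b - a + a) \<otimes> v [^] a" using u by (simp add: m_assoc flip: nat_pow_mult)
        also have "\<dots> = \<one>" using that(1) uv[of a] by (simp flip: that(3))
        finally show False using prim[of "b - a"] that by simp
      qed
      show False using *[of k i] *[of i k] eq ki False by (cases "k < i") auto
    qed
    then have "?z \<ominus> \<one> \<noteq> \<zero>" using z by simp
    moreover have "(?z \<ominus> \<one>) \<otimes> (\<Oplus>j\<in>{..<p}. ?z [^] j) = \<zero>"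
      using geometric_sum[OF z, of p] zp by (simp add: r_neg minus_eq)
    moreover have "(\<Oplus>j\<in>{..<p}. ?z [^] j) \<in> carrier R" using z by (intro finsum_closed) auto
    ultimately show ?thesis using False z integral[of "?z \<ominus> \<one>"] by auto
  qed
  finally show ?thesis .
qed

text \<open>Interchanging the sums leaves the orthogonality relation. The roles of \<open>u\<close>
  and \<open>v\<close> can be exchanged: a root of unity followed by its inverse yields existence of
  expansions, the opposite order uniqueness.\<close>

lemma (in field) fourier_inversion:
  assumes u: "u \<in> carrier R" "v \<in> carrier R" "u \<otimes> v = \<one>" and up: "u [^] p = \<one>"
    and prim: "\<And>k. \<lbrakk>0 < k; k < p\<rbrakk> \<Longrightarrow> u [^] k \<noteq> \<one>"
    and h: "h \<in> {..<p} \<rightarrow> carrier R" and k: "k < (p::nat)"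
  shows "(\<Oplus>j\<in>{..<p}. u [^] (k * j) \<otimes> (\<Oplus>i\<in>{..<p}. v [^] (i * j) \<otimes> h i)) = [p] \<cdot> \<one> \<otimes> h k"
proof -
  have h': "\<And>i. i < p \<Longrightarrow> h i \<in> carrier R" using h by auto
  have "(\<Oplus>j\<in>{..<p}. u [^] (k * j) \<otimes> (\<Oplus>i\<in>{..<p}. v [^] (i * j) \<otimes> h i))
      = (\<Oplus>j\<in>{..<p}. \<Oplus>i\<in>{..<p}. u [^] (k * j) \<otimes> (v [^] (i * j) \<otimes> h i))"
    using u h' by (intro finsum_cong' finsum_rdistr) (auto intro!: finsum_closed)
  also have "\<dots> = (\<Oplus>i\<in>{..<p}. \<Oplus>j\<in>{..<p}. u [^] (k * j) \<otimes> (v [^] (i * j) \<otimes> h i))"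
    using u h' by (intro finsum_swap) auto
  also have "\<dots> = (\<Oplus>i\<in>{..<p}. (\<Oplus>j\<in>{..<p}. u [^] (k * j) \<otimes> v [^] (i * j)) \<otimes> h i)"
    using u h' by (intro finsum_cong') (auto simp: finsum_ldistr m_assoc intro!: finsum_closed)
  also have "\<dots> = (\<Oplus>i\<in>{..<p}. if i = k then [p] \<cdot> \<one> \<otimes> h k else \<zero>)"
    using u h' orthogonality[OF u up prim k] by (intro finsum_cong') auto
  also have "\<dots> = [p] \<cdot> \<one> \<otimes> h k"
    using k h' by (intro finsum_delta) auto
  finally show ?thesis .
qed

section \<open>Radical extensions of prime degree\<close>

locale radical_extension = endomorphisms G F + field G for G :: "'g ring" (structure) and F +
  fixes \<xi> :: 'g and p :: nat
  assumes p_gt: "1 < p"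
    and xi_closed [simp]: "\<xi> \<in> carrier G"
    and xi_span: "x \<in> carrier G \<Longrightarrow> \<exists>a \<in> {..<p} \<rightarrow> F. x = (\<Oplus>i\<in>{..<p}. a i \<otimes> \<xi> [^] i)"
begin

lemma E_eq_on_powers:
  assumes "f \<in> carrier E" "h \<in> carrier E" "\<And>i. i < p \<Longrightarrow> f (\<xi> [^] i) = h (\<xi> [^] i)"
  shows "f = h"
proof (rule E_eqI[OF assms(1,2)])
  fix x assume "x \<in> carrier G"
  then obtain a where a: "a \<in> {..<p} \<rightarrow> F" and x: "x = (\<Oplus>i\<in>{..<p}. a i \<otimes> \<xi> [^] i)"
    using xi_span by blast
  have cl: "a i \<in> F" "a i \<in> carrier G" if "i < p" for i using a sub that by auto
  have eq: "f' x = (\<Oplus>i\<in>{..<p}. a i \<otimes> f' (\<xi> [^] i))" if "f' \<in> carrier E" for f'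
  proof -
    have "f' x = (\<Oplus>i\<in>{..<p}. f' (a i \<otimes> \<xi> [^] i))"
      unfolding x using that cl by (intro E_finsum) auto
    also have "\<dots> = (\<Oplus>i\<in>{..<p}. a i \<otimes> f' (\<xi> [^] i))"
      using that cl by (intro finsum_cong') (auto simp: E_smult E_closed)
    finally show ?thesis .
  qed
  show "f x = h x"
    unfolding eq[OF assms(1)] eq[OF assms(2)] using assms cl
    by (intro finsum_cong') (auto simp: E_closed)
qed

text \<open>The function is a sum of products in the ring \<open>E\<close>. This is stated here for
  an arbitrary element of \<open>E\<close>, since it helps to establish the frame in which
  \<open>layer_sum\<close> lives.\<close>

lemma theta_sum_E:
  assumes "\<theta> \<in> carrier E" "g \<in> {..<l} \<rightarrow> carrier G"
  shows "(\<lambda>x \<in> carrier G. \<Oplus>i\<in>{..<l}. g i \<otimes> (\<theta> ^^ i) x) \<in> carrier E"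
proof -
  have mem: "(\<lambda>i. mult_by G (g i) \<otimes>\<^bsub>E\<^esub> (\<theta> [^]\<^bsub>E\<^esub> i)) \<in> {..<l} \<rightarrow> carrier E"
    using assms by (auto simp: Pi_iff simp del: E_simps intro!: E.m_closed)
  have "(\<Oplus>\<^bsub>E\<^esub> i \<in> {..<l}. mult_by G (g i) \<otimes>\<^bsub>E\<^esub> (\<theta> [^]\<^bsub>E\<^esub> i))
      = (\<lambda>x \<in> carrier G. \<Oplus>i\<in>{..<l}. g i \<otimes> (\<theta> ^^ i) x)" (is "?s = _")
  proof (rule extensionalityI[of _ "carrier G"])
    show "?s \<in> extensional (carrier G)" by (rule E_ext[OF E.finsum_closed[OF mem]])
    fix x assume x: "x \<in> carrier G"
    have "?s x = (\<Oplus>i\<in>{..<l}. (mult_by G (g i) \<otimes>\<^bsub>E\<^esub> (\<theta> [^]\<^bsub>E\<^esub> i)) x)"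
      using x by (intro E_finsum_apply mem) auto
    also have "\<dots> = (\<Oplus>i\<in>{..<l}. g i \<otimes> (\<theta> ^^ i) x)"
    proof (intro finsum_cong')
      fix i assume "i \<in> {..<l}"
      then have "g i \<in> carrier G" using assms(2) by auto
      then show "(mult_by G (g i) \<otimes>\<^bsub>E\<^esub> (\<theta> [^]\<^bsub>E\<^esub> i)) x = g i \<otimes> (\<theta> ^^ i) x"
        using x assms(1) by (simp add: compose_eq E_pow mult_by_def funpow_closed)
    qed (use x assms in \<open>auto simp: funpow_closed\<close>)
    finally show "?s x = (\<lambda>x \<in> carrier G. \<Oplus>i\<in>{..<l}. g i \<otimes> (\<theta> ^^ i) x) x" using x by simp
  qed auto
  then show ?thesis using E.finsum_closed[OF mem] by metis
qed

text \<open>Reduces the expansion of \<open>f\<close> to \<open>p\<close> linear equations for the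
  \<open>p\<close> unknowns \<open>g j\<close>, one for each power of \<open>\<xi>\<close>.\<close>

lemma expansion_if_on_powers:
  assumes "\<theta> \<in> carrier E" "f \<in> carrier E" "g \<in> {..<p} \<rightarrow> carrier G"
    and "\<And>i. i < p \<Longrightarrow> (\<Oplus>j\<in>{..<p}. g j \<otimes> (\<theta> ^^ j) (\<xi> [^] i)) = f (\<xi> [^] i)" and "x \<in> carrier G"
  shows "f x = (\<Oplus>j\<in>{..<p}. g j \<otimes> (\<theta> ^^ j) x)"
proof -
  have "f = (\<lambda>x \<in> carrier G. \<Oplus>i\<in>{..<p}. g i \<otimes> (\<theta> ^^ i) x)"
    by (rule E_eq_on_powers[OF assms(2) theta_sum_E[OF assms(1,3)]]) (simp add: assms(4))
  from arg_cong[OF this, of "\<lambda>h. h x"] show ?thesis using assms(5) by simp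
qed

lemma funpow_smult:
  assumes "\<theta> \<in> carrier E" "a \<in> F" "x \<in> carrier G"
  shows "(\<theta> ^^ n) (a \<otimes> x) = a \<otimes> (\<theta> ^^ n) x"
  using assms by (induction n) (auto simp: E_smult funpow_closed)

lemma funpow_eq:
  assumes "\<theta> \<in> carrier E" "f \<in> carrier E" "\<And>i. i < p \<Longrightarrow> (\<theta> ^^ n) (\<xi> [^] i) = f (\<xi> [^] i)" "x \<in> carrier G"
  shows "(\<theta> ^^ n) x = f x"
proof -
  have "\<theta> [^]\<^bsub>E\<^esub> n = f"
    using assms by (intro E_eq_on_powers) (auto simp: E_pow simp del: E_simps)
  then show ?thesis using E_pow assms by metis
qed

end

context radical_extension begin

lemma nat_mult_eq: "x \<in> carrier G \<Longrightarrow> [n] \<cdot> x = ([n] \<cdot> \<one>) \<otimes> x" for n :: nat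
  using add_pow_ldistr[of \<one> x n] by simp

lemma skew_field_extension_derivation:
  assumes F: "subring F G"
    and char: "\<And>n::nat. \<lbrakk>0 < n; n < p\<rbrakk> \<Longrightarrow> [n] \<cdot> \<one> \<noteq> \<zero>"
    and der: "standard_derivation G F p \<xi> \<delta>"
  shows "skew_field_extension G F \<delta> (\<lambda>g. g) \<delta> \<zero> p"
proof -
  have dE [simp]: "\<delta> \<in> carrier E"
    and leib: "\<And>a b. \<lbrakk>a \<in> carrier G; b \<in> carrier G\<rbrakk> \<Longrightarrow> \<delta> (a \<otimes> b) = \<delta> a \<otimes> b \<oplus> a \<otimes> \<delta> b"
    and d_xi: "\<And>i. i < p \<Longrightarrow> \<delta> (\<xi> [^] i) = [i] \<cdot> (\<xi> [^] (i - 1))"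
    using der by (auto simp: standard_derivation_def carrier_E)
  note cl [simp] = funpow_closed[OF dE] E_closed[OF dE]
  have natF: "[n] \<cdot> \<one> \<in> F" for n :: nat
    using subringE(2,3,7)[OF F] by (induction n) (auto simp: add_pow_def nat_pow_def)
  have natG [simp]: "[n] \<cdot> \<one> \<in> carrier G" for n :: nat by simp
  \<comment> \<open>Integers lie in \<open>F\<close>, so powers of \<open>\<delta>\<close> are
    linear over them. Iterating this recursion gives zero for \<open>j > i\<close> and the factorial
    of \<open>i\<close> for \<open>j = i\<close>, which is nonzero for \<open>i < p\<close> by
    \<open>char\<close>.\<close>
  have step: "(\<delta> ^^ Suc j) (\<xi> [^] Suc i) = ([Suc i] \<cdot> \<one>) \<otimes> (\<delta> ^^ j) (\<xi> [^] i)" if "Suc i < p" for i j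
  proof -
    have "(\<delta> ^^ Suc j) (\<xi> [^] Suc i) = (\<delta> ^^ j) (([Suc i] \<cdot> \<one>) \<otimes> \<xi> [^] i)"
      using d_xi[OF that] nat_mult_eq[of "\<xi> [^] i" "Suc i"]
      by (simp add: funpow_Suc_right del: funpow.simps nat_pow_Suc add.nat_pow_Suc)
    also have "\<dots> = ([Suc i] \<cdot> \<one>) \<otimes> (\<delta> ^^ j) (\<xi> [^] i)"
      by (intro funpow_smult natF) auto
    finally show ?thesis .
  qed
  have zero: "(\<delta> ^^ j) \<zero> = \<zero>" for j by (induction j) (auto simp: E_zero[OF dE])
  have above: "(\<delta> ^^ j) (\<xi> [^] i) = \<zero>" if "i < j" "i < p" for i j
    using that
  proof (induction i arbitrary: j)
    case 0
    then obtain j' where "j = Suc j'" by (cases j) auto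
    then show ?case using d_xi[of 0] 0 zero by (simp add: funpow_swap1)
  next
    case (Suc i)
    then obtain j' where "j = Suc j'" by (cases j) auto
    then show ?case using Suc step by (simp del: funpow.simps nat_pow_Suc add.nat_pow_Suc)
  qed
  have diag: "(\<delta> ^^ i) (\<xi> [^] i) \<noteq> \<zero>" if "i < p" for i
    using that
  proof (induction i)
    case (Suc i)
    then show ?case
      using step[of i i] char[of "Suc i"] natG[of "Suc i"] integral[of "[Suc i] \<cdot> \<one>" "(\<delta> ^^ i) (\<xi> [^] i)"]
      by (auto simp del: funpow.simps nat_pow_Suc add.nat_pow_Suc)
  qed auto
  show ?thesis
  proof (intro skew_field_extension.intro endomorphisms_axioms skew_field_extension_axioms.intro)
    show "(\<delta> ^^ p) x = \<zero> \<otimes> x" if "x \<in> carrier G" for x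
      using funpow_eq[OF dE in_E(2), of p x] above[of _ p] that by simp
    show "\<delta> (g \<otimes> x) = g \<otimes> \<delta> x \<oplus> \<delta> g \<otimes> x" if "g \<in> carrier G" "x \<in> carrier G" for g x
      using leib[OF that] that by (simp add: a_comm)
  next
    fix f assume f: "f \<in> carrier E"
    \<comment> \<open>Forward substitution: the first \<open>n\<close> equations are solved already.
      Changing the coefficient of the \<open>n\<close>-th power of \<open>\<delta>\<close> repairs
      the next one and disturbs none of them, since that power kills the lower powers of
      \<open>\<xi>\<close>.\<close>
    have "\<exists>g \<in> {..<p} \<rightarrow> carrier G. \<forall>i<n. (\<Oplus>j\<in>{..<p}. g j \<otimes> (\<delta> ^^ j) (\<xi> [^] i)) = f (\<xi> [^] i)"
      if "n \<le> p" for n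
      using that
    proof (induction n)
      case (Suc n)
      then obtain g where g: "g \<in> {..<p} \<rightarrow> carrier G"
        and IH: "\<And>i. i < n \<Longrightarrow> (\<Oplus>j\<in>{..<p}. g j \<otimes> (\<delta> ^^ j) (\<xi> [^] i)) = f (\<xi> [^] i)" by auto
      have gc: "\<And>i. i < p \<Longrightarrow> g i \<in> carrier G" using g by auto
      let ?s = "\<Oplus>j\<in>{..<p}. g j \<otimes> (\<delta> ^^ j) (\<xi> [^] n)" and ?d = "(\<delta> ^^ n) (\<xi> [^] n)"
      have s: "?s \<in> carrier G" using gc by (intro finsum_closed) auto
      have d: "?d \<in> carrier G" "?d \<noteq> \<zero>" using diag[of n] Suc.prems by auto
      \<comment> \<open>The error of the current \<open>g\<close> at the \<open>n\<close>-th power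
        of \<open>\<xi>\<close>, divided by the diagonal entry \<open>?d\<close>.\<close>
      define e where "e = (f (\<xi> [^] n) \<ominus> ?s) \<otimes> inv ?d"
      have e: "e \<in> carrier G" "e \<otimes> ?d = f (\<xi> [^] n) \<ominus> ?s"
        using s d E_closed[OF f] by (auto simp: e_def m_assoc field_Units)
      let ?g = "\<lambda>j. g j \<oplus> (if j = n then e else \<zero>)"
      have sum: "(\<Oplus>j\<in>{..<p}. ?g j \<otimes> (\<delta> ^^ j) (\<xi> [^] i))
          = (\<Oplus>j\<in>{..<p}. g j \<otimes> (\<delta> ^^ j) (\<xi> [^] i)) \<oplus> e \<otimes> (\<delta> ^^ n) (\<xi> [^] i)" for i :: nat
      proof -
        have "(\<Oplus>j\<in>{..<p}. ?g j \<otimes> (\<delta> ^^ j) (\<xi> [^] i)) = (\<Oplus>j\<in>{..<p}. g j \<otimes> (\<delta> ^^ j) (\<xi> [^] i)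
            \<oplus> (if j = n then e \<otimes> (\<delta> ^^ n) (\<xi> [^] i) else \<zero>))"
          using gc e by (intro finsum_cong') (auto simp: l_distr)
        also have "\<dots> = (\<Oplus>j\<in>{..<p}. g j \<otimes> (\<delta> ^^ j) (\<xi> [^] i))
            \<oplus> (\<Oplus>j\<in>{..<p}. if j = n then e \<otimes> (\<delta> ^^ n) (\<xi> [^] i) else \<zero>)"
          using gc e by (intro finsum_addf) auto
        also have "(\<Oplus>j\<in>{..<p}. if j = n then e \<otimes> (\<delta> ^^ n) (\<xi> [^] i) else \<zero>) = e \<otimes> (\<delta> ^^ n) (\<xi> [^] i)"
          using e Suc.prems by (intro finsum_delta) auto
        finally show ?thesis .
      qed
      have "(\<Oplus>j\<in>{..<p}. ?g j \<otimes> (\<delta> ^^ j) (\<xi> [^] i)) = f (\<xi> [^] i)" if "i < Suc n" for i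
      proof (cases "i = n")
        case True
        have "?s \<oplus> (f (\<xi> [^] n) \<ominus> ?s) = f (\<xi> [^] n)"
          using s E_closed[OF f, of "\<xi> [^] n"] by (simp add: minus_eq a_lcomm r_neg)
        then show ?thesis using sum[of n] e True by simp
      next
        case False
        then show ?thesis using sum[of i] IH[of i] above[of i n] that Suc.prems e E_closed[OF f] by simp
      qed
      moreover have "?g \<in> {..<p} \<rightarrow> carrier G" using gc e by auto
      ultimately show ?case by (intro bexI[of _ ?g] allI impI)
    qed auto
    from this[of p] obtain g where "g \<in> {..<p} \<rightarrow> carrier G"
      "\<And>i. i < p \<Longrightarrow> (\<Oplus>j\<in>{..<p}. g j \<otimes> (\<delta> ^^ j) (\<xi> [^] i)) = f (\<xi> [^] i)" by auto
    then show "\<exists>a \<in> {..<p} \<rightarrow> carrier G. \<forall>x \<in> carrier G. f x = (\<Oplus>i\<in>{..<p}. a i \<otimes> (\<delta> ^^ i) x)"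
      using expansion_if_on_powers[OF dE f] by blast
  next
    fix a k assume a: "a \<in> {..<p} \<rightarrow> carrier G" and k: "k < p"
      and vanish: "\<And>x. x \<in> carrier G \<Longrightarrow> (\<Oplus>i\<in>{..<p}. a i \<otimes> (\<delta> ^^ i) x) = \<zero>"
    have ac: "\<And>i. i < p \<Longrightarrow> a i \<in> carrier G" using a by auto
    show "a k = \<zero>" using k
    \<comment> \<open>At the \<open>k\<close>-th power of \<open>\<xi>\<close> the terms with
      \<open>j < k\<close> vanish by induction and those with \<open>j > k\<close> by
      \<open>above\<close>, so the diagonal term alone is zero.\<close>
    proof (induction k rule: less_induct)
      case (less k)
      have "\<zero> = (\<Oplus>j\<in>{..<p}. a j \<otimes> (\<delta> ^^ j) (\<xi> [^] k))" using vanish[of "\<xi> [^] k"] by simp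
      also have "\<dots> = (\<Oplus>j\<in>{..<p}. if j = k then a k \<otimes> (\<delta> ^^ k) (\<xi> [^] k) else \<zero>)"
      proof (intro finsum_cong')
        fix j assume "j \<in> {..<p}"
        then show "a j \<otimes> (\<delta> ^^ j) (\<xi> [^] k) = (if j = k then a k \<otimes> (\<delta> ^^ k) (\<xi> [^] k) else \<zero>)"
          using less.IH[of j] less.prems above[of k j] ac[of j]
          by (cases j k rule: linorder_cases) simp_all
      qed (use ac less.prems in auto)
      also have "\<dots> = a k \<otimes> (\<delta> ^^ k) (\<xi> [^] k)"
        using ac less.prems by (intro finsum_delta) auto
      finally show ?case
        using integral[of "a k" "(\<delta> ^^ k) (\<xi> [^] k)"] diag[OF less.prems] ac[OF less.prems] by auto
    qed
  qed (use p_gt in auto)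
qed

lemma skew_field_extension_automorphism:
  assumes sE [simp]: "\<tau> \<in> carrier E"
    and hom: "\<And>a b. \<lbrakk>a \<in> carrier G; b \<in> carrier G\<rbrakk> \<Longrightarrow> \<tau> (a \<otimes> b) = \<tau> a \<otimes> \<tau> b" "\<tau> \<one> = \<one>"
    and xi: "\<xi> \<noteq> \<zero>"
    and zeta: "\<zeta> \<in> F" "\<tau> \<xi> = \<zeta> \<otimes> \<xi>" "\<zeta> [^] p = \<one>" "\<And>k::nat. \<lbrakk>0 < k; k < p\<rbrakk> \<Longrightarrow> \<zeta> [^] k \<noteq> \<one>"
    and char: "[p] \<cdot> \<one> \<noteq> \<zero>"
    and F: "subring F G"
  shows "skew_field_extension G F \<tau> \<tau> (\<lambda>_. \<zero>) \<one> p"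
proof -
  note cl [simp] = funpow_closed[OF sE] E_closed[OF sE]
  have z [simp]: "\<zeta> \<in> carrier G" using zeta(1) sub by auto
  define \<omega> where "\<omega> = inv \<zeta>"
  have z0: "\<zeta> \<noteq> \<zero>" using zeta(3) p_gt nat_pow_zero[of p] by auto
  have w [simp]: "\<omega> \<in> carrier G" and zw: "\<zeta> \<otimes> \<omega> = \<one>" "\<omega> \<otimes> \<zeta> = \<one>"
    using z0 by (auto simp: \<omega>_def field_Units)
  have zwk: "\<zeta> [^] k \<otimes> \<omega> [^] k = \<one>" for k :: nat using zw by (simp flip: nat_pow_distrib)
  have wp: "\<omega> [^] p = \<one>" using zwk[of p] zeta(3) by simp
  have wk: "\<omega> [^] k \<noteq> \<one>" if "0 < k" "k < p" for k :: nat
    using zwk[of k] zeta(4)[OF that] by auto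
  let ?P = "[p] \<cdot> \<one>"
  have P: "?P \<in> carrier G" "inv ?P \<in> carrier G" "?P \<otimes> inv ?P = \<one>"
    using char by (auto simp: field_Units)
  have xi_pow: "\<xi> [^] i \<noteq> \<zero>" for i :: nat
    using xi by (induction i) (auto dest: integral)
  have xi_inv: "inv (\<xi> [^] i) \<in> carrier G" "inv (\<xi> [^] i) \<otimes> \<xi> [^] i = \<one>" for i :: nat
    using xi_pow[of i] by (auto simp: field_Units)
  have sig_pow: "\<tau> (\<xi> [^] i) = \<zeta> [^] i \<otimes> \<xi> [^] i" for i :: nat
    by (induction i) (auto simp: hom zeta(2) m_ac)
  have zF: "\<zeta> [^] n \<in> F" for n :: nat
    using subringE(3,6)[OF F] zeta(1) by (induction n) auto
  \<comment> \<open>\<open>\<tau>\<close> fixes the powers of \<open>\<zeta>\<close>, which lie in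
    \<open>F\<close>; each application therefore contributes one more factor \<zeta>^i.\<close>
  have sig: "(\<tau> ^^ j) (\<xi> [^] i) = \<zeta> [^] (i * j) \<otimes> \<xi> [^] i" for i j :: nat
  proof (induction j)
    case (Suc j)
    have "\<tau> (\<zeta> [^] (i * j) \<otimes> \<xi> [^] i) = \<zeta> [^] (i * j) \<otimes> (\<zeta> [^] i \<otimes> \<xi> [^] i)"
      using zF sig_pow by (subst E_smult[OF sE]) auto
    then show ?case using Suc by (simp add: m_assoc add.commute[of i] flip: nat_pow_mult)
  qed simp
  \<comment> \<open>On the \<open>i\<close>-th power of \<open>\<xi>\<close> the operator with
    coefficients \<open>g\<close> is multiplication by the discrete Fourier transform of
    \<open>g\<close> at \<open>i\<close>.\<close>
  have eval: "(\<Oplus>j\<in>{..<p}. g j \<otimes> (\<tau> ^^ j) (\<xi> [^] i)) = (\<Oplus>j\<in>{..<p}. \<zeta> [^] (i * j) \<otimes> g j) \<otimes> \<xi> [^] i"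
    if g: "\<And>j. j < p \<Longrightarrow> g j \<in> carrier G" for g i
  proof -
    have "(\<Oplus>j\<in>{..<p}. g j \<otimes> (\<tau> ^^ j) (\<xi> [^] i)) = (\<Oplus>j\<in>{..<p}. \<zeta> [^] (i * j) \<otimes> g j \<otimes> \<xi> [^] i)"
      using g by (intro finsum_cong') (auto simp: sig m_ac)
    then show ?thesis using g by (subst finsum_ldistr) auto
  qed
  show ?thesis
  proof (intro skew_field_extension.intro endomorphisms_axioms skew_field_extension_axioms.intro)
    show "(\<tau> ^^ p) x = \<one> \<otimes> x" if "x \<in> carrier G" for x
    proof -
      have "\<zeta> [^] (i * p) = \<one>" for i :: nat
        using zeta(3) nat_pow_pow[OF z, of p i] by (simp add: mult.commute)
      then show ?thesis using funpow_eq[OF sE in_E(1), of p x] that sig[of p] by simp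
    qed
    show "\<tau> (g \<otimes> x) = \<tau> g \<otimes> \<tau> x \<oplus> \<zero> \<otimes> x" if "g \<in> carrier G" "x \<in> carrier G" for g x
      using hom that by simp
  next
    fix f assume f: "f \<in> carrier E"
    \<comment> \<open>\<open>h\<close> records the factor by which \<open>f\<close> multiplies each
      power of \<open>\<xi>\<close>. The wanted \<open>g\<close> is the inverse transform of
      \<open>h\<close>, with \<open>inv ?P\<close> as the usual normalisation 1/p.\<close>
    define h where "h i = f (\<xi> [^] i) \<otimes> inv (\<xi> [^] i)" for i :: nat
    have h: "h i \<in> carrier G" "h i \<otimes> \<xi> [^] i = f (\<xi> [^] i)" for i
      using xi_inv E_closed[OF f] by (auto simp: h_def m_assoc)
    define s where "s j = (\<Oplus>i\<in>{..<p}. \<omega> [^] (i * j) \<otimes> h i)" for j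
    define g where "g j = inv ?P \<otimes> s j" for j
    have s: "s j \<in> carrier G" for j using h by (auto simp: s_def intro!: finsum_closed)
    have g: "g j \<in> carrier G" for j using s P by (simp add: g_def)
    have "(\<Oplus>j\<in>{..<p}. g j \<otimes> (\<tau> ^^ j) (\<xi> [^] k)) = f (\<xi> [^] k)" if k: "k < p" for k
    proof -
      have "(\<Oplus>j\<in>{..<p}. \<zeta> [^] (k * j) \<otimes> g j) = (\<Oplus>j\<in>{..<p}. inv ?P \<otimes> (\<zeta> [^] (k * j) \<otimes> s j))"
        using s P by (intro finsum_cong') (auto simp: g_def m_lcomm)
      also have "\<dots> = inv ?P \<otimes> (\<Oplus>j\<in>{..<p}. \<zeta> [^] (k * j) \<otimes> s j)"
        using s P by (intro finsum_rdistr[symmetric]) auto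
      also have "(\<Oplus>j\<in>{..<p}. \<zeta> [^] (k * j) \<otimes> s j) = ?P \<otimes> h k"
        unfolding s_def using h zeta(3,4) k by (intro fourier_inversion z w zw) auto
      also have "inv ?P \<otimes> (?P \<otimes> h k) = h k" using P h m_comm[of "inv ?P" ?P] by (simp flip: m_assoc)
      finally show ?thesis using eval[of g k] g h by simp
    qed
    then show "\<exists>a \<in> {..<p} \<rightarrow> carrier G. \<forall>x \<in> carrier G. f x = (\<Oplus>i\<in>{..<p}. a i \<otimes> (\<tau> ^^ i) x)"
      using expansion_if_on_powers[OF sE f, of g] g by (intro bexI[of _ g]) auto
  next
    fix a k assume a: "a \<in> {..<p} \<rightarrow> carrier G" and k: "k < p"
      and vanish: "\<And>x. x \<in> carrier G \<Longrightarrow> (\<Oplus>i\<in>{..<p}. a i \<otimes> (\<tau> ^^ i) x) = \<zero>"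
    have ac: "\<And>i. i < p \<Longrightarrow> a i \<in> carrier G" using a by auto
    have zero: "(\<Oplus>j\<in>{..<p}. \<zeta> [^] (j * i) \<otimes> a j) = \<zero>" for i
    proof -
      have prod: "(\<Oplus>j\<in>{..<p}. \<zeta> [^] (i * j) \<otimes> a j) \<otimes> \<xi> [^] i = \<zero>"
        using eval[of a i] ac vanish[of "\<xi> [^] i"] by simp
      have cl: "(\<Oplus>j\<in>{..<p}. \<zeta> [^] (i * j) \<otimes> a j) \<in> carrier G" using ac by (intro finsum_closed) auto
      have "(\<Oplus>j\<in>{..<p}. \<zeta> [^] (i * j) \<otimes> a j) = \<zero>"
        using integral[OF prod cl nat_pow_closed[OF xi_closed]] xi_pow[of i] by simp
      then show ?thesis by (simp add: mult.commute)
    qed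
    \<comment> \<open>All transforms of \<open>a\<close> vanish; inversion with
      \<open>\<omega>\<close> and \<open>\<zeta>\<close> in exchanged roles leaves p times
      \<open>a k\<close>.\<close>
    have "?P \<otimes> a k = (\<Oplus>j\<in>{..<p}. \<omega> [^] (k * j) \<otimes> (\<Oplus>i\<in>{..<p}. \<zeta> [^] (i * j) \<otimes> a i))"
      using a k wp wk zw by (intro fourier_inversion[symmetric]) auto
    also have "\<dots> = \<zero>"
      unfolding zero using finsum_zero by (simp add: add.finprod_one_eqI)
    finally show "a k = \<zero>" using integral[of ?P "a k"] P char ac[OF k] by auto
  qed (use p_gt in auto)
qed

lemma twisted_module_derivation_iff:
  assumes "skew_field_extension G F \<delta> (\<lambda>g. g) \<delta> \<zero> p"
  shows "module G V \<and> delta_derivation G F p \<delta> V r \<longleftrightarrow> twisted_module G F \<delta> (\<lambda>g. g) \<delta> \<zero> p V r"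
  using assms
  by (auto simp: twisted_module_def twisted_module_axioms_def delta_derivation_def module.smult_l_null)

lemma twisted_module_automorphism_iff:
  assumes "skew_field_extension G F \<tau> \<tau> (\<lambda>_. \<zero>) \<one> p"
  shows "module G V \<and> sigma_action G F p \<tau> V s \<longleftrightarrow> twisted_module G F \<tau> \<tau> (\<lambda>_. \<zero>) \<one> p V s"
proof (cases "module G V \<and> s \<in> lin_maps K V V")
  case True
  then interpret V: module G V by simp
  have "\<tau> g \<odot>\<^bsub>V\<^esub> s v \<oplus>\<^bsub>V\<^esub> \<zero> \<odot>\<^bsub>V\<^esub> v = \<tau> g \<odot>\<^bsub>V\<^esub> s v" if "g \<in> carrier G" "v \<in> carrier V" for g v
    using that lin_mapsD(1)[of s K V V] True skew_field_extension.alpha_closed[OF assms] by simp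
  then show ?thesis
    using assms True
    by (auto simp: twisted_module_def twisted_module_axioms_def sigma_action_def)
qed (auto simp: twisted_module_def twisted_module_axioms_def sigma_action_def)

end

section \<open>Galois theory of radical extensions\<close>

context field begin

text \<open>
  Replaces the derivative criterion: writing \<open>X\<^sup>p - \<xi>\<^sup>p = (X - \<xi>) s\<close>, one has
  \<open>s(\<xi>) = p \<xi>\<^bsup>p-1\<^esup> \<noteq> 0\<close>.
\<close>

lemma alg_mult_radical_le_1:
  assumes \<xi>: "\<xi> \<in> carrier R" "\<xi> \<noteq> \<zero>" and char: "[(p::nat)] \<cdot> \<one> \<noteq> \<zero>"
    and f: "f \<in> carrier (poly_ring R)"
    and dvd: "f pdivides (X [^]\<^bsub>poly_ring R\<^esub> p \<ominus>\<^bsub>poly_ring R\<^esub> poly_of_const (\<xi> [^] p))"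
  shows "alg_mult f \<xi> \<le> 1"
proof (rule ccontr)
  assume mult: "\<not> alg_mult f \<xi> \<le> 1"
  interpret UP: domain "poly_ring R" using univ_poly_is_domain[OF carrier_is_subring] .
  interpret ev: ring_hom_ring "poly_ring R" R "\<lambda>f. eval f \<xi>"
    using eval_ring_hom[OF carrier_is_subring \<xi>(1)] .
  interpret const: ring_hom_ring R "poly_ring R" poly_of_const
    using canonical_embedding_ring_hom[OF carrier_is_subring] by simp
  let ?C = "poly_of_const \<xi>" and ?L = "[\<one>, \<ominus> \<xi>]"
  have X: "X \<in> carrier (poly_ring R)" using var_closed(1)[OF carrier_is_subring] .
  have C: "?C \<in> carrier (poly_ring R)" using \<xi> by simp
  have eX: "eval X \<xi> = \<xi>" using \<xi> by (simp add: eval_var)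
  have eC: "eval ?C \<xi> = \<xi>" using \<xi> by (simp add: poly_of_const_def)
  have L: "?L = X \<ominus>\<^bsub>poly_ring R\<^esub> ?C"
  proof -
    have "\<ominus>\<^bsub>poly_ring R\<^esub> ?C = poly_of_const (\<ominus> \<xi>)" using \<xi> by simp
    also have "\<dots> = [\<ominus> \<xi>]" using \<xi> by (simp add: poly_of_const_def)
    finally show ?thesis
      using \<xi> by (simp add: a_minus_def var_def univ_poly_add)
  qed
  have Lc: "?L \<in> carrier (poly_ring R)" using X C unfolding L by simp
  \<comment> \<open>The factor \<open>\<xi>\<close> in front of \<open>eval s \<xi>\<close> avoids
    an exponent n - 1, so the induction can start at n = 0 with s = 0.\<close>
  have factor: "\<exists>s \<in> carrier (poly_ring R).
      X [^]\<^bsub>poly_ring R\<^esub> n \<ominus>\<^bsub>poly_ring R\<^esub> ?C [^]\<^bsub>poly_ring R\<^esub> n = ?L \<otimes>\<^bsub>poly_ring R\<^esub> s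
      \<and> \<xi> \<otimes> eval s \<xi> = [n] \<cdot> \<one> \<otimes> \<xi> [^] n" for n :: nat
  proof (induction n)
    case 0
    show ?case
      using X C Lc by (intro bexI[of _ "\<zero>\<^bsub>poly_ring R\<^esub>"]) (auto simp: UP.r_neg a_minus_def \<xi>)
  next
    case (Suc n)
    then obtain s where s: "s \<in> carrier (poly_ring R)"
      and s_eq: "X [^]\<^bsub>poly_ring R\<^esub> n \<ominus>\<^bsub>poly_ring R\<^esub> ?C [^]\<^bsub>poly_ring R\<^esub> n = ?L \<otimes>\<^bsub>poly_ring R\<^esub> s"
      and s_ev: "\<xi> \<otimes> eval s \<xi> = [n] \<cdot> \<one> \<otimes> \<xi> [^] n" by blast
    let ?s = "X \<otimes>\<^bsub>poly_ring R\<^esub> s \<oplus>\<^bsub>poly_ring R\<^esub> ?C [^]\<^bsub>poly_ring R\<^esub> n"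
    let ?Xn = "X [^]\<^bsub>poly_ring R\<^esub> n" and ?Cn = "?C [^]\<^bsub>poly_ring R\<^esub> n"
    have cl: "?Xn \<in> carrier (poly_ring R)" "?Cn \<in> carrier (poly_ring R)" using X C by auto
    have "?L \<otimes>\<^bsub>poly_ring R\<^esub> ?s
        = X \<otimes>\<^bsub>poly_ring R\<^esub> (?L \<otimes>\<^bsub>poly_ring R\<^esub> s) \<oplus>\<^bsub>poly_ring R\<^esub> ?L \<otimes>\<^bsub>poly_ring R\<^esub> ?Cn"
      using X Lc s cl by (simp add: UP.r_distr UP.m_lcomm)
    also have "\<dots> = X [^]\<^bsub>poly_ring R\<^esub> Suc n \<ominus>\<^bsub>poly_ring R\<^esub> ?C [^]\<^bsub>poly_ring R\<^esub> Suc n"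
      unfolding s_eq[symmetric] unfolding L UP.nat_pow_Suc using X C cl by algebra
    finally have "X [^]\<^bsub>poly_ring R\<^esub> Suc n \<ominus>\<^bsub>poly_ring R\<^esub> ?C [^]\<^bsub>poly_ring R\<^esub> Suc n
        = ?L \<otimes>\<^bsub>poly_ring R\<^esub> ?s" ..
    moreover have "eval ?s \<xi> = [Suc n] \<cdot> \<one> \<otimes> \<xi> [^] n"
      using X C s cl eX eC s_ev \<xi> by (simp add: ev.hom_nat_pow l_distr)
    then have "\<xi> \<otimes> eval ?s \<xi> = [Suc n] \<cdot> \<one> \<otimes> \<xi> [^] Suc n"
      using \<xi> by (simp add: m_ac)
    ultimately show ?case using X s cl by (intro bexI[of _ ?s]) auto
  qed
  then obtain s where s: "s \<in> carrier (poly_ring R)"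
    and s_eq: "X [^]\<^bsub>poly_ring R\<^esub> p \<ominus>\<^bsub>poly_ring R\<^esub> ?C [^]\<^bsub>poly_ring R\<^esub> p = ?L \<otimes>\<^bsub>poly_ring R\<^esub> s"
    and s_ev: "\<xi> \<otimes> eval s \<xi> = [p] \<cdot> \<one> \<otimes> \<xi> [^] p" by blast
  have pol: "X [^]\<^bsub>poly_ring R\<^esub> p \<ominus>\<^bsub>poly_ring R\<^esub> poly_of_const (\<xi> [^] p) = ?L \<otimes>\<^bsub>poly_ring R\<^esub> s"
    using s_eq \<xi> by (simp add: const.hom_nat_pow)
  \<comment> \<open>Multiplicity at least 2 puts the square of the linear factor into X^p - \<xi>^p;
    cancelling one factor leaves \<open>s\<close> vanishing at \<open>\<xi>\<close>.\<close>
  have "?L [^]\<^bsub>poly_ring R\<^esub> (2::nat) pdivides f"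
    using mult by (intro le_alg_mult_imp_pdivides[OF \<xi>(1) f]) auto
  then have "?L [^]\<^bsub>poly_ring R\<^esub> (2::nat) divides\<^bsub>poly_ring R\<^esub> (?L \<otimes>\<^bsub>poly_ring R\<^esub> s)"
    using dvd pol Lc UP.divides_trans[of "?L [^]\<^bsub>poly_ring R\<^esub> (2::nat)" f "?L \<otimes>\<^bsub>poly_ring R\<^esub> s"]
    unfolding pdivides_def by simp
  then obtain m where m: "m \<in> carrier (poly_ring R)"
    "?L \<otimes>\<^bsub>poly_ring R\<^esub> s = ?L [^]\<^bsub>poly_ring R\<^esub> (2::nat) \<otimes>\<^bsub>poly_ring R\<^esub> m"
    unfolding factor_def by blast
  have "?L [^]\<^bsub>poly_ring R\<^esub> (2::nat) = ?L \<otimes>\<^bsub>poly_ring R\<^esub> ?L"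
    using Lc by (simp add: numeral_2_eq_2)
  with m Lc have "?L \<otimes>\<^bsub>poly_ring R\<^esub> s = ?L \<otimes>\<^bsub>poly_ring R\<^esub> (?L \<otimes>\<^bsub>poly_ring R\<^esub> m)"
    by (simp add: UP.m_assoc)
  then have "s = ?L \<otimes>\<^bsub>poly_ring R\<^esub> m"
    using UP.m_lcancel[of ?L s "?L \<otimes>\<^bsub>poly_ring R\<^esub> m"] Lc s m(1) by (simp add: univ_poly_zero)
  moreover have "eval ?L \<xi> = \<zero>" using \<xi> by (simp add: r_neg)
  ultimately have "eval s \<xi> = \<zero>" using ev.hom_mult[OF Lc m(1)] m(1) by simp
  then have "[p] \<cdot> \<one> \<otimes> \<xi> [^] p = \<zero>" using s_ev \<xi> by simp
  moreover have "\<xi> [^] p \<noteq> \<zero>" using \<xi> by (induction p) (auto dest: integral)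
  ultimately show False using char \<xi> integral[of "[p] \<cdot> \<one>" "\<xi> [^] p"] by auto
qed

text \<open>\<open>\<xi>\<close> is a simple root of a split polynomial of degree above 1, so a
  second root exists. As the minimal polynomial divides X^p - \<xi>^p, whose coefficients lie in
  \<open>K\<close>, that root has the same \<open>p\<close>-th power.\<close>

lemma exists_other_conjugate:
  assumes K: "subfield K R" and \<xi>: "\<xi> \<in> carrier R" "\<xi> \<noteq> \<zero>" "(algebraic over K) \<xi>" "\<xi> [^] p \<in> K"
    and deg: "degree (Irr K \<xi>) > 1" and split: "splitted (Irr K \<xi>)" and char: "[(p::nat)] \<cdot> \<one> \<noteq> \<zero>"
  obtains \<eta> where "\<eta> \<in> carrier R" "\<eta> \<noteq> \<xi>" "eval (Irr K \<xi>) \<eta> = \<zero>" "\<eta> [^] p = \<xi> [^] p"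
proof -
  have subr: "subring K R" using subfieldE(1)[OF K] .
  interpret KX: domain "K[X]" using univ_poly_is_domain[OF subr] .
  note Irr = IrrE[OF K \<xi>(1,3)]
  have Irr_c: "Irr K \<xi> \<in> carrier (poly_ring R)" using carrier_polynomial_shell[OF subr Irr(1)] .
  let ?pol = "X [^]\<^bsub>poly_ring R\<^esub> p \<ominus>\<^bsub>poly_ring R\<^esub> poly_of_const (\<xi> [^] p)"
  have const: "poly_of_const (\<xi> [^] p) \<in> carrier (K[X])"
    using ring_hom_memE(1)[OF canonical_embedding_is_hom[OF subr]] \<xi>(4) by simp
  have "?pol = X [^]\<^bsub>K[X]\<^esub> p \<ominus>\<^bsub>K[X]\<^esub> poly_of_const (\<xi> [^] p)"
    using univ_poly_a_minus_consistent[OF subr const] unitary_monom_eq_var_pow[OF subr, of p]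
      unitary_monom_eq_var_pow[OF carrier_is_subring, of p] by simp
  then have pol_K: "?pol \<in> carrier (K[X])"
    using const var_closed(1)[OF subr] by simp
  have pol_c: "?pol \<in> carrier (poly_ring R)" using carrier_polynomial_shell[OF subr pol_K] .
  have eval_pol: "eval ?pol x = x [^] p \<ominus> \<xi> [^] p" if x: "x \<in> carrier R" for x
  proof -
    interpret ev: ring_hom_ring "poly_ring R" R "\<lambda>f. eval f x"
      using eval_ring_hom[OF carrier_is_subring x] .
    interpret const: ring_hom_ring R "poly_ring R" poly_of_const
      using canonical_embedding_ring_hom[OF carrier_is_subring] by simp
    have "eval (poly_of_const (\<xi> [^] p)) x = \<xi> [^] p"
      using x \<xi> by (simp add: poly_of_const_def)
    then show ?thesis
      using var_closed(1)[OF carrier_is_subring] \<xi> x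
      by (simp add: a_minus_def ev.hom_nat_pow eval_var)
  qed
  have dvd: "Irr K \<xi> pdivides ?pol"
    using eval_pol[OF \<xi>(1)] \<xi> by (intro Irr_minimal[OF K \<xi>(1,3) pol_K]) (simp add: a_minus_def r_neg)
  have le1: "count (roots (Irr K \<xi>)) \<xi> \<le> 1"
    using alg_mult_radical_le_1[OF \<xi>(1,2) char Irr_c dvd] alg_mult_eq_count_roots[OF Irr_c] by simp
  have "\<exists>\<eta>. \<eta> \<in># roots (Irr K \<xi>) \<and> \<eta> \<noteq> \<xi>"
  proof (rule ccontr)
    assume "\<not> ?thesis"
    then have "set_mset (roots (Irr K \<xi>)) \<subseteq> {\<xi>}" by auto
    then have "roots (Irr K \<xi>) = replicate_mset (count (roots (Irr K \<xi>)) \<xi>) \<xi>"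
      by (metis set_mset_subset_singletonD count_replicate_mset)
    then have "size (roots (Irr K \<xi>)) \<le> 1" using le1 by (metis size_replicate_mset)
    then show False using split deg by (simp add: splitted_def)
  qed
  then obtain \<eta> where \<eta>: "is_root (Irr K \<xi>) \<eta>" "\<eta> \<noteq> \<xi>"
    using roots_mem_iff_is_root[OF Irr_c] by blast
  then have \<eta>_c: "\<eta> \<in> carrier R" "eval (Irr K \<xi>) \<eta> = \<zero>" by (auto simp: is_root_def)
  have "eval ?pol \<eta> = \<zero>"
    using pdivides_imp_root_sharing[OF Irr_c dvd \<eta>_c] .
  then have "\<eta> [^] p = \<xi> [^] p" using eval_pol[OF \<eta>_c(1)] \<eta>_c \<xi> by simp
  then show ?thesis using that \<eta> \<eta>_c by blast
qed

text \<open>Every element is a polynomial value at \<open>\<xi>\<close>. Replacing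
  \<open>\<xi>\<close> by \<open>\<eta>\<close> is well defined: a polynomial that vanishes at
  \<open>\<xi>\<close> is a multiple of \<open>Irr K \<xi>\<close> and so vanishes at
  \<open>\<eta>\<close>.\<close>

lemma conjugate_hom:
  assumes K: "subfield K R" and \<xi>: "\<xi> \<in> carrier R" "(algebraic over K) \<xi>" "carrier R = simple_extension K \<xi>"
    and \<eta>: "\<eta> \<in> carrier R" "eval (Irr K \<xi>) \<eta> = \<zero>"
  obtains h where "h \<in> ring_hom R R" "h \<in> extensional (carrier R)" "\<And>a. a \<in> K \<Longrightarrow> h a = a" "h \<xi> = \<eta>"
proof -
  have subr: "subring K R" using subfieldE(1)[OF K] .
  interpret KX: domain "K[X]" using univ_poly_is_domain[OF subr] .
  interpret ex: ring_hom_ring "K[X]" R "\<lambda>f. eval f \<xi>" using eval_ring_hom[OF subr \<xi>(1)] .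
  interpret ey: ring_hom_ring "K[X]" R "\<lambda>f. eval f \<eta>" using eval_ring_hom[OF subr \<eta>(1)] .
  have Irr_c: "Irr K \<xi> \<in> carrier (poly_ring R)"
    using carrier_polynomial_shell[OF subr IrrE(1)[OF K \<xi>(1,2)]] .
  have wd: "eval f \<eta> = eval g \<eta>"
    if f: "f \<in> carrier (K[X])" and g: "g \<in> carrier (K[X])" and eq: "eval f \<xi> = eval g \<xi>" for f g
  proof -
    have d: "f \<ominus>\<^bsub>K[X]\<^esub> g \<in> carrier (K[X])" using f g by simp
    have "eval (f \<ominus>\<^bsub>K[X]\<^esub> g) \<xi> = \<zero>" using f g eq by (simp add: a_minus_def r_neg)
    then have "Irr K \<xi> pdivides (f \<ominus>\<^bsub>K[X]\<^esub> g)" by (rule Irr_minimal[OF K \<xi>(1,2) d])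
    then have "eval (f \<ominus>\<^bsub>K[X]\<^esub> g) \<eta> = \<zero>"
      using pdivides_imp_root_sharing[OF Irr_c _ \<eta>] by blast
    then have "eval f \<eta> \<ominus> eval g \<eta> = \<zero>" using f g by (simp add: a_minus_def)
    then show ?thesis using f g by simp
  qed
  have surj: "\<exists>f \<in> carrier (K[X]). x = eval f \<xi>" if "x \<in> carrier R" for x
    using that simple_extension_as_eval_img[OF subringE(1)[OF subr] \<xi>(1)] \<xi>(3) by auto
  define h where "h = (\<lambda>x \<in> carrier R. eval (SOME f. f \<in> carrier (K[X]) \<and> x = eval f \<xi>) \<eta>)"
  have h: "h (eval f \<xi>) = eval f \<eta>" if f: "f \<in> carrier (K[X])" for f
  proof -
    let ?g = "SOME g. g \<in> carrier (K[X]) \<and> eval f \<xi> = eval g \<xi>"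
    have "?g \<in> carrier (K[X]) \<and> eval f \<xi> = eval ?g \<xi>"
      by (rule someI[of _ f]) (use f in simp)
    then have "eval ?g \<eta> = eval f \<eta>" using wd[of ?g f] f by simp
    then show ?thesis unfolding h_def using ex.hom_closed[OF f] by (simp only: restrict_apply')
  qed
  have "h \<in> ring_hom R R"
  proof (rule ring_hom_memI)
    fix x assume "x \<in> carrier R"
    then obtain f where f: "f \<in> carrier (K[X])" "x = eval f \<xi>" using surj by blast
    then show "h x \<in> carrier R" by (simp add: h)
    fix y assume "y \<in> carrier R"
    then obtain g where g: "g \<in> carrier (K[X])" "y = eval g \<xi>" using surj by blast
    show "h (x \<otimes> y) = h x \<otimes> h y" "h (x \<oplus> y) = h x \<oplus> h y"
      using h[of "f \<otimes>\<^bsub>K[X]\<^esub> g"] h[of "f \<oplus>\<^bsub>K[X]\<^esub> g"] f g by (simp_all add: h)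
  next
    show "h \<one> = \<one>" using h[of "\<one>\<^bsub>K[X]\<^esub>"] by simp
  qed
  moreover have "h a = a" if a: "a \<in> K" for a
  proof -
    have "a \<in> carrier R" using a subringE(1)[OF subr] by auto
    then have "eval (poly_of_const a) x = a" if "x \<in> carrier R" for x
      using that by (simp add: poly_of_const_def)
    moreover have "poly_of_const a \<in> carrier (K[X])"
      using ring_hom_memE(1)[OF canonical_embedding_is_hom[OF subr]] a by simp
    ultimately show ?thesis using h[of "poly_of_const a"] \<xi> \<eta> by simp
  qed
  moreover have "h \<xi> = \<eta>" using h[OF var_closed(1)[OF subr]] \<xi> \<eta> by (simp add: eval_var)
  moreover have "h \<in> extensional (carrier R)" by (simp add: h_def)
  ultimately show ?thesis using that by blast
qed

text \<open>By the tower law the degree of \<open>z\<close> over \<open>K\<close> divides the prime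
  \<open>p\<close>. Unless \<open>z\<close> is 1, it is a root of 1 + X + ... + X^(p-1), so this
  degree is less than \<open>p\<close> and must be 1.\<close>

lemma root_of_unity_in_subfield:
  assumes K: "subfield K R" and p: "Factorial_Ring.prime p" and dim: "dimension p K (carrier R)"
    and \<xi>: "\<xi> \<in> carrier R" "carrier R = simple_extension K \<xi>"
    and z: "z \<in> carrier R" "z [^] p = \<one>"
  shows "z \<in> K"
proof (cases "z = \<one>")
  case True
  then show ?thesis using subringE(3)[OF subfieldE(1)[OF K]] by simp
next
  case False
  have subr: "subring K R" using subfieldE(1)[OF K] .
  have p_pos: "0 < p" using p prime_gt_0_nat by blast
  have alg: "(algebraic over K) x" if "x \<in> carrier R" for x
    using finite_dimension_imp_algebraic[OF K carrier_is_subring finite_dimensionI[OF dim] that] .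
  let ?L = "simple_extension K z"
  have L: "subfield ?L R" using simple_extension_is_subfield[OF K z(1)] alg[OF z(1)] by simp
  have KL: "K \<subseteq> ?L" using simple_extension_incl[OF subringE(1)[OF subr] z(1)] .
  \<comment> \<open>The upper step of the tower is generated by the algebraic element
    \<open>\<xi>\<close>, hence finite, as the tower law requires.\<close>
  have "simple_extension ?L \<xi> = carrier R"
    using mono_simple_extension[OF KL, of \<xi>] \<xi>
      simple_extension_in_carrier[OF subringE(1)[OF subfieldE(1)[OF L]] \<xi>(1)] by auto
  then have fin: "finite_dimension ?L (carrier R)"
    using finite_dimension_simple_extension[OF L \<xi>(1)] algebraic_mono[OF KL alg[OF \<xi>(1)]] by simp
  let ?n = "degree (Irr K z)"
  note dimL = dimension_simple_extension[OF K z(1) alg[OF z(1)]]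
  have "p = ?n * (dim over ?L) (carrier R)"
    using telescopic_base_dim(2)[OF K L finite_dimensionI[OF dimL] fin] dimI[OF K dim] dimI[OF K dimL]
    by simp
  then have "?n = 1 \<or> ?n = p" using p by (metis dvd_triv_left prime_nat_iff)
  moreover have "?n < p"
  proof -
    \<comment> \<open>The coefficient list of 1 + X + ... + X^(p-1).\<close>
    let ?f = "replicate p \<one>"
    have f: "?f \<in> carrier (K[X])"
      using p_pos subringE(3)[OF subr] by (cases p) (auto simp: polynomial_def simp flip: univ_poly_carrier)
    have "eval (replicate n \<one>) z \<otimes> (z \<ominus> \<one>) = z [^] n \<ominus> \<one>
        \<and> eval (replicate n \<one>) z \<in> carrier R" for n
    proof (induction n)
      case (Suc n)
      let ?e = "eval (replicate n \<one>) z"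
      have "(z [^] n \<oplus> ?e) \<otimes> (z \<ominus> \<one>) = z [^] n \<otimes> (z \<ominus> \<one>) \<oplus> (z [^] n \<ominus> \<one>)"
        using Suc z by (simp add: l_distr)
      also have "\<dots> = z [^] n \<otimes> z \<ominus> \<one>" using z(1) nat_pow_closed[of z n] by algebra
      finally show ?case using Suc z by simp
    qed (use z in \<open>simp add: a_minus_def r_neg\<close>)
    from this[of p] have "eval ?f z \<otimes> (z \<ominus> \<one>) = \<zero>" "eval ?f z \<in> carrier R"
      using z by (simp_all add: a_minus_def r_neg)
    moreover have "z \<ominus> \<one> \<noteq> \<zero>" using False z by simp
    ultimately have "eval ?f z = \<zero>" using integral z by blast
    then have "Irr K z pdivides ?f" by (rule Irr_minimal[OF K z(1) alg[OF z(1)] f])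
    then have "?n \<le> degree ?f"
      using p_pos by (intro pdivides_imp_degree_le[OF subr IrrE(1)[OF K z(1) alg[OF z(1)]] f]) auto
    then show ?thesis using p_pos by simp
  qed
  ultimately have "?n = 1" by simp
  then obtain a b where ab: "a \<in> K" "b \<in> K" "Irr K z = [a, b]"
    using degree_oneE[OF IrrE(1)[OF K z(1) alg[OF z(1)]]] by metis
  have "a = \<one>" using IrrE(3)[OF K z(1) alg[OF z(1)]] ab by simp
  moreover have "b \<in> carrier R" using ab subringE(1)[OF subr] by auto
  ultimately have "z \<oplus> b = \<zero>" using IrrE(4)[OF K z(1) alg[OF z(1)]] ab z by simp
  then have "z = \<ominus> b" using minus_equality[of z b] z \<open>b \<in> carrier R\<close> by simp
  then show ?thesis using subringE(5)[OF subr ab(2)] by simp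
qed

end

text \<open>\<open>simple_extension\<close> is built by Horner steps from x to
  \<open>x \<otimes> \<xi> \<oplus> k\<close>. Such a step moves the coefficients one index up, and
  the top one, multiplied by \<xi>^p in \<open>F\<close>, joins \<open>k\<close> at index 0.\<close>

lemma (in field) simple_extension_radical_span:
  assumes F: "subring F R" and \<xi>: "\<xi> \<in> carrier R" "\<xi> [^] p \<in> F" and p: "0 < (p::nat)"
    and x: "x \<in> simple_extension F \<xi>"
  shows "\<exists>a \<in> {..<p} \<rightarrow> F. x = (\<Oplus>i\<in>{..<p}. a i \<otimes> \<xi> [^] i)"
  using x
proof (induction x rule: simple_extension.induct)
  case zero
  show ?case
  proof (intro bexI[of _ "\<lambda>_. \<zero>"])
    have "(\<Oplus>i\<in>{..<p}. \<zero> \<otimes> \<xi> [^] i) = \<zero>" using \<xi>(1) by (intro add.finprod_one_eqI) simp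
    then show "\<zero> = (\<Oplus>i\<in>{..<p}. \<zero> \<otimes> \<xi> [^] i)" ..
  qed (use subringE(2)[OF F] in auto)
next
  case (lin x k)
  obtain a where a: "a \<in> {..<p} \<rightarrow> F" and x: "x = (\<Oplus>i\<in>{..<p}. a i \<otimes> \<xi> [^] i)" using lin by blast
  obtain m where m: "p = Suc m" using p gr0_implies_Suc by blast
  have aF: "a i \<in> F" "a i \<in> carrier R" if "i < p" for i using a that subringE(1)[OF F] by auto
  have k: "k \<in> carrier R" using lin(2) subringE(1)[OF F] by auto
  define b where "b i = (case i of 0 \<Rightarrow> a m \<otimes> \<xi> [^] p \<oplus> k | Suc j \<Rightarrow> a j)" for i
  have bF: "b \<in> {..<p} \<rightarrow> F"
    using aF m \<xi>(2) lin(2) subringE(6,7)[OF F] by (auto simp: b_def split: nat.split)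
  have bR: "b i \<in> carrier R" if "i < p" for i using bF that subringE(1)[OF F] by auto
  let ?s = "\<Oplus>i\<in>{..<m}. a i \<otimes> \<xi> [^] Suc i"
  have s: "?s \<in> carrier R" using aF m \<xi> by (intro finsum_closed) (auto simp del: nat_pow_Suc)
  have "x \<otimes> \<xi> = (\<Oplus>i\<in>{..<p}. a i \<otimes> \<xi> [^] Suc i)"
    unfolding x using aF \<xi>
    by (subst finsum_ldistr) (auto simp: m_assoc intro!: finsum_cong')
  also have "\<dots> = ?s \<oplus> a m \<otimes> \<xi> [^] p"
    unfolding m using aF m \<xi> by (intro finsum_lessThan_Suc) (auto simp del: nat_pow_Suc)
  finally have "x \<otimes> \<xi> \<oplus> k = b 0 \<oplus> ?s"
    using s aF[of m] m k \<xi> by (simp add: b_def a_ac del: nat_pow_Suc)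
  also have "?s = (\<Oplus>i\<in>{..<m}. b (Suc i) \<otimes> \<xi> [^] Suc i)"
    by (simp add: b_def)
  also have "b 0 \<oplus> \<dots> = (\<Oplus>i\<in>{..<p}. b i \<otimes> \<xi> [^] i)"
    unfolding m using bR m \<xi> by (subst finsum_lessThan_Suc_shift) (auto simp del: nat_pow_Suc)
  finally show ?case using bF by blast
qed

lemma (in field) ring_char_subfield:
  fixes n :: nat
  assumes "subfield F R"
  shows "[n] \<cdot> \<one> = \<zero> \<longleftrightarrow> ring_char (R\<lparr>carrier := F\<rparr>) dvd n"
proof -
  interpret F: field "R\<lparr>carrier := F\<rparr>" using subfield_iff(2)[OF assms] .
  have "[n] \<cdot> \<one> = pow (add_monoid (R\<lparr>carrier := F\<rparr>)) \<one> n"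
    by (simp add: add_pow_def nat_pow_def)
  then show ?thesis
    using group.pow_eq_id[OF F.a_group, of \<one> n] F.one_closed by (simp add: ring_char_def)
qed

text \<open>The identity generates only the trivial group, so one nontrivial element
  \<open>h\<close> excludes it as a generator.\<close>

lemma galois_generator_moves:
  assumes gen: "galois_generator G F \<tau>" and h: "h \<in> carrier (galois_group G F)" "h \<noteq> (\<lambda>x \<in> carrier G. x)"
  shows "\<tau> \<noteq> (\<lambda>x \<in> carrier G. x)"
proof
  let ?id = "\<lambda>x \<in> carrier G. x"
  assume \<tau>: "\<tau> = ?id"
  have id: "?id \<in> carrier (galois_group G F)" using gen \<tau> by (simp add: galois_generator_def)
  have left: "compose (carrier G) f ?id = f" if "f \<in> carrier (galois_group G F)" for f
    using that by (auto simp: galois_group_def compose_def fun_eq_iff extensional_def)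
  \<comment> \<open>\<open>generate\<close> also adjoins inverses. This one is computed from the
    definition of \<open>m_inv\<close>, since no group axioms are established for
    \<open>galois_group G F\<close>.\<close>
  have inv: "inv\<^bsub>galois_group G F\<^esub> ?id = ?id"
    unfolding m_inv_def
  proof (rule the_equality)
    show "?id \<in> carrier (galois_group G F) \<and> ?id \<otimes>\<^bsub>galois_group G F\<^esub> ?id = \<one>\<^bsub>galois_group G F\<^esub>
        \<and> ?id \<otimes>\<^bsub>galois_group G F\<^esub> ?id = \<one>\<^bsub>galois_group G F\<^esub>"
      using id left[OF id] by (simp add: galois_group_def)
  next
    fix y
    assume "y \<in> carrier (galois_group G F) \<and> ?id \<otimes>\<^bsub>galois_group G F\<^esub> y = \<one>\<^bsub>galois_group G F\<^esub>
        \<and> y \<otimes>\<^bsub>galois_group G F\<^esub> ?id = \<one>\<^bsub>galois_group G F\<^esub>"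
    then show "y = ?id" using left[of y] by (simp add: galois_group_def)
  qed
  have "f = ?id" if "f \<in> generate (galois_group G F) {?id}" for f
    using that
  proof (induction f rule: generate.induct)
    case (eng h1 h2)
    have "h1 \<otimes>\<^bsub>galois_group G F\<^esub> h2 = compose (carrier G) h1 h2"
      by (simp add: galois_group_def)
    then show ?case unfolding eng.IH left[OF id] .
  qed (use inv in \<open>auto simp: galois_group_def\<close>)
  then show False using gen h \<tau> by (auto simp: galois_generator_def)
qed

theorem theorem9:
  fixes p :: nat and P :: "'x set" and leq :: "'x rel" and lvl :: "'x \<Rightarrow> 'x \<Rightarrow> nat"
    and G :: "'g ring" and F :: "'g set" and \<xi> q :: 'g and \<delta> \<sigma> :: "'g \<Rightarrow> 'g"
  assumes "Factorial_Ring.prime p"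
    and "equipped_poset p P leq lvl"
    and "field G" and "subfield F G"
    and "normal_extension G F"
    and "ring.dimension G p F (carrier G)"
    and "\<xi> \<in> carrier G" and "carrier G = generate_field G (insert \<xi> F)"
    and "q \<in> F" and "\<xi> [^]\<^bsub>G\<^esub> p = q"
    and "ring_char (G\<lparr>carrier := F\<rparr>) = p \<Longrightarrow> standard_derivation G F p \<xi> \<delta>"
    and "ring_char (G\<lparr>carrier := F\<rparr>) \<noteq> p \<Longrightarrow> galois_generator G F \<sigma>"
  defines "A \<equiv> opposite_algebra (end_algebra G F)"
    and "T \<equiv> (\<lambda>x y. A_layer G F (theta G F p \<delta> \<sigma>) (lvl x y))"
  shows "equivalent_categories
     (Rep G F p \<delta> \<sigma> P leq lvl
        :: (('g, 'v) module \<times> ('v \<Rightarrow> 'v) \<times> ('x \<Rightarrow> 'v set), 'v \<Rightarrow> 'v) category)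
     (Rep_alg (G\<lparr>carrier := F\<rparr>) A T P leq
        :: (('g \<Rightarrow> 'g, 'v) module \<times> ('x \<Rightarrow> 'v set), 'v \<Rightarrow> 'v) category)"
proof -
  interpret G: field G by fact
  note prime = assms(1) and F = assms(4) and xi = assms(7)
  have p_gt: "1 < p" using prime prime_gt_1_nat by blast
  have Fr: "subring F G" using subfieldE(1)[OF F] .
  have FG: "F \<subseteq> carrier G" using subringE(1)[OF Fr] .
  have alg: "(G.algebraic over F) x" if "x \<in> carrier G" for x
    using assms(5) that by (simp add: normal_extension_def over_def)
  \<comment> \<open>Since \<open>\<xi>\<close> is algebraic, its polynomial expressions over
    \<open>F\<close> already form a field.\<close>
  have ext: "carrier G = G.simple_extension F \<xi>"
  proof
    have "subfield (G.simple_extension F \<xi>) G"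
      using G.simple_extension_is_subfield[OF F xi] alg[OF xi] by simp
    then show "carrier G \<subseteq> G.simple_extension F \<xi>"
      unfolding assms(8)
      using G.simple_extension_incl[OF FG xi] G.simple_extension_mem[OF Fr xi] FG xi
      by (intro G.generate_field_min_subfield1) auto
  qed (rule G.simple_extension_in_carrier[OF FG xi])
  have xi_p: "\<xi> [^]\<^bsub>G\<^esub> p \<in> F" using assms(9,10) by simp
  interpret radical_extension G F \<xi> p
  proof (intro radical_extension.intro endomorphisms.intro endomorphisms_axioms.intro
      radical_extension_axioms.intro)
    show "\<exists>a\<in>{..<p} \<rightarrow> F. x = (\<Oplus>\<^bsub>G\<^esub>i\<in>{..<p}. a i \<otimes>\<^bsub>G\<^esub> \<xi> [^]\<^bsub>G\<^esub> i)" if "x \<in> carrier G" for x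
      using G.simple_extension_radical_span[OF Fr xi xi_p, of x] ext that p_gt by simp
  qed (use G.is_cring G.field_axioms FG p_gt xi in auto)
  show ?thesis
  proof (cases "ring_char K = p")
    case True
    have "[n] \<cdot>\<^bsub>G\<^esub> \<one>\<^bsub>G\<^esub> \<noteq> \<zero>\<^bsub>G\<^esub>" if "0 < n" "n < p" for n :: nat
      using G.ring_char_subfield[OF F, of n] True that by (auto dest: dvd_imp_le)
    then have skew: "skew_field_extension G F \<delta> (\<lambda>g. g) \<delta> \<zero>\<^bsub>G\<^esub> p"
      using skew_field_extension_derivation[OF Fr _ assms(11)[OF True]] by blast
    have theta: "theta G F p \<delta> \<sigma> = \<delta>" using True by (simp add: theta_def)
    show ?thesis
      unfolding A_def T_def theta
      by (rule skew_field_extension.Rep_equivalent[OF skew assms(2)])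
         (simp add: True twisted_module_derivation_iff[OF skew])
  next
    case False
    \<comment> \<open>Otherwise the characteristic divides the prime \<open>p\<close> without being
      \<open>p\<close>, so it is 1, which forces 1 = 0.\<close>
    have char: "[p] \<cdot>\<^bsub>G\<^esub> \<one>\<^bsub>G\<^esub> \<noteq> \<zero>\<^bsub>G\<^esub>"
    proof
      assume "[p] \<cdot>\<^bsub>G\<^esub> \<one>\<^bsub>G\<^esub> = \<zero>\<^bsub>G\<^esub>"
      then have "ring_char K = 1"
        using G.ring_char_subfield[OF F, of p] False prime by (metis prime_nat_iff)
      then show False using G.ring_char_subfield[OF F, of 1] by simp
    qed
    \<comment> \<open>For \<open>\<xi>\<close> = 0 the extension would be trivial, of dimension 1
      instead of \<open>p\<close>.\<close>
    have xi0: "\<xi> \<noteq> \<zero>\<^bsub>G\<^esub>"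
    proof
      assume "\<xi> = \<zero>\<^bsub>G\<^esub>"
      then have "carrier G \<subseteq> F"
        using ext G.simple_extension_subring_incl[OF Fr, of F \<xi>] subringE(2)[OF Fr] by simp
      then have "carrier G = F" using FG by simp
      then have "G.dimension p F F" using assms(6) by simp
      then show False using G.dimension_is_inj[OF F _ G.dimension_one[OF F]] p_gt by fastforce
    qed
    have xi_div: "x = (x \<otimes>\<^bsub>G\<^esub> inv\<^bsub>G\<^esub> \<xi>) \<otimes>\<^bsub>G\<^esub> \<xi>" if "x \<in> carrier G" for x
      using that xi xi0 by (auto simp: G.m_assoc G.field_Units)
    \<comment> \<open>Two \<open>p\<close>-th roots of the same element differ by a
      \<open>p\<close>-th root of unity, which lies in \<open>F\<close>. Applied both to the
      conjugate \<eta> and to \<open>\<sigma> \<xi>\<close>.\<close>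
    have ratio: "x \<otimes>\<^bsub>G\<^esub> inv\<^bsub>G\<^esub> \<xi> \<in> F" "(x \<otimes>\<^bsub>G\<^esub> inv\<^bsub>G\<^esub> \<xi>) [^]\<^bsub>G\<^esub> p = \<one>\<^bsub>G\<^esub>"
      if x: "x \<in> carrier G" "x [^]\<^bsub>G\<^esub> p = \<xi> [^]\<^bsub>G\<^esub> p" for x
    proof -
      have i: "inv\<^bsub>G\<^esub> \<xi> \<in> carrier G" "\<xi> \<otimes>\<^bsub>G\<^esub> inv\<^bsub>G\<^esub> \<xi> = \<one>\<^bsub>G\<^esub>"
        using xi xi0 by (auto simp: G.field_Units)
      have "(x \<otimes>\<^bsub>G\<^esub> inv\<^bsub>G\<^esub> \<xi>) [^]\<^bsub>G\<^esub> p = (\<xi> \<otimes>\<^bsub>G\<^esub> inv\<^bsub>G\<^esub> \<xi>) [^]\<^bsub>G\<^esub> p"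
        using x i(1) xi by (simp only: G.nat_pow_distrib)
      then show pow: "(x \<otimes>\<^bsub>G\<^esub> inv\<^bsub>G\<^esub> \<xi>) [^]\<^bsub>G\<^esub> p = \<one>\<^bsub>G\<^esub>" using i by simp
      show "x \<otimes>\<^bsub>G\<^esub> inv\<^bsub>G\<^esub> \<xi> \<in> F"
        using x i by (intro G.root_of_unity_in_subfield[OF F prime assms(6) xi ext _ pow]) auto
    qed
    have gen: "galois_generator G F \<sigma>" using assms(12)[OF False] .
    then have \<sigma>: "\<sigma> \<in> ring_iso G G" "\<sigma> \<in> extensional (carrier G)" "\<And>a. a \<in> F \<Longrightarrow> \<sigma> a = a"
      by (auto simp: galois_generator_def galois_group_def)
    note \<sigma>_hom = ring_iso_memE[OF \<sigma>(1)]
    have \<sigma>E: "\<sigma> \<in> carrier E"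
      using \<sigma> \<sigma>_hom FG by (auto simp: mem_E_iff PiE_iff)
    have deg: "degree (G.Irr F \<xi>) = p"
      using G.dimension_is_inj[OF F] G.dimension_simple_extension[OF F xi alg[OF xi]] ext assms(6) by metis
    note Irr = G.IrrE[OF F xi alg[OF xi]]
    have "G.splitted (G.Irr F \<xi>)"
      using assms(5) Irr xi unfolding normal_extension_def by blast
    then obtain \<eta> where \<eta>: "\<eta> \<in> carrier G" "\<eta> \<noteq> \<xi>" "G.eval (G.Irr F \<xi>) \<eta> = \<zero>\<^bsub>G\<^esub>"
      "\<eta> [^]\<^bsub>G\<^esub> p = \<xi> [^]\<^bsub>G\<^esub> p"
      using G.exists_other_conjugate[OF F xi xi0 alg[OF xi] xi_p _ _ char] deg p_gt by metis
    obtain h where h: "h \<in> ring_hom G G" "h \<in> extensional (carrier G)" "\<And>a. a \<in> F \<Longrightarrow> h a = a" "h \<xi> = \<eta>"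
      using G.conjugate_hom[OF F xi alg[OF xi] ext \<eta>(1,3)] by metis
    interpret h: ring_hom_ring G G h using h(1) by (intro ring_hom_ringI2 G.ring_axioms)
    \<comment> \<open>The image is a subring that contains \<open>F\<close> and \<eta>. With z =
      \<eta>/\<xi> in \<open>F\<close>, z^(p-1) \<eta> = z^p \<xi> = \<xi>, so it contains \<xi> and
      is everything.\<close>
    have "h ` carrier G = carrier G"
    proof
      have img: "subring (h ` carrier G) G" using h.img_is_subring[OF G.carrier_is_subring] .
      have F_img: "F \<subseteq> h ` carrier G"
      proof
        fix a assume "a \<in> F"
        then show "a \<in> h ` carrier G" using h(3) FG by (intro image_eqI[of _ _ a]) auto
      qed
      let ?z = "\<eta> \<otimes>\<^bsub>G\<^esub> inv\<^bsub>G\<^esub> \<xi>"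
      have z: "?z \<in> F" "?z \<in> carrier G" "?z [^]\<^bsub>G\<^esub> p = \<one>\<^bsub>G\<^esub>" using ratio[OF \<eta>(1,4)] FG by auto
      have "?z [^]\<^bsub>G\<^esub> (p - 1) \<otimes>\<^bsub>G\<^esub> \<eta> = ?z [^]\<^bsub>G\<^esub> (p - 1) \<otimes>\<^bsub>G\<^esub> (?z \<otimes>\<^bsub>G\<^esub> \<xi>)"
        using xi_div[OF \<eta>(1)] by simp
      also have "\<dots> = ?z [^]\<^bsub>G\<^esub> Suc (p - 1) \<otimes>\<^bsub>G\<^esub> \<xi>" using z xi by (simp add: G.m_assoc)
      also have "\<dots> = \<xi>" using z p_gt xi by (simp del: G.nat_pow_Suc)
      finally have eq: "\<xi> = ?z [^]\<^bsub>G\<^esub> (p - 1) \<otimes>\<^bsub>G\<^esub> \<eta>" ..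
      have "?z [^]\<^bsub>G\<^esub> n \<in> F" for n :: nat
        using z subringE(3,6)[OF Fr] by (induction n) auto
      then have "?z [^]\<^bsub>G\<^esub> (p - 1) \<in> h ` carrier G" "\<eta> \<in> h ` carrier G" using F_img h(4) xi by auto
      then have "\<xi> \<in> h ` carrier G" using subringE(6)[OF img] eq by metis
      then show "carrier G \<subseteq> h ` carrier G"
        using G.simple_extension_subring_incl[OF img F_img] ext by simp
    qed auto
    moreover have "inj_on h (carrier G)"
    proof (rule h.non_trivial_field_hom_imp_inj[OF G.field_axioms])
      show "h ` carrier G \<noteq> {\<zero>\<^bsub>G\<^esub>}"
        using h.hom_one G.one_closed by (metis G.zero_not_one imageI singletonD)
    qed
    ultimately have h_gal: "h \<in> carrier (galois_group G F)"
      using h by (simp add: galois_group_def ring_iso_def bij_betw_def)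
    have "h \<noteq> (\<lambda>x \<in> carrier G. x)" using h(4) \<eta>(2) xi by auto
    then have \<sigma>_id: "\<sigma> \<noteq> (\<lambda>x \<in> carrier G. x)" using galois_generator_moves[OF gen h_gal] by simp
    have \<sigma>_one: "\<sigma> \<one>\<^bsub>G\<^esub> = \<one>\<^bsub>G\<^esub>" using \<sigma>_hom(4) .
    have \<sigma>_pow: "\<sigma> (\<xi> [^]\<^bsub>G\<^esub> i) = \<sigma> \<xi> [^]\<^bsub>G\<^esub> i" for i :: nat
      by (induction i) (auto simp: \<sigma>_one \<sigma>_hom(2) xi)
    \<comment> \<open>Fixing \<xi> would mean fixing its powers, which span \<open>G\<close> over
      \<open>F\<close>.\<close>
    have \<sigma>_xi: "\<sigma> \<xi> \<noteq> \<xi>"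
    proof
      assume "\<sigma> \<xi> = \<xi>"
      then have "\<sigma> = (\<lambda>x \<in> carrier G. x)"
        using \<sigma>_pow xi by (intro E_eq_on_powers \<sigma>E in_E) auto
      then show False using \<sigma>_id by simp
    qed
    let ?z = "\<sigma> \<xi> \<otimes>\<^bsub>G\<^esub> inv\<^bsub>G\<^esub> \<xi>"
    have \<sigma>_xi_c: "\<sigma> \<xi> \<in> carrier G" using \<sigma>_hom(1) xi by simp
    have z: "?z \<in> F" "?z \<in> carrier G" "?z [^]\<^bsub>G\<^esub> p = \<one>\<^bsub>G\<^esub>" "\<sigma> \<xi> = ?z \<otimes>\<^bsub>G\<^esub> \<xi>"
      using ratio[OF \<sigma>_xi_c] \<sigma>_pow[of p] \<sigma>(3)[OF xi_p] FG xi_div[OF \<sigma>_xi_c] by auto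
    \<comment> \<open>\<open>k\<close> is coprime to the prime \<open>p\<close>. From k a = p b + 1
      and z^k = z^p = 1 follows z = 1, against \<sigma> moving \<xi>.\<close>
    have z_prim: "?z [^]\<^bsub>G\<^esub> k \<noteq> \<one>\<^bsub>G\<^esub>" if k: "0 < k" "k < p" for k :: nat
    proof
      assume zk: "?z [^]\<^bsub>G\<^esub> k = \<one>\<^bsub>G\<^esub>"
      have "coprime k p" using prime k by (metis coprime_commute nat_dvd_not_less prime_imp_coprime)
      then obtain a b where "k * a = p * b + 1"
        using bezout_nat[of k p] k by auto
      then have "?z [^]\<^bsub>G\<^esub> (k * a) = ?z [^]\<^bsub>G\<^esub> (p * b) \<otimes>\<^bsub>G\<^esub> ?z"
        using z(2) by simp
      then have "?z = \<one>\<^bsub>G\<^esub>"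
        using z(2,3) zk by (simp flip: G.nat_pow_pow)
      then show False using z(4) \<sigma>_xi xi by simp
    qed
    have skew: "skew_field_extension G F \<sigma> \<sigma> (\<lambda>_. \<zero>\<^bsub>G\<^esub>) \<one>\<^bsub>G\<^esub> p"
      using \<sigma>_hom(2) by (intro skew_field_extension_automorphism[OF \<sigma>E _ \<sigma>_one xi0 z(1,4,3) z_prim char Fr])
    have theta: "theta G F p \<delta> \<sigma> = \<sigma>" using False by (simp add: theta_def)
    show ?thesis
      unfolding A_def T_def theta
      by (rule skew_field_extension.Rep_equivalent[OF skew assms(2)])
         (simp add: False twisted_module_automorphism_iff[OF skew])
  qed
qed

end
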